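(* Let $(M,g,J)$ be a Hermitian manifold with fundamental form $\omega_g$, and let $\gamma:[a,b]\to M$ be a unit speed geodesic. Then for any smooth vector fields $V$ and $W$ along $\gamma$, the index form $I_\gamma$ can be written as $$I_\gamma(V,W)=\int_a^b\left\{\left\langle\hat{\nabla}^{\mathrm{SB}}_{\frac{d}{dt}}V,\hat{\nabla}^{\mathrm{SB}}_{\frac{d}{dt}}W\right\rangle+T^{\mathrm{SB}}\left(V,\gamma',\hat{\nabla}^{\mathrm{SB}}_{\frac{d}{dt}}W\right)-R^{\mathrm{SB}}(V,\gamma',\gamma',W)\right\}dt+\left.\frac12T^{\mathrm{SB}}(V,W,\gamma')\right|_{t=a}^{t=b}.$$ In particular, $$I_\gamma(V,V)=\int_a^b\left\{\left\langle\hat{\nabla}^{\mathrm{SB}}_{\frac{d}{dt}}V,\hat{\nabla}^{\mathrm{SB}}_{\frac{d}{dt}}V\right\rangle+T^{\mathrm{SB}}\left(V,\gamma',\hat{\nabla}^{\mathrm{SB}}_{\frac{d}{dt}}V\right)-R^{\mathrm{SB}}(V,\gamma',\gamma',V)\right\}dt.$$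
   Context: A Hermitian manifold $(M,g,J)$ is a manifold with a Riemannian metric $g=\langle\cdot,\cdot\rangle$ and an integrable complex structure $J$ with $g(JX,JY)=g(X,Y)$. Its fundamental form is $\omega_g(X,Y)=g(JX,Y)$ for real tangent vectors $X,Y$. $\nabla^{\mathrm{LC}}$ is the Levi-Civita connection of $g$; geodesics are those of $\nabla^{\mathrm{LC}}$. The Strominger-Bismut connection $\nabla^{\mathrm{SB}}$ on the real tangent bundle is the affine connection defined by $$g(\nabla_X^{\mathrm{SB}}Y,Z)=g(\nabla_X^{\mathrm{LC}}Y,Z)+\tfrac12(d\omega_g)(JX,JY,JZ);$$ it is the unique affine connection compatible with $g$ and $J$ whose torsion $T^{\mathrm{SB}}(X,Y,Z):=g(\nabla^{\mathrm{SB}}_XY-\nabla^{\mathrm{SB}}_YX-[X,Y],Z)$ is totally skew-symmetric. For $\nabla=\nabla^{\mathrm{SB}}$ or $\nabla^{\mathrm{LC}}$ the curvature tensor (denoted $R^{\mathrm{SB}}$, $R^{\mathrm{LC}}$) is $$R(X,Y,Z,W)=\left\langle\nabla_X\nabla_YZ-\nabla_Y\nabla_XZ-\nabla_{[X,Y]}Z,W\right\rangle,$$ and $\hat\nabla^{\mathrm{SB}}$, $\hat\nabla^{\mathrm{LC}}$ denote the induced connections on $\gamma^*TM$. The index form $I_\gamma:\Gamma(\gamma^*TM)\times\Gamma(\gamma^*TM)\to\mathbb{R}$ is defined by $$I_\gamma(V,W)=\int_a^b\left\{\left\langle\hat{\nabla}^{\mathrm{LC}}_{\frac{d}{dt}}V,\hat{\nabla}^{\mathrm{LC}}_{\frac{d}{dt}}W\right\rangle-R^{\mathrm{LC}}(V,\gamma',\gamma',W)\right\}dt.$$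 *)

theory Defs
  imports "HOL-Analysis.Analysis"
begin

section \<open>Smooth maps\<close>

text \<open>The derivatives are taken within the set \<open>S\<close>. The notion is meant for sets on which they are
  unique: open sets, and relatively open subsets of a compact interval \<open>{a..b}\<close> with \<open>a < b\<close>, where
  they are one-sided at \<open>a\<close> and \<open>b\<close>.\<close>

primrec Ck_on :: "nat \<Rightarrow> 'a::euclidean_space set \<Rightarrow> ('a \<Rightarrow> 'b::real_normed_vector) \<Rightarrow> bool" where
  "Ck_on 0 S f \<longleftrightarrow> continuous_on S f"
| "Ck_on (Suc k) S f \<longleftrightarrow> f differentiable_on S \<and>
     (\<forall>v. Ck_on k S (\<lambda>x. frechet_derivative f (at x within S) v))"

definition smooth_on :: "'a::euclidean_space set \<Rightarrow> ('a \<Rightarrow> 'b::real_normed_vector) \<Rightarrow> bool" where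
  "smooth_on S f \<longleftrightarrow> (\<forall>k. Ck_on k S f)"


section \<open>Smooth manifolds and tangent vectors\<close>

text \<open>The manifold is the whole type \<open>'m\<close>, with its topology, together with a smooth atlas \<open>A\<close>. A chart
  is a pair of its domain and its coordinate map; the values of the map off the domain are
  irrelevant.\<close>

type_synonym ('m, 'e) chart = "'m set \<times> ('m \<Rightarrow> 'e)"

abbreviation cdom :: "('m, 'e) chart \<Rightarrow> 'm set" where "cdom c \<equiv> fst c"

abbreviation cmap :: "('m, 'e) chart \<Rightarrow> 'm \<Rightarrow> 'e" where "cmap c \<equiv> snd c"

definition cinv :: "('m, 'e) chart \<Rightarrow> 'e \<Rightarrow> 'm" where
  "cinv c = inv_into (cdom c) (cmap c)"

definition is_chart :: "('m::topological_space, 'e::euclidean_space) chart \<Rightarrow> bool" where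
  "is_chart c \<longleftrightarrow> open (cdom c) \<and> open (cmap c ` cdom c) \<and>
     homeomorphism (cdom c) (cmap c ` cdom c) (cmap c) (cinv c)"

definition smooth_atlas :: "('m::topological_space, 'e::euclidean_space) chart set \<Rightarrow> bool" where
  "smooth_atlas A \<longleftrightarrow> (\<forall>c\<in>A. is_chart c) \<and> (\<Union>c\<in>A. cdom c) = UNIV \<and>
     (\<forall>c\<in>A. \<forall>d\<in>A. smooth_on (cmap c ` (cdom c \<inter> cdom d)) (\<lambda>x. cmap d (cinv c x)))"

text \<open>A tangent vector at \<open>p\<close> is represented by its components in one chart \<open>chart_at A p\<close> of the atlas
  around \<open>p\<close>, chosen once and for all. So every tangent space is a copy of the vector space \<open>'e\<close>, a
  vector field is a function \<open>'m \<Rightarrow> 'e\<close>, and vectors at different points are not comparable as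
  elements of \<open>'e\<close>: since \<open>chart_at A p\<close> varies with \<open>p\<close>, smoothness and derivatives of fields always
  refer to the components in a fixed chart. These are given by \<open>tcoord A c p\<close>, the differential at
  \<open>p\<close> of the coordinate map of \<open>c\<close>; \<open>tvec A c p\<close> is its inverse.\<close>

definition chart_at :: "('m, 'e) chart set \<Rightarrow> 'm \<Rightarrow> ('m, 'e) chart" where
  "chart_at A p = (SOME c. c \<in> A \<and> p \<in> cdom c)"

definition tcoord :: "('m, 'e::euclidean_space) chart set \<Rightarrow> ('m, 'e) chart \<Rightarrow> 'm \<Rightarrow> 'e \<Rightarrow> 'e" where
  "tcoord A c p v =
     frechet_derivative (\<lambda>x. cmap c (cinv (chart_at A p) x)) (at (cmap (chart_at A p) p)) v"

definition tvec :: "('m, 'e::euclidean_space) chart set \<Rightarrow> ('m, 'e) chart \<Rightarrow> 'm \<Rightarrow> 'e \<Rightarrow> 'e" where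
  "tvec A c p u = frechet_derivative (\<lambda>x. cmap (chart_at A p) (cinv c x)) (at (cmap c p)) u"

definition smooth_fun :: "('m, 'e::euclidean_space) chart set \<Rightarrow> 'm set \<Rightarrow> ('m \<Rightarrow> real) \<Rightarrow> bool" where
  "smooth_fun A U f \<longleftrightarrow> (\<forall>c\<in>A. smooth_on (cmap c ` (cdom c \<inter> U)) (\<lambda>x. f (cinv c x)))"

definition smooth_field :: "('m, 'e::euclidean_space) chart set \<Rightarrow> 'm set \<Rightarrow> ('m \<Rightarrow> 'e) \<Rightarrow> bool" where
  "smooth_field A U Y \<longleftrightarrow>
     (\<forall>c\<in>A. smooth_on (cmap c ` (cdom c \<inter> U)) (\<lambda>x. tcoord A c (cinv c x) (Y (cinv c x))))"

text \<open>\<open>dir_deriv A f p v\<close> is the derivative at \<open>p\<close> of the function \<open>f\<close> in the direction of the tangent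
  vector \<open>v\<close>, and \<open>lie_bracket A X Y p\<close> is \<open>[X, Y]\<close> at \<open>p\<close>.\<close>

definition dir_deriv :: "('m, 'e::euclidean_space) chart set \<Rightarrow> ('m \<Rightarrow> real) \<Rightarrow> 'm \<Rightarrow> 'e \<Rightarrow> real" where
  "dir_deriv A f p v =
     frechet_derivative (\<lambda>x. f (cinv (chart_at A p) x)) (at (cmap (chart_at A p) p)) v"

definition lie_bracket ::
    "('m, 'e::euclidean_space) chart set \<Rightarrow> ('m \<Rightarrow> 'e) \<Rightarrow> ('m \<Rightarrow> 'e) \<Rightarrow> 'm \<Rightarrow> 'e" where
  "lie_bracket A X Y p =
     (let c = chart_at A p; x = cmap c p; local = (\<lambda>Z y. tcoord A c (cinv c y) (Z (cinv c y)))
      in frechet_derivative (local Y) (at x) (X p) - frechet_derivative (local X) (at x) (Y p))"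

text \<open>The extension of a tangent vector \<open>v\<close> at \<open>p\<close> to the vector field near \<open>p\<close> that has constant
  components in \<open>chart_at A p\<close>. Tensors given by a formula in vector fields are evaluated on tangent
  vectors by means of it.\<close>

definition extend :: "('m, 'e::euclidean_space) chart set \<Rightarrow> 'm \<Rightarrow> 'e \<Rightarrow> 'm \<Rightarrow> 'e" where
  "extend A p v = (\<lambda>q. tvec A (chart_at A p) q v)"


section \<open>Hermitian manifolds\<close>

definition riemannian_metric ::
    "('m, 'e::euclidean_space) chart set \<Rightarrow> ('m \<Rightarrow> 'e \<Rightarrow> 'e \<Rightarrow> real) \<Rightarrow> bool" where
  "riemannian_metric A g \<longleftrightarrow>
     (\<forall>p. bilinear (g p) \<and> (\<forall>u v. g p u v = g p v u) \<and> (\<forall>v. v \<noteq> 0 \<longrightarrow> g p v v > 0)) \<and>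
     (\<forall>c\<in>A. \<forall>u v. smooth_on (cmap c ` cdom c)
        (\<lambda>x. g (cinv c x) (tvec A c (cinv c x) u) (tvec A c (cinv c x) v)))"

definition almost_complex_structure ::
    "('m, 'e::euclidean_space) chart set \<Rightarrow> ('m \<Rightarrow> 'e \<Rightarrow> 'e) \<Rightarrow> bool" where
  "almost_complex_structure A J \<longleftrightarrow>
     (\<forall>p. linear (J p) \<and> (\<forall>v. J p (J p v) = - v)) \<and>
     (\<forall>c\<in>A. \<forall>u. smooth_on (cmap c ` cdom c)
        (\<lambda>x. tcoord A c (cinv c x) (J (cinv c x) (tvec A c (cinv c x) u))))"

text \<open>Integrability is the vanishing of the Nijenhuis tensor.\<close>

definition integrable_complex_structure ::
    "('m::topological_space, 'e::euclidean_space) chart set \<Rightarrow> ('m \<Rightarrow> 'e \<Rightarrow> 'e) \<Rightarrow> bool" where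
  "integrable_complex_structure A J \<longleftrightarrow> almost_complex_structure A J \<and>
     (\<forall>U X Y. open U \<and> smooth_field A U X \<and> smooth_field A U Y \<longrightarrow>
        (\<forall>p\<in>U. lie_bracket A (\<lambda>q. J q (X q)) (\<lambda>q. J q (Y q)) p
               - J p (lie_bracket A (\<lambda>q. J q (X q)) Y p)
               - J p (lie_bracket A X (\<lambda>q. J q (Y q)) p)
               - lie_bracket A X Y p = 0))"

definition hermitian_manifold ::
    "('m::{t2_space, second_countable_topology}, 'e::euclidean_space) chart set \<Rightarrow>
     ('m \<Rightarrow> 'e \<Rightarrow> 'e \<Rightarrow> real) \<Rightarrow> ('m \<Rightarrow> 'e \<Rightarrow> 'e) \<Rightarrow> bool" where
  "hermitian_manifold A g J \<longleftrightarrow> smooth_atlas A \<and> riemannian_metric A g \<and>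
     integrable_complex_structure A J \<and> (\<forall>p u v. g p (J p u) (J p v) = g p u v)"

definition fundamental_form ::
    "('m \<Rightarrow> 'e \<Rightarrow> 'e \<Rightarrow> real) \<Rightarrow> ('m \<Rightarrow> 'e \<Rightarrow> 'e) \<Rightarrow> 'm \<Rightarrow> 'e \<Rightarrow> 'e \<Rightarrow> real" where
  "fundamental_form g J p u v = g p (J p u) v"

text \<open>The exterior derivative of a 2-form, normalised without the factor 1/3. With this
  normalisation the Strominger-Bismut connection below is compatible with \<open>J\<close>.\<close>

definition ext_deriv_fields ::
    "('m, 'e::euclidean_space) chart set \<Rightarrow> ('m \<Rightarrow> 'e \<Rightarrow> 'e \<Rightarrow> real) \<Rightarrow>
     ('m \<Rightarrow> 'e) \<Rightarrow> ('m \<Rightarrow> 'e) \<Rightarrow> ('m \<Rightarrow> 'e) \<Rightarrow> 'm \<Rightarrow> real" where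
  "ext_deriv_fields A w X Y Z p =
       dir_deriv A (\<lambda>q. w q (Y q) (Z q)) p (X p)
     - dir_deriv A (\<lambda>q. w q (X q) (Z q)) p (Y p)
     + dir_deriv A (\<lambda>q. w q (X q) (Y q)) p (Z p)
     - w p (lie_bracket A X Y p) (Z p)
     + w p (lie_bracket A X Z p) (Y p)
     - w p (lie_bracket A Y Z p) (X p)"

definition ext_deriv ::
    "('m, 'e::euclidean_space) chart set \<Rightarrow> ('m \<Rightarrow> 'e \<Rightarrow> 'e \<Rightarrow> real) \<Rightarrow> 'm \<Rightarrow> 'e \<Rightarrow> 'e \<Rightarrow> 'e \<Rightarrow> real" where
  "ext_deriv A w p x y z = ext_deriv_fields A w (extend A p x) (extend A p y) (extend A p z) p"


section \<open>Affine connections\<close>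

text \<open>\<open>D p v Y\<close> stands for \<open>(\<nabla>\<^sub>v Y)(p)\<close>, where \<open>Y\<close> is a vector field smooth on some
  neighbourhood of \<open>p\<close>. That it only depends on the values of \<open>Y\<close> near \<open>p\<close> follows from the Leibniz
  rule, because \<open>f\<close> need not be smooth off the neighbourhood \<open>U\<close>.\<close>

type_synonym ('m, 'e) connection = "'m \<Rightarrow> 'e \<Rightarrow> ('m \<Rightarrow> 'e) \<Rightarrow> 'e"

definition affine_connection ::
    "('m::topological_space, 'e::euclidean_space) chart set \<Rightarrow> ('m, 'e) connection \<Rightarrow> bool" where
  "affine_connection A D \<longleftrightarrow>
     (\<forall>U X Y Z f. open U \<and> smooth_field A U X \<and> smooth_field A U Y \<and> smooth_field A U Z \<and>
                  smooth_fun A U f \<longrightarrow>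
        smooth_field A U (\<lambda>q. D q (X q) Y) \<and>
        (\<forall>p\<in>U. linear (\<lambda>v. D p v Y) \<and>
           (\<forall>v. D p v (\<lambda>q. Y q + Z q) = D p v Y + D p v Z \<and>
                D p v (\<lambda>q. f q *\<^sub>R Y q) = dir_deriv A f p v *\<^sub>R Y p + f p *\<^sub>R D p v Y)))"

definition torsion_fields ::
    "('m, 'e::euclidean_space) chart set \<Rightarrow> ('m, 'e) connection \<Rightarrow> ('m \<Rightarrow> 'e) \<Rightarrow> ('m \<Rightarrow> 'e) \<Rightarrow> 'm \<Rightarrow> 'e"
  where
  "torsion_fields A D X Y p = D p (X p) Y - D p (Y p) X - lie_bracket A X Y p"

definition torsion ::
    "('m, 'e::euclidean_space) chart set \<Rightarrow> ('m \<Rightarrow> 'e \<Rightarrow> 'e \<Rightarrow> real) \<Rightarrow> ('m, 'e) connection \<Rightarrow>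
     'm \<Rightarrow> 'e \<Rightarrow> 'e \<Rightarrow> 'e \<Rightarrow> real" where
  "torsion A g D p x y z = g p (torsion_fields A D (extend A p x) (extend A p y) p) z"

definition curvature_fields ::
    "('m, 'e::euclidean_space) chart set \<Rightarrow> ('m, 'e) connection \<Rightarrow>
     ('m \<Rightarrow> 'e) \<Rightarrow> ('m \<Rightarrow> 'e) \<Rightarrow> ('m \<Rightarrow> 'e) \<Rightarrow> 'm \<Rightarrow> 'e" where
  "curvature_fields A D X Y Z p =
     D p (X p) (\<lambda>q. D q (Y q) Z) - D p (Y p) (\<lambda>q. D q (X q) Z) - D p (lie_bracket A X Y p) Z"

definition curvature ::
    "('m, 'e::euclidean_space) chart set \<Rightarrow> ('m \<Rightarrow> 'e \<Rightarrow> 'e \<Rightarrow> real) \<Rightarrow> ('m, 'e) connection \<Rightarrow>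
     'm \<Rightarrow> 'e \<Rightarrow> 'e \<Rightarrow> 'e \<Rightarrow> 'e \<Rightarrow> real" where
  "curvature A g D p x y z w =
     g p (curvature_fields A D (extend A p x) (extend A p y) (extend A p z) p) w"

definition levi_civita ::
    "('m::topological_space, 'e::euclidean_space) chart set \<Rightarrow> ('m \<Rightarrow> 'e \<Rightarrow> 'e \<Rightarrow> real) \<Rightarrow>
     ('m, 'e) connection \<Rightarrow> bool" where
  "levi_civita A g D \<longleftrightarrow> affine_connection A D \<and>
     (\<forall>U X Y. open U \<and> smooth_field A U X \<and> smooth_field A U Y \<longrightarrow>
        (\<forall>p\<in>U. torsion_fields A D X Y p = 0 \<and>
           (\<forall>v. dir_deriv A (\<lambda>q. g q (X q) (Y q)) p v = g p (D p v X) (Y p) + g p (X p) (D p v Y))))"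

text \<open>The argument \<open>LC\<close> is the Levi-Civita connection of \<open>g\<close>; the vector is determined by its inner
  products with all \<open>z\<close>.\<close>

definition strominger_bismut ::
    "('m, 'e::euclidean_space) chart set \<Rightarrow> ('m \<Rightarrow> 'e \<Rightarrow> 'e \<Rightarrow> real) \<Rightarrow> ('m \<Rightarrow> 'e \<Rightarrow> 'e) \<Rightarrow>
     ('m, 'e) connection \<Rightarrow> ('m, 'e) connection" where
  "strominger_bismut A g J LC p v Y =
     (THE u. \<forall>z. g p u z = g p (LC p v Y) z
        + 1/2 * ext_deriv A (fundamental_form g J) p (J p v) (J p (Y p)) (J p z))"


section \<open>Curves and the index form\<close>

definition smooth_curve ::
    "('m::topological_space, 'e::euclidean_space) chart set \<Rightarrow> real \<Rightarrow> real \<Rightarrow> (real \<Rightarrow> 'm) \<Rightarrow> bool" where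
  "smooth_curve A a b \<gamma> \<longleftrightarrow> continuous_on {a..b} \<gamma> \<and>
     (\<forall>c\<in>A. smooth_on {t \<in> {a..b}. \<gamma> t \<in> cdom c} (\<lambda>t. cmap c (\<gamma> t)))"

definition smooth_field_along ::
    "('m, 'e::euclidean_space) chart set \<Rightarrow> real \<Rightarrow> real \<Rightarrow> (real \<Rightarrow> 'm) \<Rightarrow> (real \<Rightarrow> 'e) \<Rightarrow> bool" where
  "smooth_field_along A a b \<gamma> V \<longleftrightarrow>
     (\<forall>c\<in>A. smooth_on {t \<in> {a..b}. \<gamma> t \<in> cdom c} (\<lambda>t. tcoord A c (\<gamma> t) (V t)))"

definition velocity ::
    "('m, 'e::euclidean_space) chart set \<Rightarrow> real \<Rightarrow> real \<Rightarrow> (real \<Rightarrow> 'm) \<Rightarrow> real \<Rightarrow> 'e" where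
  "velocity A a b \<gamma> t =
     vector_derivative (\<lambda>s. cmap (chart_at A (\<gamma> t)) (\<gamma> s)) (at t within {a..b})"

text \<open>The connection induced by \<open>D\<close> on the pullback of the tangent bundle: with respect to the
  coordinate frame \<open>E i\<close> (\<open>i \<in> Basis\<close>) of \<open>chart_at A (\<gamma> t)\<close>, a field \<open>V = \<Sum> V\<^sub>i E\<^sub>i\<close> along \<open>\<gamma>\<close> has the
  covariant derivative \<open>\<Sum> (V\<^sub>i' E\<^sub>i + V\<^sub>i \<nabla>\<^bsub>\<gamma>'\<^esub> E\<^sub>i)\<close>.\<close>

definition cov_along ::
    "('m, 'e::euclidean_space) chart set \<Rightarrow> ('m, 'e) connection \<Rightarrow> real \<Rightarrow> real \<Rightarrow> (real \<Rightarrow> 'm) \<Rightarrow>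
     (real \<Rightarrow> 'e) \<Rightarrow> real \<Rightarrow> 'e" where
  "cov_along A D a b \<gamma> V t =
     (let E = (\<lambda>i. extend A (\<gamma> t) i);
          comp = (\<lambda>i s. tcoord A (chart_at A (\<gamma> t)) (\<gamma> s) (V s) \<bullet> i)
      in \<Sum>i\<in>Basis. vector_derivative (comp i) (at t within {a..b}) *\<^sub>R E i (\<gamma> t)
           + comp i t *\<^sub>R D (\<gamma> t) (velocity A a b \<gamma> t) (E i))"

definition unit_speed ::
    "('m, 'e::euclidean_space) chart set \<Rightarrow> ('m \<Rightarrow> 'e \<Rightarrow> 'e \<Rightarrow> real) \<Rightarrow> real \<Rightarrow> real \<Rightarrow> (real \<Rightarrow> 'm) \<Rightarrow> bool"
  where
  "unit_speed A g a b \<gamma> \<longleftrightarrow>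
     (\<forall>t\<in>{a..b}. sqrt (g (\<gamma> t) (velocity A a b \<gamma> t) (velocity A a b \<gamma> t)) = 1)"

definition geodesic ::
    "('m::topological_space, 'e::euclidean_space) chart set \<Rightarrow> ('m, 'e) connection \<Rightarrow>
     real \<Rightarrow> real \<Rightarrow> (real \<Rightarrow> 'm) \<Rightarrow> bool" where
  "geodesic A D a b \<gamma> \<longleftrightarrow> smooth_curve A a b \<gamma> \<and>
     (\<forall>t\<in>{a..b}. cov_along A D a b \<gamma> (velocity A a b \<gamma>) t = 0)"

definition index_form ::
    "('m, 'e::euclidean_space) chart set \<Rightarrow> ('m \<Rightarrow> 'e \<Rightarrow> 'e \<Rightarrow> real) \<Rightarrow> ('m, 'e) connection \<Rightarrow>
     real \<Rightarrow> real \<Rightarrow> (real \<Rightarrow> 'm) \<Rightarrow> (real \<Rightarrow> 'e) \<Rightarrow> (real \<Rightarrow> 'e) \<Rightarrow> real" where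
  "index_form A g LC a b \<gamma> V W = integral {a..b} (\<lambda>t.
     g (\<gamma> t) (cov_along A LC a b \<gamma> V t) (cov_along A LC a b \<gamma> W t)
     - curvature A g LC (\<gamma> t) (V t) (velocity A a b \<gamma> t) (velocity A a b \<gamma> t) (W t))"

end

theory Submission
  imports Defs
begin

text \<open>
  The form \<open>T(x, y, z) = d\<omega>(Jx, Jy, Jz)\<close> is a 3-form because \<open>\<omega>\<close> is skew. Write
  \<open>T(x, y, z) = g(\<tau>(x, y), z)\<close>. Then \<open>\<nabla>\<^sup>S\<^sup>B = \<nabla>\<^sup>L\<^sup>C + \<tau>/2\<close>, and since \<open>\<nabla>\<^sup>L\<^sup>C\<close> has no torsion, \<open>T\<close> is the
  torsion of \<open>\<nabla>\<^sup>S\<^sup>B\<close>. Insert this into the covariant derivatives along the geodesic and into the curvature.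
  In the term \<open>R\<^sup>S\<^sup>B(V, \<gamma>', \<gamma>', W)\<close> everything containing \<open>\<tau>(\<gamma>', \<gamma>')\<close> vanishes, and the terms quadratic
  in \<open>\<tau>\<close> cancel against those of the other two summands. What is left of the difference of the two
  integrands is linear in \<open>T\<close>, and because \<open>\<nabla>\<^sup>L\<^sup>C \<gamma>' = 0\<close> and \<open>\<nabla>\<^sup>L\<^sup>C g = 0\<close> it is a total derivative:

    \<open>(integrand for LC) - (integrand for SB) = (d/dt) (1/2) T(V, W, \<gamma>')\<close>.

  Integration gives the first formula, and \<open>T(V, V, \<gamma>') = 0\<close> the second one. The pointwise identity is
  the bilinear algebra of \<open>index_integrand_identity\<close>; \<open>boundary_term_derivative\<close> applies it to the
  geodesic, and \<open>index_form_SB\<close> integrates.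

  The rest of the work is to compute in coordinates. A connection acts on vector fields; it is local
  (\<open>conn_local\<close>), hence given by Christoffel symbols (\<open>conn_chart\<close>), which yield the usual formulas for the
  curvature (\<open>curvature_fields_chart\<close>) and for derivatives along curves (\<open>cov_along_chart\<close>). They
  serve for both connections, because \<open>\<nabla>\<^sup>S\<^sup>B\<close> is an affine connection too (\<open>affine_connection_SB\<close>). For this \<open>\<tau>\<close>
  must be smooth, and it is, as the solution of a smooth linear system (\<open>smooth_on_linear_solve\<close>).

  The terms at a point are defined by means of a chart chosen at this point. Along the curve this
  chart jumps, so neither the continuity of the integrand, which is needed for its integrability, nor
  the derivative of the boundary term can be read off the definitions. One needs formulas in a fixed
  chart, valid at all points of its domain. For the curvature and for \<open>d\<omega>\<close> they rest on the
  invariance of the Lie bracket under changes of coordinates (\<open>lie_bracket_chart\<close>), that is, on the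
  symmetry of second derivatives (\<open>second_derivative_symmetric\<close>).
\<close>

section \<open>Smooth functions on open sets\<close>

lemma Ck_on_cong:
  assumes "\<And>x. x \<in> S \<Longrightarrow> f x = g x" "Ck_on k S f"
  shows "Ck_on k S g"
  using assms
proof (induction k arbitrary: f g)
  case 0
  then show ?case using continuous_on_cong by fastforce
next
  case (Suc k)
  have D: "(f has_derivative f') (at x within S) \<longleftrightarrow> (g has_derivative f') (at x within S)"
    if "x \<in> S" for x f'
    using Suc.prems(1) that by (metis has_derivative_transform)
  have F: "frechet_derivative f (at x within S) = frechet_derivative g (at x within S)" if "x \<in> S" for x
    using D[OF that] by (simp add: frechet_derivative_def)
  have "g differentiable_on S"
    using Suc.prems(2) D by (auto simp: differentiable_on_def differentiable_def)
  moreover have "Ck_on k S (\<lambda>x. frechet_derivative g (at x within S) v)" for v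
    using Suc.IH[of "\<lambda>x. frechet_derivative f (at x within S) v"] F Suc.prems(2) by auto
  ultimately show ?case by simp
qed

text \<open>From here on the sets are open, and the derivatives within them are full derivatives. This rule and
  the next one replace the derivative within the set by the latter; the closure properties
  below are inductions on the order of differentiability that go through them.\<close>

lemma Ck_on_SucI:
  assumes "open S" "\<And>x. x \<in> S \<Longrightarrow> (f has_derivative f' x) (at x)" "\<And>v. Ck_on k S (\<lambda>x. f' x v)"
  shows "Ck_on (Suc k) S f"
proof -
  have "f differentiable_on S"
    using assms(2) by (meson differentiable_at_imp_differentiable_on differentiable_def)
  moreover have "Ck_on k S (\<lambda>x. frechet_derivative f (at x within S) v)" for v
  proof (rule Ck_on_cong[OF _ assms(3)[of v]])
    show "f' x v = frechet_derivative f (at x within S) v" if "x \<in> S" for x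
      using frechet_derivative_at[OF assms(2)[OF that]] that assms(1) by (simp add: at_within_open_NO_MATCH)
  qed
  ultimately show ?thesis by simp
qed

lemma Ck_on_SucD:
  assumes "open S" "Ck_on (Suc k) S f"
  shows "x \<in> S \<Longrightarrow> (f has_derivative frechet_derivative f (at x)) (at x)"
    and "Ck_on k S (\<lambda>x. frechet_derivative f (at x) v)"
proof -
  show "(f has_derivative frechet_derivative f (at x)) (at x)" if "x \<in> S"
    using assms that by (simp add: differentiable_on_eq_differentiable_at frechet_derivative_works)
  have "Ck_on k S (\<lambda>x. frechet_derivative f (at x within S) v)" using assms by simp
  then show "Ck_on k S (\<lambda>x. frechet_derivative f (at x) v)"
    by (rule Ck_on_cong[rotated]) (use assms(1) in \<open>simp add: at_within_open_NO_MATCH\<close>)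
qed

lemma Ck_on_lower: "Ck_on (Suc k) S f \<Longrightarrow> Ck_on k S f"
proof (induction k arbitrary: f)
  case 0
  then show ?case by (simp add: differentiable_imp_continuous_on)
next
  case (Suc k)
  then show ?case by (metis Ck_on.simps(2))
qed

lemma Ck_on_subset:
  assumes "open S" "open T" "T \<subseteq> S" "Ck_on k S f"
  shows "Ck_on k T f"
  using assms(4)
proof (induction k arbitrary: f)
  case 0
  then show ?case using assms(3) by (auto intro: continuous_on_subset)
next
  case (Suc k)
  show ?case
    by (rule Ck_on_SucI[OF assms(2), where f' = "\<lambda>x. frechet_derivative f (at x)"])
      (use Ck_on_SucD[OF assms(1) Suc.prems] Suc.IH assms(3) in auto)
qed

lemma Ck_on_const: "open S \<Longrightarrow> Ck_on k S (\<lambda>x. c)"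
proof (induction k arbitrary: c)
  case (Suc k)
  then show ?case by (intro Ck_on_SucI[where f' = "\<lambda>x v. 0"]) auto
qed simp

lemma Ck_on_bounded_linear:
  assumes "bounded_linear h" "open S" "Ck_on k S f"
  shows "Ck_on k S (\<lambda>x. h (f x))"
  using assms(3)
proof (induction k arbitrary: f)
  case 0
  then show ?case using assms(1) by (auto intro: bounded_linear.continuous_on)
next
  case (Suc k)
  note D = Ck_on_SucD[OF assms(2) Suc.prems]
  show ?case
    by (rule Ck_on_SucI[OF assms(2), where f' = "\<lambda>x v. h (frechet_derivative f (at x) v)"])
      (auto intro!: D(2) Suc.IH bounded_linear.has_derivative[OF assms(1)] D(1))
qed

lemma Ck_on_add:
  assumes "open S" "Ck_on k S f" "Ck_on k S g"
  shows "Ck_on k S (\<lambda>x. f x + g x)"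
  using assms(2,3)
proof (induction k arbitrary: f g)
  case 0
  then show ?case by (auto intro: continuous_on_add)
next
  case (Suc k)
  note D = Ck_on_SucD[OF assms(1) Suc.prems(1)] Ck_on_SucD[OF assms(1) Suc.prems(2)]
  show ?case
    by (rule Ck_on_SucI[OF assms(1), where
          f' = "\<lambda>x v. frechet_derivative f (at x) v + frechet_derivative g (at x) v"])
      (auto intro!: D Suc.IH has_derivative_add)
qed

lemma Ck_on_sum:
  assumes "open S" "\<And>i. i \<in> I \<Longrightarrow> Ck_on k S (f i)"
  shows "Ck_on k S (\<lambda>x. \<Sum>i\<in>I. f i x)"
  using assms(2)
  by (induction I rule: infinite_finite_induct) (auto intro!: Ck_on_const Ck_on_add assms(1))

lemma Ck_on_bilinear:
  assumes "bounded_bilinear pr" "open S" "Ck_on k S f" "Ck_on k S g"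
  shows "Ck_on k S (\<lambda>x. pr (f x) (g x))"
  using assms(3,4)
proof (induction k arbitrary: f g)
  case 0
  then show ?case using bounded_bilinear.continuous_on[OF assms(1)] by auto
next
  case (Suc k)
  note D = Ck_on_SucD[OF assms(2) Suc.prems(1)] Ck_on_SucD[OF assms(2) Suc.prems(2)]
  show ?case
  proof (rule Ck_on_SucI[OF assms(2), where
        f' = "\<lambda>x v. pr (f x) (frechet_derivative g (at x) v) + pr (frechet_derivative f (at x) v) (g x)"])
    show "((\<lambda>x. pr (f x) (g x)) has_derivative (\<lambda>v. pr (f x) (frechet_derivative g (at x) v) +
        pr (frechet_derivative f (at x) v) (g x))) (at x)" if "x \<in> S" for x
      by (rule bounded_bilinear.FDERIV[OF assms(1) D(1)[OF that] D(3)[OF that]])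
    show "Ck_on k S (\<lambda>x. pr (f x) (frechet_derivative g (at x) v) +
        pr (frechet_derivative f (at x) v) (g x))" for v
      by (intro Ck_on_add assms(2) Suc.IH D(2,4) Suc.prems[THEN Ck_on_lower])
  qed
qed

text \<open>A linear map enters smoothness and differentiability only through its finitely many values on the
  basis. In this way a family of linear maps \<open>F x\<close> is handled by the functions \<open>x \<mapsto> F x u\<close> for
  constant \<open>u\<close>, without a norm on a space of linear maps. All tensors below are treated so.\<close>

lemma linear_basis_expansion:
  fixes F :: "'e::euclidean_space \<Rightarrow> 'b::real_vector"
  assumes "linear F"
  shows "F u = (\<Sum>i\<in>Basis. (u \<bullet> i) *\<^sub>R F i)"
proof -
  have "F u = F (\<Sum>i\<in>Basis. (u \<bullet> i) *\<^sub>R i)" by (simp add: euclidean_representation)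
  then show ?thesis by (simp add: linear_sum[OF assms] linear_scale[OF assms])
qed

lemma Ck_on_compose:
  fixes f :: "'b::euclidean_space \<Rightarrow> 'c::real_normed_vector" and g :: "'a::euclidean_space \<Rightarrow> 'b"
  assumes "open S" "open T" "g ` S \<subseteq> T" "Ck_on k T f" "Ck_on k S g"
  shows "Ck_on k S (\<lambda>x. f (g x))"
  using assms(4,5)
proof (induction k arbitrary: f)
  case 0
  then show ?case using assms(3) by (auto intro: continuous_on_compose2)
next
  case (Suc k)
  note D = Ck_on_SucD[OF assms(2) Suc.prems(1)] Ck_on_SucD[OF assms(1) Suc.prems(2)]
  let ?f' = "\<lambda>y. frechet_derivative f (at y)" and ?g' = "\<lambda>x. frechet_derivative g (at x)"
  show ?case
  proof (rule Ck_on_SucI[OF assms(1), where f' = "\<lambda>x v. ?f' (g x) (?g' x v)"])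
    show "((\<lambda>x. f (g x)) has_derivative (\<lambda>v. ?f' (g x) (?g' x v))) (at x)" if "x \<in> S" for x
      by (rule has_derivative_compose[OF D(3)[OF that] D(1)]) (use assms(3) that in auto)
    fix v
    \<comment> \<open>The expansion separates the point \<open>g x\<close> from the direction \<open>?g' x v\<close>, so that the induction
      hypothesis applies to the derivatives of \<open>f\<close> in constant directions.\<close>
    have "Ck_on k S (\<lambda>x. \<Sum>i\<in>Basis. (?g' x v \<bullet> i) *\<^sub>R ?f' (g x) i)"
      by (intro Ck_on_sum Ck_on_bilinear[OF bounded_bilinear_scaleR]
          Ck_on_bounded_linear[OF bounded_linear_inner_left] Suc.IH assms(1) D(2,4)
          Ck_on_lower[OF Suc.prems(2)])
    then show "Ck_on k S (\<lambda>x. ?f' (g x) (?g' x v))"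
    proof (rule Ck_on_cong[rotated])
      fix x assume "x \<in> S"
      then have "linear (?f' (g x))"
        using D(1) assms(3) by (auto intro: has_derivative_linear)
      then show "(\<Sum>i\<in>Basis. (?g' x v \<bullet> i) *\<^sub>R ?f' (g x) i) = ?f' (g x) (?g' x v)"
        by (simp add: linear_basis_expansion[of "?f' (g x)" "?g' x v"])
    qed
  qed
qed

lemma smooth_on_cong: "\<lbrakk>\<And>x. x \<in> S \<Longrightarrow> f x = g x; smooth_on S f\<rbrakk> \<Longrightarrow> smooth_on S g"
  unfolding smooth_on_def using Ck_on_cong by blast

lemma smooth_on_subset: "\<lbrakk>open S; open T; T \<subseteq> S; smooth_on S f\<rbrakk> \<Longrightarrow> smooth_on T f"
  unfolding smooth_on_def using Ck_on_subset by blast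

lemma smooth_on_const: "open S \<Longrightarrow> smooth_on S (\<lambda>x. c)"
  unfolding smooth_on_def using Ck_on_const by blast

lemma smooth_on_bounded_linear:
  "\<lbrakk>bounded_linear h; open S; smooth_on S f\<rbrakk> \<Longrightarrow> smooth_on S (\<lambda>x. h (f x))"
  unfolding smooth_on_def using Ck_on_bounded_linear by blast

lemma smooth_on_add: "\<lbrakk>open S; smooth_on S f; smooth_on S g\<rbrakk> \<Longrightarrow> smooth_on S (\<lambda>x. f x + g x)"
  unfolding smooth_on_def using Ck_on_add by blast

lemma smooth_on_minus: "\<lbrakk>open S; smooth_on S f\<rbrakk> \<Longrightarrow> smooth_on S (\<lambda>x. - f x)"
  by (rule smooth_on_bounded_linear[OF bounded_linear_minus[OF bounded_linear_ident]])

lemma smooth_on_diff: "\<lbrakk>open S; smooth_on S f; smooth_on S g\<rbrakk> \<Longrightarrow> smooth_on S (\<lambda>x. f x - g x)"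
  using smooth_on_add[of S f "\<lambda>x. - g x"] smooth_on_minus by auto

lemma smooth_on_sum:
  "\<lbrakk>open S; \<And>i. i \<in> I \<Longrightarrow> smooth_on S (f i)\<rbrakk> \<Longrightarrow> smooth_on S (\<lambda>x. \<Sum>i\<in>I. f i x)"
  unfolding smooth_on_def using Ck_on_sum[of S I] by blast

lemma smooth_on_scaleR:
  "\<lbrakk>open S; smooth_on S f; smooth_on S g\<rbrakk> \<Longrightarrow> smooth_on S (\<lambda>x. f x *\<^sub>R g x)"
  unfolding smooth_on_def using Ck_on_bilinear[OF bounded_bilinear_scaleR] by blast

lemma smooth_on_inner:
  "\<lbrakk>open S; smooth_on S f\<rbrakk> \<Longrightarrow> smooth_on S (\<lambda>x. f x \<bullet> i)"
  by (rule smooth_on_bounded_linear[OF bounded_linear_inner_left])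

lemma smooth_on_compose:
  "\<lbrakk>open S; open T; g ` S \<subseteq> T; smooth_on T f; smooth_on S g\<rbrakk> \<Longrightarrow> smooth_on S (\<lambda>x. f (g x))"
  for g :: "'a::euclidean_space \<Rightarrow> 'b::euclidean_space"
  unfolding smooth_on_def using Ck_on_compose by blast

lemma smooth_on_frechet:
  "\<lbrakk>open S; smooth_on S f\<rbrakk> \<Longrightarrow> smooth_on S (\<lambda>x. frechet_derivative f (at x) v)"
  unfolding smooth_on_def using Ck_on_SucD(2) by blast

lemma smooth_on_has_derivative:
  "\<lbrakk>open S; smooth_on S f; x \<in> S\<rbrakk> \<Longrightarrow> (f has_derivative frechet_derivative f (at x)) (at x)"
  unfolding smooth_on_def using Ck_on_SucD(1) by blast

lemma smooth_on_linear_frechet: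
  "\<lbrakk>open S; smooth_on S f; x \<in> S\<rbrakk> \<Longrightarrow> linear (frechet_derivative f (at x))"
  using smooth_on_has_derivative has_derivative_linear by blast

lemma smooth_on_continuous: "smooth_on S f \<Longrightarrow> continuous_on S f"
  unfolding smooth_on_def by (metis Ck_on.simps(1))

lemma smooth_on_linear_family:
  fixes F :: "'a::euclidean_space \<Rightarrow> 'e::euclidean_space \<Rightarrow> 'b::real_normed_vector"
  assumes "open S" "\<And>x. x \<in> S \<Longrightarrow> linear (F x)" "\<And>u. smooth_on S (\<lambda>x. F x u)" "smooth_on S w"
  shows "smooth_on S (\<lambda>x. F x (w x))"
proof (rule smooth_on_cong)
  show "(\<Sum>i\<in>Basis. (w x \<bullet> i) *\<^sub>R F x i) = F x (w x)" if "x \<in> S" for x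
    by (rule linear_basis_expansion[OF assms(2)[OF that], symmetric])
  show "smooth_on S (\<lambda>x. \<Sum>i\<in>Basis. (w x \<bullet> i) *\<^sub>R F x i)"
    by (intro smooth_on_sum smooth_on_scaleR smooth_on_inner assms)
qed

text \<open>The product rule for the evaluation of a linear map depending on \<open>s\<close> at a vector depending on \<open>s\<close>.
  The derivative \<open>F'\<close> of the family is again given by constant arguments.\<close>

lemma has_derivative_linear_family:
  fixes F :: "'s::real_normed_vector \<Rightarrow> 'e::euclidean_space \<Rightarrow> 'b::real_normed_vector"
  assumes lin: "\<And>s. s \<in> S \<Longrightarrow> linear (F s)" and x: "x \<in> S" and lin': "\<And>h. linear (F' h)"
    and F: "\<And>u. ((\<lambda>s. F s u) has_derivative (\<lambda>h. F' h u)) (at x within S)"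
    and w: "(w has_derivative w') (at x within S)"
  shows "((\<lambda>s. F s (w s)) has_derivative (\<lambda>h. F' h (w x) + F x (w' h))) (at x within S)"
proof -
  have "((\<lambda>s. \<Sum>i\<in>Basis. (w s \<bullet> i) *\<^sub>R F s i) has_derivative
      (\<lambda>h. \<Sum>i\<in>Basis. (w x \<bullet> i) *\<^sub>R F' h i + (w' h \<bullet> i) *\<^sub>R F x i)) (at x within S)"
    by (intro has_derivative_sum has_derivative_scaleR F has_derivative_inner_left w)
  moreover have "(\<Sum>i\<in>Basis. (w x \<bullet> i) *\<^sub>R F' h i + (w' h \<bullet> i) *\<^sub>R F x i) = F' h (w x) + F x (w' h)" for h
    by (simp add: sum.distrib linear_basis_expansion[OF lin', of h "w x"]
        linear_basis_expansion[OF lin[OF x], of "w' h"])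
  ultimately have "((\<lambda>s. \<Sum>i\<in>Basis. (w s \<bullet> i) *\<^sub>R F s i) has_derivative
      (\<lambda>h. F' h (w x) + F x (w' h))) (at x within S)" by simp
  then show ?thesis
    by (rule has_derivative_transform[OF x, rotated])
      (use linear_basis_expansion[OF lin] in blast)
qed

lemma has_derivative_bilinear_family:
  fixes F :: "'s::real_normed_vector \<Rightarrow> 'e::euclidean_space \<Rightarrow> 'f::euclidean_space \<Rightarrow> 'b::real_normed_vector"
  assumes bil: "\<And>s. s \<in> S \<Longrightarrow> bilinear (F s)" and x: "x \<in> S" and bil': "\<And>h. bilinear (F' h)"
    and F: "\<And>u v. ((\<lambda>s. F s u v) has_derivative (\<lambda>h. F' h u v)) (at x within S)"
    and w: "(w has_derivative w') (at x within S)" and z: "(z has_derivative z') (at x within S)"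
  shows "((\<lambda>s. F s (w s) (z s)) has_derivative
      (\<lambda>h. F' h (w x) (z x) + F x (w' h) (z x) + F x (w x) (z' h))) (at x within S)"
proof (rule has_derivative_linear_family[OF _ x _ _ z, where F' = "\<lambda>h v. F' h (w x) v + F x (w' h) v"])
  show "linear (F s (w s))" if "s \<in> S" for s using bil[OF that] by (simp add: bilinear_def)
  show "linear (\<lambda>v. F' h (w x) v + F x (w' h) v)" for h
    using bil[OF x] bil'[of h] by (auto simp: bilinear_def intro!: linear_compose_add)
  fix v
  show "((\<lambda>s. F s (w s) v) has_derivative (\<lambda>h. F' h (w x) v + F x (w' h) v)) (at x within S)"
    by (rule has_derivative_linear_family[OF _ x _ F w])
      (use bil bil' in \<open>auto simp: bilinear_def\<close>)
qed

text \<open>The derivative of a family of linear maps is linear in their argument; this supplies the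
  hypothesis on \<open>F'\<close> of the product rules above.\<close>

lemma linear_frechet_family:
  fixes F :: "'a::euclidean_space \<Rightarrow> 'e::real_vector \<Rightarrow> 'b::real_normed_vector"
  assumes S: "open S" "x \<in> S" and lin: "\<And>s. s \<in> S \<Longrightarrow> linear (F s)"
    and smooth: "\<And>u. smooth_on S (\<lambda>s. F s u)"
  shows "linear (\<lambda>u. frechet_derivative (\<lambda>s. F s u) (at x) h)"
proof (rule linearI)
  note D = smooth_on_has_derivative[OF S(1) smooth S(2)]
  fix u v :: 'e and r :: real
  have "((\<lambda>s. F s (u + v)) has_derivative
      (\<lambda>h. frechet_derivative (\<lambda>s. F s u) (at x) h + frechet_derivative (\<lambda>s. F s v) (at x) h)) (at x)"
    by (rule has_derivative_transform_within_open[OF has_derivative_add[OF D[of u] D[of v]] S])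
      (simp add: lin linear_add)
  then show "frechet_derivative (\<lambda>s. F s (u + v)) (at x) h =
      frechet_derivative (\<lambda>s. F s u) (at x) h + frechet_derivative (\<lambda>s. F s v) (at x) h"
    using frechet_derivative_at by (metis (no_types, lifting))
  have "((\<lambda>s. F s (r *\<^sub>R u)) has_derivative
      (\<lambda>h. r *\<^sub>R frechet_derivative (\<lambda>s. F s u) (at x) h)) (at x)"
    by (rule has_derivative_transform_within_open[OF has_derivative_scaleR_right[OF D[of u]] S])
      (simp add: lin linear_scale)
  then show "frechet_derivative (\<lambda>s. F s (r *\<^sub>R u)) (at x) h =
      r *\<^sub>R frechet_derivative (\<lambda>s. F s u) (at x) h"
    using frechet_derivative_at by (metis (no_types, lifting))
qed

lemma bilinear_frechet_family:
  fixes F :: "'a::euclidean_space \<Rightarrow> 'e::real_vector \<Rightarrow> 'f::real_vector \<Rightarrow> 'b::real_normed_vector"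
  assumes S: "open S" "x \<in> S" and bil: "\<And>s. s \<in> S \<Longrightarrow> bilinear (F s)"
    and smooth: "\<And>u v. smooth_on S (\<lambda>s. F s u v)"
  shows "bilinear (\<lambda>u v. frechet_derivative (\<lambda>s. F s u v) (at x) h)"
  unfolding bilinear_def
  using linear_frechet_family[OF S, of "\<lambda>s. F s u" for u]
    linear_frechet_family[OF S, of "\<lambda>s u. F s u v" for v] bil smooth
  by (auto simp: bilinear_def)

subsection \<open>Symmetry of second derivatives\<close>

text \<open>The mean value theorem, first in the direction \<open>u\<close> and then in the direction \<open>v\<close>, turns the second
  difference of \<open>f\<close> over a small parallelogram into a mixed second derivative. The second difference
  is symmetric in \<open>u\<close> and \<open>v\<close>, so the two mixed derivatives agree at points arbitrarily near to
  \<open>x\<close>, hence by continuity at \<open>x\<close>.\<close>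

lemma second_difference_mean_value:
  fixes f :: "'a::euclidean_space \<Rightarrow> real"
  assumes S: "open S" and f: "smooth_on S f" and h: "h > 0"
    and ball: "cball x (h * (norm u + norm v)) \<subseteq> S"
  obtains y where "dist x y \<le> h * (norm u + norm v)"
    and "f (x + h *\<^sub>R u + h *\<^sub>R v) - f (x + h *\<^sub>R u) - f (x + h *\<^sub>R v) + f x =
      h * h * frechet_derivative (\<lambda>z. frechet_derivative f (at z) u) (at y) v"
proof -
  let ?d = "\<lambda>z. frechet_derivative f (at z)"
  let ?d2 = "\<lambda>z. frechet_derivative (\<lambda>z. ?d z u) (at z)"
  have near: "dist x (x + s *\<^sub>R u + t *\<^sub>R v) \<le> h * (norm u + norm v)"
    if "0 \<le> s" "s \<le> h" "0 \<le> t" "t \<le> h" for s t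
  proof -
    have "x - (x + s *\<^sub>R u + t *\<^sub>R v) = - (s *\<^sub>R u + t *\<^sub>R v)" by simp
    then have "dist x (x + s *\<^sub>R u + t *\<^sub>R v) = norm (s *\<^sub>R u + t *\<^sub>R v)"
      unfolding dist_norm by (simp only: norm_minus_cancel)
    also have "\<dots> \<le> s * norm u + t * norm v"
      using norm_triangle_ineq[of "s *\<^sub>R u" "t *\<^sub>R v"] that by simp
    also have "\<dots> \<le> h * norm u + h * norm v" using that by (intro add_mono mult_right_mono) auto
    finally show ?thesis by (simp add: algebra_simps)
  qed
  then have mem: "x + s *\<^sub>R u + t *\<^sub>R v \<in> S" if "0 \<le> s" "s \<le> h" "0 \<le> t" "t \<le> h" for s t
    using ball that by (meson mem_cball subsetD)
  have df: "(f has_derivative ?d z) (at z)" if "z \<in> S" for z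
    using smooth_on_has_derivative[OF S f that] .
  have ddf: "((\<lambda>z. ?d z u) has_derivative ?d2 z) (at z)" if "z \<in> S" for z
    using smooth_on_has_derivative[OF S smooth_on_frechet[OF S f] that] .
  define p where "p = (\<lambda>s. f (x + s *\<^sub>R u + h *\<^sub>R v) - f (x + s *\<^sub>R u))"
  have along_u: "((\<lambda>s. f (x + s *\<^sub>R u + t *\<^sub>R v)) has_real_derivative ?d (x + s *\<^sub>R u + t *\<^sub>R v) u) (at s)"
    if "0 \<le> s" "s \<le> h" "0 \<le> t" "t \<le> h" for s t
  proof -
    have "((\<lambda>s. f (x + s *\<^sub>R u + t *\<^sub>R v)) has_derivative
        (\<lambda>r. ?d (x + s *\<^sub>R u + t *\<^sub>R v) (r *\<^sub>R u))) (at s)"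
      by (rule has_derivative_compose[where f = "\<lambda>s. x + s *\<^sub>R u + t *\<^sub>R v", OF _ df[OF mem[OF that]]])
        (auto intro!: derivative_eq_intros)
    moreover have "?d (x + s *\<^sub>R u + t *\<^sub>R v) (r *\<^sub>R u) = ?d (x + s *\<^sub>R u + t *\<^sub>R v) u * r" for r
      using linear_scale[OF smooth_on_linear_frechet[OF S f mem[OF that]]] by simp
    ultimately show ?thesis by (simp add: has_field_derivative_def)
  qed
  have "\<exists>s>0. s < h \<and> p h - p 0 = (h - 0) * (?d (x + s *\<^sub>R u + h *\<^sub>R v) u - ?d (x + s *\<^sub>R u + 0 *\<^sub>R v) u)"
    unfolding p_def
    by (rule MVT2[OF h]) (use along_u[of _ h] along_u[of _ 0] h in \<open>auto intro!: DERIV_diff\<close>)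
  then obtain s where s: "0 < s" "s < h"
    "p h - p 0 = h * (?d (x + s *\<^sub>R u + h *\<^sub>R v) u - ?d (x + s *\<^sub>R u) u)" by auto
  have along_v: "((\<lambda>t. ?d (x + s *\<^sub>R u + t *\<^sub>R v) u) has_real_derivative ?d2 (x + s *\<^sub>R u + t *\<^sub>R v) v) (at t)"
    if "0 \<le> t" "t \<le> h" for t
  proof -
    have m: "x + s *\<^sub>R u + t *\<^sub>R v \<in> S" using mem s that by simp
    have "((\<lambda>t. ?d (x + s *\<^sub>R u + t *\<^sub>R v) u) has_derivative
        (\<lambda>r. ?d2 (x + s *\<^sub>R u + t *\<^sub>R v) (r *\<^sub>R v))) (at t)"
      by (rule has_derivative_compose[where f = "\<lambda>t. x + s *\<^sub>R u + t *\<^sub>R v", OF _ ddf[OF m]])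
        (auto intro!: derivative_eq_intros)
    moreover have "?d2 (x + s *\<^sub>R u + t *\<^sub>R v) (r *\<^sub>R v) = ?d2 (x + s *\<^sub>R u + t *\<^sub>R v) v * r" for r
      using linear_scale[OF has_derivative_linear[OF ddf[OF m]]] by simp
    ultimately show ?thesis by (simp add: has_field_derivative_def)
  qed
  have "\<exists>t>0. t < h \<and> ?d (x + s *\<^sub>R u + h *\<^sub>R v) u - ?d (x + s *\<^sub>R u + 0 *\<^sub>R v) u =
      (h - 0) * ?d2 (x + s *\<^sub>R u + t *\<^sub>R v) v"
    by (rule MVT2[OF h]) (use along_v in auto)
  then obtain t where t: "0 < t" "t < h"
    "?d (x + s *\<^sub>R u + h *\<^sub>R v) u - ?d (x + s *\<^sub>R u) u = h * ?d2 (x + s *\<^sub>R u + t *\<^sub>R v) v" by auto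
  show ?thesis
    by (rule that[of "x + s *\<^sub>R u + t *\<^sub>R v"]) (use near s t in \<open>auto simp: p_def\<close>)
qed

lemma second_derivative_symmetric_real:
  fixes f :: "'a::euclidean_space \<Rightarrow> real"
  assumes S: "open S" "x \<in> S" and f: "smooth_on S f"
  shows "frechet_derivative (\<lambda>z. frechet_derivative f (at z) u) (at x) v =
    frechet_derivative (\<lambda>z. frechet_derivative f (at z) v) (at x) u"
proof (rule ccontr)
  let ?F = "\<lambda>u v y. frechet_derivative (\<lambda>z. frechet_derivative f (at z) u) (at y) v"
  assume ne: "?F u v x \<noteq> ?F v u x"
  define e where "e = \<bar>?F u v x - ?F v u x\<bar> / 2"
  have e: "e > 0" using ne by (simp add: e_def)
  have cont: "isCont (?F u v) x" for u v
    using smooth_on_continuous[OF smooth_on_frechet[OF S(1) smooth_on_frechet[OF S(1) f]]] S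
    by (simp add: continuous_on_eq_continuous_at)
  obtain d1 d2 where d: "d1 > 0" "d2 > 0"
    "\<And>y. dist y x < d1 \<Longrightarrow> dist (?F u v y) (?F u v x) < e"
    "\<And>y. dist y x < d2 \<Longrightarrow> dist (?F v u y) (?F v u x) < e"
    using cont[of u v] cont[of v u] e unfolding continuous_at_eps_delta by (metis dist_commute)
  obtain d3 where d3: "d3 > 0" "cball x d3 \<subseteq> S" using S open_contains_cball by blast
  define n where "n = norm u + norm v + 1"
  \<comment> \<open>The parallelogram of size \<open>h\<close> lies in \<open>S\<close> and within both distances of continuity.\<close>
  define h where "h = min d3 (min d1 d2) / (2 * n)"
  have n: "n > 0" by (simp add: n_def add_nonneg_pos)
  have h: "h > 0" using n d d3 by (simp add: h_def)
  have "h * (norm u + norm v) < h * n" using h by (simp add: n_def)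
  also have "\<dots> \<le> h * n * 2" using h n by simp
  also have "h * n * 2 = min d3 (min d1 d2)" using n by (simp add: h_def)
  finally have b: "h * (norm u + norm v) < min d3 (min d1 d2)" .
  then have "cball x (h * (norm u + norm v)) \<subseteq> cball x d3" by (intro subset_cball) simp
  then have ball: "cball x (h * (norm u + norm v)) \<subseteq> S" using d3(2) by (rule subset_trans)
  then have ball': "cball x (h * (norm v + norm u)) \<subseteq> S" by (simp only: add.commute)
  obtain y where y: "dist x y \<le> h * (norm u + norm v)"
    "f (x + h *\<^sub>R u + h *\<^sub>R v) - f (x + h *\<^sub>R u) - f (x + h *\<^sub>R v) + f x = h * h * ?F u v y"
    using second_difference_mean_value[OF S(1) f h ball] by blast
  obtain z where z: "dist x z \<le> h * (norm v + norm u)"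
    "f (x + h *\<^sub>R v + h *\<^sub>R u) - f (x + h *\<^sub>R v) - f (x + h *\<^sub>R u) + f x = h * h * ?F v u z"
    using second_difference_mean_value[OF S(1) f h ball'] by blast
  have "h * h * ?F u v y = h * h * ?F v u z"
  proof -
    have "x + h *\<^sub>R v + h *\<^sub>R u = x + h *\<^sub>R u + h *\<^sub>R v" by (simp add: algebra_simps)
    with y(2) z(2) show ?thesis by (smt (verit))
  qed
  then have "?F u v y = ?F v u z" using h by simp
  moreover have "dist (?F u v y) (?F u v x) < e" "dist (?F v u z) (?F v u x) < e"
    using d(3)[of y] d(4)[of z] y(1) z(1) b by (auto simp: dist_commute add.commute)
  ultimately have "dist (?F u v x) (?F v u x) < e + e"
    using dist_triangle3[of "?F u v x" "?F v u x" "?F u v y"] by simp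
  then show False by (simp add: e_def dist_real_def)
qed

lemma second_derivative_symmetric:
  fixes f :: "'a::euclidean_space \<Rightarrow> 'b::euclidean_space"
  assumes S: "open S" "x \<in> S" and f: "smooth_on S f"
  shows "frechet_derivative (\<lambda>z. frechet_derivative f (at z) u) (at x) v =
    frechet_derivative (\<lambda>z. frechet_derivative f (at z) v) (at x) u"
proof (rule euclidean_eqI)
  fix i :: 'b
  have comp: "frechet_derivative (\<lambda>z. frechet_derivative f (at z) u) (at x) v \<bullet> i =
      frechet_derivative (\<lambda>z. frechet_derivative (\<lambda>y. f y \<bullet> i) (at z) u) (at x) v" for u v
  proof -
    have 1: "frechet_derivative (\<lambda>y. f y \<bullet> i) (at z) = (\<lambda>w. frechet_derivative f (at z) w \<bullet> i)"
      if "z \<in> S" for z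
      using has_derivative_inner_left[OF smooth_on_has_derivative[OF S(1) f that]]
      by (metis frechet_derivative_at)
    have "((\<lambda>z. frechet_derivative f (at z) u \<bullet> i) has_derivative
        (\<lambda>v. frechet_derivative (\<lambda>z. frechet_derivative f (at z) u) (at x) v \<bullet> i)) (at x)"
      by (rule has_derivative_inner_left[OF smooth_on_has_derivative[OF S(1) smooth_on_frechet[OF S(1) f] S(2)]])
    then have "((\<lambda>z. frechet_derivative (\<lambda>y. f y \<bullet> i) (at z) u) has_derivative
        (\<lambda>v. frechet_derivative (\<lambda>z. frechet_derivative f (at z) u) (at x) v \<bullet> i)) (at x)"
      by (rule has_derivative_transform_within_open[OF _ S]) (simp add: 1)
    then show ?thesis by (metis frechet_derivative_at)
  qed
  show "frechet_derivative (\<lambda>z. frechet_derivative f (at z) u) (at x) v \<bullet> i =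
    frechet_derivative (\<lambda>z. frechet_derivative f (at z) v) (at x) u \<bullet> i"
    unfolding comp
    by (rule second_derivative_symmetric_real[OF S smooth_on_inner[OF S(1) f]])
qed

subsection \<open>Smooth dependence of the solution of a linear system\<close>

text \<open>An injective linear map on a finite-dimensional space is bounded below, and a small perturbation
  costs at most half of the bound.\<close>

lemma linear_solve_bound:
  fixes B :: "'a::euclidean_space \<Rightarrow> 'e::euclidean_space \<Rightarrow> 'e"
  assumes S: "open S" "x \<in> S" and lin: "\<And>y. y \<in> S \<Longrightarrow> linear (B y)" and inj: "inj (B x)"
    and cont: "\<And>u. continuous_on S (\<lambda>y. B y u)"
  obtains m where "m > 0" "\<forall>\<^sub>F y in at x. \<forall>u. m * norm u \<le> norm (B y u)"
proof -
  obtain m where m: "m > 0" "\<And>u. m * norm u \<le> norm (B x u)"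
    using linear_inj_bounded_below_pos[OF lin[OF S(2)] inj] by blast
  have "((\<lambda>y. \<Sum>i\<in>Basis. norm (B y i - B x i)) \<longlongrightarrow> (\<Sum>i\<in>Basis. norm (B x i - B x i))) (at x)"
    using cont S by (intro tendsto_intros) (auto simp: continuous_on_eq_continuous_at isCont_def)
  then have "\<forall>\<^sub>F y in at x. (\<Sum>i\<in>Basis. norm (B y i - B x i)) < m / 2"
    using m(1) by (intro order_tendstoD) auto
  moreover have "\<forall>\<^sub>F y in at x. y \<in> S" using S eventually_at_in_open' by blast
  ultimately have "\<forall>\<^sub>F y in at x. \<forall>u. m / 2 * norm u \<le> norm (B y u)"
  proof eventually_elim
    case (elim y)
    show ?case
    proof
      fix u
      have "norm (B y u - B x u) = norm (\<Sum>i\<in>Basis. (u \<bullet> i) *\<^sub>R (B y i - B x i))"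
        using linear_basis_expansion[OF lin[OF elim(2)], of u] linear_basis_expansion[OF lin[OF S(2)], of u]
        by (simp add: sum_subtractf scaleR_diff_right)
      also have "\<dots> \<le> (\<Sum>i\<in>Basis. norm u * norm (B y i - B x i))"
        by (rule order_trans[OF norm_sum]) (auto intro!: sum_mono mult_right_mono Basis_le_norm)
      also have "\<dots> = norm u * (\<Sum>i\<in>Basis. norm (B y i - B x i))" by (simp add: sum_distrib_left)
      also have "\<dots> \<le> norm u * (m / 2)" using elim(1) by (intro mult_left_mono) auto
      finally show "m / 2 * norm u \<le> norm (B y u)"
        using m(2)[of u] norm_triangle_ineq2[of "B x u" "B y u"]
        by (simp add: norm_minus_commute mult.commute[of m])
    qed
  qed
  then show ?thesis using that[of "m / 2"] m(1) by simp
qed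

text \<open>Formally \<open>f = B\<^sup>-\<^sup>1 h\<close>, and differentiating \<open>B f = h\<close> gives \<open>f' = B\<^sup>-\<^sup>1 (h' - B' f)\<close>.\<close>

lemma linear_solve_has_derivative:
  fixes B :: "'a::euclidean_space \<Rightarrow> 'e::euclidean_space \<Rightarrow> 'e"
  assumes S: "open S" "x \<in> S" and lin: "\<And>y. y \<in> S \<Longrightarrow> linear (B y)" and inj: "inj (B x)"
    and B: "\<And>u. smooth_on S (\<lambda>y. B y u)"
    and sol: "\<And>y. y \<in> S \<Longrightarrow> B y (f y) = h y"
    and h: "(h has_derivative h') (at x)"
  shows "(f has_derivative
    (\<lambda>v. inv (B x) (h' v - frechet_derivative (\<lambda>y. B y (f x)) (at x) v))) (at x)"
proof -
  define B' where "B' = (\<lambda>v u. frechet_derivative (\<lambda>y. B y u) (at x) v)"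
  define L where "L = (\<lambda>v. inv (B x) (h' v - B' v (f x)))"
  have surj: "surj (B x)" using inj lin[OF S(2)] linear_injective_imp_surjective by blast
  have dB: "((\<lambda>y. B y u) has_derivative (\<lambda>v. B' v u)) (at x)" for u
    unfolding B'_def by (rule smooth_on_has_derivative[OF S(1) B S(2)])
  have linL: "linear L"
    unfolding L_def
    using linear_compose[of "\<lambda>v. h' v - B' v (f x)" "inv (B x)"] has_derivative_linear[OF h]
      has_derivative_linear[OF dB[of "f x"]] inj_linear_imp_inv_linear[OF lin[OF S(2)] inj]
    by (auto simp: o_def linear_compose_sub)
  have BL: "B x (L v) = h' v - B' v (f x)" for v
    unfolding L_def using surj by (simp add: surj_f_inv_f)
  \<comment> \<open>\<open>r\<close> is the image under \<open>B y\<close> of the error of the linear approximation \<open>L\<close> of \<open>f\<close>. It vanishes to first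
    order at \<open>x\<close>, and the lower bound for \<open>B y\<close> carries this over to the error.\<close>
  define r where "r = (\<lambda>y. h y - B y (f x) - B y (L (y - x)))"
  have "((\<lambda>y. B y (L (y - x))) has_derivative (\<lambda>v. B' v (L (x - x)) + B x (L v))) (at x within S)"
  proof (rule has_derivative_linear_family[OF lin S(2)])
    show "linear (B' k)" for k
      unfolding B'_def by (rule linear_frechet_family[OF S lin B])
    show "((\<lambda>y. B y u) has_derivative (\<lambda>k. B' k u)) (at x within S)" for u
      using dB has_derivative_at_withinI by blast
    have "((\<lambda>y. y - x) has_derivative (\<lambda>v. v)) (at x within S)"
      by (auto intro!: derivative_eq_intros)
    then show "((\<lambda>y. L (y - x)) has_derivative L) (at x within S)"
      using linL bounded_linear.has_derivative[of L "\<lambda>y. y - x" "\<lambda>v. v" "at x within S"]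
      by (simp add: linear_conv_bounded_linear)
  qed
  then have "((\<lambda>y. B y (L (y - x))) has_derivative (\<lambda>v. B' v (L (x - x)) + B x (L v))) (at x)"
    using S by (simp add: at_within_open_NO_MATCH)
  then have "(r has_derivative (\<lambda>v. h' v - B' v (f x) - (B' v (L (x - x)) + B x (L v)))) (at x)"
    unfolding r_def by (intro has_derivative_diff h dB)
  moreover have "B' v 0 = 0" for v
    using linear_0[OF linear_frechet_family[OF S lin B]] by (simp add: B'_def)
  ultimately have "(r has_derivative (\<lambda>v. 0)) (at x)"
    using linear_0[OF linL] by (simp add: BL)
  moreover have "r x = 0"
    using sol[OF S(2)] linear_0[OF linL] linear_0[OF lin[OF S(2)]] by (simp add: r_def)
  ultimately have r0: "((\<lambda>y. norm (r y) / norm (y - x)) \<longlongrightarrow> 0) (at x)"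
    by (simp add: has_derivative_iff_norm)
  obtain m where m: "m > 0" "\<forall>\<^sub>F y in at x. \<forall>u. m * norm u \<le> norm (B y u)"
    using linear_solve_bound[OF S lin inj smooth_on_continuous[OF B]] by blast
  have S': "\<forall>\<^sub>F y in at x. y \<in> S" using S eventually_at_in_open' by blast
  have "((\<lambda>y. norm (f y - f x - L (y - x)) / norm (y - x)) \<longlongrightarrow> 0) (at x)"
  proof (rule Lim_null_comparison)
    show "((\<lambda>y. (1 / m) * (norm (r y) / norm (y - x))) \<longlongrightarrow> 0) (at x)"
      using tendsto_mult_right_zero[OF r0] by blast
    show "\<forall>\<^sub>F y in at x. norm (norm (f y - f x - L (y - x)) / norm (y - x)) \<le>
        (1 / m) * (norm (r y) / norm (y - x))"
      using m(2) S'
    proof eventually_elim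
      case (elim y)
      have "B y (f y - f x - L (y - x)) = r y"
        using lin[OF elim(2)] sol[OF elim(2)] by (simp add: r_def linear_diff)
      then have "m * norm (f y - f x - L (y - x)) \<le> norm (r y)" using elim(1) by metis
      then have "norm (f y - f x - L (y - x)) \<le> norm (r y) / m"
        using m(1) by (simp add: field_simps)
      from divide_right_mono[OF this, of "norm (y - x)"] show ?case by simp
    qed
  qed
  then have "(f has_derivative L) (at x)"
    using linL by (simp add: has_derivative_iff_norm linear_conv_bounded_linear)
  then show ?thesis by (simp add: L_def B'_def)
qed

text \<open>The solution of a smooth regular linear system is smooth: by \<open>linear_solve_has_derivative\<close> its
  derivatives solve a system with the same matrix, whose right-hand side has one degree
  of differentiability less. This replaces the smoothness of the inverse of the metric.\<close>

lemma smooth_on_linear_solve: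
  fixes B :: "'a::euclidean_space \<Rightarrow> 'e::euclidean_space \<Rightarrow> 'e"
  assumes S: "open S" and lin: "\<And>y. y \<in> S \<Longrightarrow> linear (B y)" and inj: "\<And>y. y \<in> S \<Longrightarrow> inj (B y)"
    and B: "\<And>u. smooth_on S (\<lambda>y. B y u)"
    and sol: "\<And>y. y \<in> S \<Longrightarrow> B y (f y) = h y" and h: "smooth_on S h"
  shows "smooth_on S f"
proof -
  have "Ck_on k S f" if "\<And>y. y \<in> S \<Longrightarrow> B y (f y) = h y" "Ck_on k S h" for k f h
    using that
  proof (induction k arbitrary: f h)
    case 0
    have "(f \<longlongrightarrow> f x) (at x)" if x: "x \<in> S" for x
    proof -
      obtain m where m: "m > 0" "\<forall>\<^sub>F y in at x. \<forall>u. m * norm u \<le> norm (B y u)"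
        using linear_solve_bound[OF S x lin inj[OF x] smooth_on_continuous[OF B]] by blast
      have "(h \<longlongrightarrow> h x) (at x)" "((\<lambda>y. B y (f x)) \<longlongrightarrow> B x (f x)) (at x)"
        using 0(2) smooth_on_continuous[OF B] S x
        by (auto simp: continuous_on_eq_continuous_at isCont_def)
      then have "((\<lambda>y. (1 / m) * norm (h y - B y (f x))) \<longlongrightarrow> (1 / m) * norm (h x - B x (f x))) (at x)"
        by (intro tendsto_intros)
      then have lim: "((\<lambda>y. (1 / m) * norm (h y - B y (f x))) \<longlongrightarrow> 0) (at x)"
        using 0(1)[OF x] by simp
      have S': "\<forall>\<^sub>F y in at x. y \<in> S" using S x eventually_at_in_open' by blast
      have "((\<lambda>y. f y - f x) \<longlongrightarrow> 0) (at x)"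
      proof (rule Lim_null_comparison[OF _ lim])
        show "\<forall>\<^sub>F y in at x. norm (f y - f x) \<le> (1 / m) * norm (h y - B y (f x))"
          using m(2) S'
        proof eventually_elim
          case (elim y)
          have "B y (f y - f x) = h y - B y (f x)"
            using lin[OF elim(2)] 0(1)[OF elim(2)] by (simp add: linear_diff)
          then have "m * norm (f y - f x) \<le> norm (h y - B y (f x))" using elim(1) by metis
          then show ?case using m(1) by (simp add: field_simps)
        qed
      qed
      then show ?thesis by (simp add: LIM_zero_iff)
    qed
    then show ?case using S by (simp add: continuous_on_eq_continuous_at isCont_def)
  next
    case (Suc k)
    let ?r = "\<lambda>v x. frechet_derivative h (at x) v - frechet_derivative (\<lambda>y. B y (f x)) (at x) v"
    have "Ck_on k S f" using Suc.IH[OF Suc.prems(1) Ck_on_lower[OF Suc.prems(2)]] by simp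
    then have "Ck_on k S (\<lambda>x. \<Sum>i\<in>Basis. (f x \<bullet> i) *\<^sub>R frechet_derivative (\<lambda>y. B y i) (at x) v)" for v
      using smooth_on_frechet[OF S B] S
      by (intro Ck_on_sum Ck_on_bilinear[OF bounded_bilinear_scaleR]
          Ck_on_bounded_linear[OF bounded_linear_inner_left]) (auto simp: smooth_on_def)
    then have "Ck_on k S (\<lambda>x. frechet_derivative (\<lambda>y. B y (f x)) (at x) v)" for v
      by (rule Ck_on_cong[rotated])
        (rule linear_basis_expansion[OF linear_frechet_family[OF S _ lin B], symmetric])
    then have r: "Ck_on k S (?r v)" for v
      using Ck_on_add[OF S Ck_on_SucD(2)[OF S Suc.prems(2)]
          Ck_on_bounded_linear[OF bounded_linear_minus[OF bounded_linear_ident] S]] by fastforce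
    show ?case
    proof (rule Ck_on_SucI[OF S, where f' = "\<lambda>x v. inv (B x) (?r v x)"])
      show "(f has_derivative (\<lambda>v. inv (B x) (?r v x))) (at x)" if "x \<in> S" for x
        by (rule linear_solve_has_derivative[OF S that lin inj[OF that] B Suc.prems(1)
              Ck_on_SucD(1)[OF S Suc.prems(2) that]])
      have "B y (inv (B y) (?r v y)) = ?r v y" if "y \<in> S" for v y
        using linear_injective_imp_surjective[OF lin[OF that] inj[OF that]] by (simp add: surj_f_inv_f)
      then show "Ck_on k S (\<lambda>x. inv (B x) (?r v x))" for v
        using Suc.IH[of "\<lambda>x. inv (B x) (?r v x)", OF _ r[of v]] by blast
    qed
  qed
  then show ?thesis using sol h by (simp add: smooth_on_def)
qed

section \<open>Calculus along curves\<close>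

lemma continuous_on_linear_family:
  fixes F :: "'s::topological_space \<Rightarrow> 'e::euclidean_space \<Rightarrow> 'b::real_normed_vector"
  assumes "\<And>s. s \<in> S \<Longrightarrow> linear (F s)" "\<And>u. continuous_on S (\<lambda>s. F s u)" "continuous_on S w"
  shows "continuous_on S (\<lambda>s. F s (w s))"
proof -
  have "continuous_on S (\<lambda>s. \<Sum>i\<in>Basis. (w s \<bullet> i) *\<^sub>R F s i)"
    by (intro continuous_intros assms)
  then show ?thesis
    by (rule continuous_on_cong[THEN iffD1, rotated 2])
      (simp_all add: linear_basis_expansion[OF assms(1), symmetric])
qed

lemma continuous_on_bilinear_family:
  fixes F :: "'s::topological_space \<Rightarrow> 'e::euclidean_space \<Rightarrow> 'f::euclidean_space \<Rightarrow> 'b::real_normed_vector"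
  assumes "\<And>s. s \<in> S \<Longrightarrow> bilinear (F s)" "\<And>u v. continuous_on S (\<lambda>s. F s u v)"
    "continuous_on S w" "continuous_on S z"
  shows "continuous_on S (\<lambda>s. F s (w s) (z s))"
proof (rule continuous_on_linear_family[OF _ _ assms(4)])
  show "linear (F s (w s))" if "s \<in> S" for s using assms(1)[OF that] by (simp add: bilinear_def)
  show "continuous_on S (\<lambda>s. F s (w s) v)" for v
    by (rule continuous_on_linear_family[where F = "\<lambda>s u. F s u v", OF _ assms(2,3)])
      (use assms(1) in \<open>auto simp: bilinear_def\<close>)
qed

lemma has_vector_derivative_bilinear_family:
  fixes F :: "'a::euclidean_space \<Rightarrow> 'e::euclidean_space \<Rightarrow> 'f::euclidean_space \<Rightarrow> 'b::real_normed_vector"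
  assumes Q: "open Q" and F: "\<And>u v. smooth_on Q (\<lambda>x. F x u v)" and bil: "\<And>x. x \<in> Q \<Longrightarrow> bilinear (F x)"
    and X: "\<And>s. s \<in> S \<Longrightarrow> X s \<in> Q" "(X has_vector_derivative X') (at t within S)" and t: "t \<in> S"
    and u: "(u has_vector_derivative u') (at t within S)" and v: "(v has_vector_derivative v') (at t within S)"
  shows "((\<lambda>s. F (X s) (u s) (v s)) has_vector_derivative
    (frechet_derivative (\<lambda>x. F x (u t) (v t)) (at (X t)) X' + F (X t) u' (v t) + F (X t) (u t) v'))
    (at t within S)"
proof -
  let ?F' = "\<lambda>h u v. frechet_derivative (\<lambda>x. F x u v) (at (X t)) (h *\<^sub>R X')"
  have "((\<lambda>s. F (X s) (u s) (v s)) has_derivative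
      (\<lambda>h. ?F' h (u t) (v t) + F (X t) (h *\<^sub>R u') (v t) + F (X t) (u t) (h *\<^sub>R v'))) (at t within S)"
  proof (rule has_derivative_bilinear_family[OF _ t])
    show "bilinear (F (X s))" if "s \<in> S" for s using bil X(1) that by blast
    show "bilinear (?F' h)" for h by (rule bilinear_frechet_family[OF Q X(1)[OF t] bil F])
    show "((\<lambda>s. F (X s) u v) has_derivative (\<lambda>h. ?F' h u v)) (at t within S)" for u v
      by (rule has_derivative_compose[OF X(2)[unfolded has_vector_derivative_def]
            smooth_on_has_derivative[OF Q F X(1)[OF t]]])
  qed (use u v in \<open>simp_all add: has_vector_derivative_def\<close>)
  moreover have "?F' h (u t) (v t) + F (X t) (h *\<^sub>R u') (v t) + F (X t) (u t) (h *\<^sub>R v') =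
      h *\<^sub>R (?F' 1 (u t) (v t) + F (X t) u' (v t) + F (X t) (u t) v')" for h
    using linear_scale[OF smooth_on_linear_frechet[OF Q F X(1)[OF t]]] bil[OF X(1)[OF t]]
    by (simp add: bilinear_lmul bilinear_rmul scaleR_add_right)
  ultimately show ?thesis by (simp add: has_vector_derivative_def)
qed

section \<open>Charts, fields and forms in coordinates\<close>

text \<open>The differential of the change of coordinates from \<open>c\<close> to \<open>d\<close>. The base point is a point of the
  manifold, so that the chain rule \<open>dtrans_comp\<close> mentions it only once. Both \<open>tcoord\<close> and \<open>tvec\<close>
  are instances.\<close>

definition dtrans :: "('m, 'e::euclidean_space) chart \<Rightarrow> ('m, 'e) chart \<Rightarrow> 'm \<Rightarrow> 'e \<Rightarrow> 'e" where
  "dtrans c d p = frechet_derivative (\<lambda>x. cmap d (cinv c x)) (at (cmap c p))"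

definition local_rep ::
    "('m, 'e::euclidean_space) chart set \<Rightarrow> ('m, 'e) chart \<Rightarrow> ('m \<Rightarrow> 'e) \<Rightarrow> 'e \<Rightarrow> 'e" where
  "local_rep A c Y x = tcoord A c (cinv c x) (Y (cinv c x))"

locale smooth_manifold =
  fixes A :: "('m::topological_space, 'e::euclidean_space) chart set"
  assumes atlas: "smooth_atlas A"
begin

lemma open_cdom: "c \<in> A \<Longrightarrow> open (cdom c)"
  using atlas by (auto simp: smooth_atlas_def is_chart_def)

lemma open_cimage: "c \<in> A \<Longrightarrow> open (cmap c ` cdom c)"
  using atlas by (auto simp: smooth_atlas_def is_chart_def)

lemma chart_homeomorphism:
  "c \<in> A \<Longrightarrow> homeomorphism (cdom c) (cmap c ` cdom c) (cmap c) (cinv c)"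
  using atlas by (auto simp: smooth_atlas_def is_chart_def)

lemma cinv_cmap [simp]: "\<lbrakk>c \<in> A; p \<in> cdom c\<rbrakk> \<Longrightarrow> cinv c (cmap c p) = p"
  using chart_homeomorphism homeomorphism_apply1 by fastforce

lemma open_cimage_Int: "\<lbrakk>c \<in> A; open U\<rbrakk> \<Longrightarrow> open (cmap c ` (cdom c \<inter> U))"
proof -
  assume c: "c \<in> A" and "open U"
  then have "openin (top_of_set (cdom c)) (cdom c \<inter> U)" by blast
  then have "openin (top_of_set (cmap c ` cdom c)) (cmap c ` (cdom c \<inter> U))"
    using homeomorphism_imp_open_map[OF chart_homeomorphism[OF c]] by blast
  then show "open (cmap c ` (cdom c \<inter> U))"
    using open_cimage[OF c] openin_open_eq by blast
qed

lemma chart_at: "chart_at A p \<in> A" "p \<in> cdom (chart_at A p)"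
proof -
  have "\<exists>c. c \<in> A \<and> p \<in> cdom c" using atlas unfolding smooth_atlas_def by blast
  from someI_ex[OF this] show "chart_at A p \<in> A" "p \<in> cdom (chart_at A p)"
    by (auto simp: chart_at_def)
qed

lemma smooth_trans:
  "\<lbrakk>c \<in> A; d \<in> A\<rbrakk> \<Longrightarrow> smooth_on (cmap c ` (cdom c \<inter> cdom d)) (\<lambda>x. cmap d (cinv c x))"
  using atlas by (auto simp: smooth_atlas_def)

lemma dtrans_has_derivative:
  assumes "c \<in> A" "d \<in> A" "p \<in> cdom c" "p \<in> cdom d"
  shows "((\<lambda>x. cmap d (cinv c x)) has_derivative dtrans c d p) (at (cmap c p))"
  unfolding dtrans_def
  by (rule smooth_on_has_derivative[OF open_cimage_Int smooth_trans]) (use assms open_cdom in auto)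

lemma linear_dtrans:
  "\<lbrakk>c \<in> A; d \<in> A; p \<in> cdom c; p \<in> cdom d\<rbrakk> \<Longrightarrow> linear (dtrans c d p)"
  using dtrans_has_derivative has_derivative_linear by blast

lemma dtrans_comp:
  assumes A: "b \<in> A" "c \<in> A" "d \<in> A" and p: "p \<in> cdom b" "p \<in> cdom c" "p \<in> cdom d"
  shows "dtrans c d p (dtrans b c p v) = dtrans b d p v"
proof -
  let ?S = "cmap b ` (cdom b \<inter> (cdom c \<inter> cdom d))"
  have "((\<lambda>x. cmap d (cinv c (cmap c (cinv b x)))) has_derivative
      (\<lambda>v. dtrans c d p (dtrans b c p v))) (at (cmap b p))"
    by (rule has_derivative_compose[OF dtrans_has_derivative]) (use assms dtrans_has_derivative in auto)
  then have "((\<lambda>x. cmap d (cinv b x)) has_derivative (\<lambda>v. dtrans c d p (dtrans b c p v))) (at (cmap b p))"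
    by (rule has_derivative_transform_within_open[where s = ?S])
      (use assms open_cimage_Int[OF A(1) open_Int[OF open_cdom[OF A(2)] open_cdom[OF A(3)]]] in auto)
  then have "(\<lambda>v. dtrans c d p (dtrans b c p v)) = dtrans b d p"
    unfolding dtrans_def[of b d] by (rule frechet_derivative_at)
  then show ?thesis by (rule fun_cong)
qed

lemma dtrans_self:
  assumes "c \<in> A" "p \<in> cdom c"
  shows "dtrans c c p v = v"
proof -
  have "((\<lambda>x. cmap c (cinv c x)) has_derivative (\<lambda>v. v)) (at (cmap c p))"
    by (rule has_derivative_transform_within_open[OF has_derivative_ident open_cimage[OF assms(1)]])
      (use assms in auto)
  then show ?thesis unfolding dtrans_def using frechet_derivative_at by metis
qed

lemma tcoord_dtrans: "tcoord A c p = dtrans (chart_at A p) c p"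
  by (rule ext) (simp add: tcoord_def dtrans_def)

lemma tvec_dtrans: "tvec A c p = dtrans c (chart_at A p) p"
  by (rule ext) (simp add: tvec_def dtrans_def)

lemma linear_tcoord: "\<lbrakk>c \<in> A; p \<in> cdom c\<rbrakk> \<Longrightarrow> linear (tcoord A c p)"
  using chart_at linear_dtrans by (simp add: tcoord_dtrans)

lemma linear_tvec: "\<lbrakk>c \<in> A; p \<in> cdom c\<rbrakk> \<Longrightarrow> linear (tvec A c p)"
  using chart_at linear_dtrans by (simp add: tvec_dtrans)

lemma tvec_tcoord [simp]: "\<lbrakk>c \<in> A; p \<in> cdom c\<rbrakk> \<Longrightarrow> tvec A c p (tcoord A c p v) = v"
  using chart_at by (simp add: tcoord_dtrans tvec_dtrans dtrans_comp dtrans_self)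

lemma tcoord_tvec [simp]: "\<lbrakk>c \<in> A; p \<in> cdom c\<rbrakk> \<Longrightarrow> tcoord A c p (tvec A c p v) = v"
  using chart_at by (simp add: tcoord_dtrans tvec_dtrans dtrans_comp dtrans_self)

lemma tcoord_chart_at [simp]: "tcoord A (chart_at A p) p v = v"
  using chart_at by (simp add: tcoord_dtrans dtrans_self)

lemma tvec_chart_at [simp]: "tvec A (chart_at A p) p v = v"
  using chart_at by (simp add: tvec_dtrans dtrans_self)

lemma dtrans_tcoord:
  "\<lbrakk>c \<in> A; d \<in> A; p \<in> cdom c; p \<in> cdom d\<rbrakk> \<Longrightarrow> dtrans c d p (tcoord A c p v) = tcoord A d p v"
  using chart_at by (simp add: tcoord_dtrans dtrans_comp)

lemma extend_at [simp]: "extend A p v p = v"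
  by (simp add: extend_def)

lemma local_rep_cmap: "\<lbrakk>c \<in> A; p \<in> cdom c\<rbrakk> \<Longrightarrow> local_rep A c Y (cmap c p) = tcoord A c p (Y p)"
  by (simp add: local_rep_def)

lemma local_rep_trans:
  assumes "c \<in> A" "d \<in> A" "x \<in> cmap c ` (cdom c \<inter> cdom d)"
  shows "local_rep A d Y (cmap d (cinv c x)) =
    frechet_derivative (\<lambda>x. cmap d (cinv c x)) (at x) (local_rep A c Y x)"
proof -
  obtain p where p: "p \<in> cdom c" "p \<in> cdom d" "x = cmap c p" using assms(3) by auto
  show ?thesis
    using dtrans_tcoord[OF assms(1,2) p(1,2), of "Y p"] assms p
    by (simp add: local_rep_def dtrans_def)
qed

lemma smooth_fieldD:
  "\<lbrakk>smooth_field A U Y; c \<in> A\<rbrakk> \<Longrightarrow> smooth_on (cmap c ` (cdom c \<inter> U)) (local_rep A c Y)"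
  by (simp add: smooth_field_def local_rep_def[abs_def])

lemma smooth_field_cong:
  assumes "\<And>q. q \<in> U \<Longrightarrow> X q = Y q" "smooth_field A U X"
  shows "smooth_field A U Y"
  unfolding smooth_field_def
proof
  fix d assume "d \<in> A"
  show "smooth_on (cmap d ` (cdom d \<inter> U)) (\<lambda>x. tcoord A d (cinv d x) (Y (cinv d x)))"
    by (rule smooth_on_cong[OF _ assms(2)[unfolded smooth_field_def, rule_format, OF \<open>d \<in> A\<close>]])
      (use assms(1) \<open>d \<in> A\<close> in auto)
qed

lemma smooth_field_subset:
  "\<lbrakk>open U; open V; V \<subseteq> U; smooth_field A U Y\<rbrakk> \<Longrightarrow> smooth_field A V Y"
  unfolding smooth_field_def
  by (metis (no_types, lifting) Int_mono image_mono open_cimage_Int smooth_on_subset subset_refl)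

lemma smooth_trans_within:
  assumes "c \<in> A" "d \<in> A" "open U" "U \<subseteq> cdom c"
  shows "open (cmap d ` (cdom d \<inter> U))" "open (cmap c ` U)"
    and "(\<lambda>x. cmap c (cinv d x)) ` (cmap d ` (cdom d \<inter> U)) \<subseteq> cmap c ` U"
    and "smooth_on (cmap d ` (cdom d \<inter> U)) (\<lambda>x. cmap c (cinv d x))"
proof -
  show o: "open (cmap d ` (cdom d \<inter> U))" using open_cimage_Int assms by blast
  have "cdom c \<inter> U = U" using assms(4) by blast
  then show "open (cmap c ` U)" using open_cimage_Int[OF assms(1,3)] by simp
  show "(\<lambda>x. cmap c (cinv d x)) ` (cmap d ` (cdom d \<inter> U)) \<subseteq> cmap c ` U"
    using assms by auto
  show "smooth_on (cmap d ` (cdom d \<inter> U)) (\<lambda>x. cmap c (cinv d x))"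
    by (rule smooth_on_subset[OF open_cimage_Int[OF assms(2) open_cdom[OF assms(1)]] o _
          smooth_trans[OF assms(2,1)]]) (use assms(4) in auto)
qed

text \<open>Smoothness needs to be checked in one chart only, because the components in another chart
  are obtained from these by the differential of the change of coordinates.\<close>

lemma smooth_fieldI:
  assumes "c \<in> A" "open U" "U \<subseteq> cdom c" "smooth_on (cmap c ` U) (local_rep A c Y)"
  shows "smooth_field A U Y"
  unfolding smooth_field_def
proof
  fix d assume d: "d \<in> A"
  note T = smooth_trans_within[OF assms(1) d assms(2,3)]
  let ?S = "cmap d ` (cdom d \<inter> U)"
  have "smooth_on ?S (\<lambda>x. frechet_derivative (\<lambda>x. cmap d (cinv c x)) (at (cmap c (cinv d x)))
      (local_rep A c Y (cmap c (cinv d x))))"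
  proof (rule smooth_on_linear_family[OF T(1), where w = "\<lambda>x. local_rep A c Y (cmap c (cinv d x))"])
    show "linear (frechet_derivative (\<lambda>x. cmap d (cinv c x)) (at (cmap c (cinv d x))))"
      if "x \<in> ?S" for x
      using linear_dtrans[OF assms(1) d, of "cinv d x"] that assms d by (auto simp: dtrans_def)
    have o: "open (cmap c ` (cdom c \<inter> cdom d))" using open_cimage_Int open_cdom assms(1) d by blast
    show "smooth_on ?S (\<lambda>x. frechet_derivative (\<lambda>x. cmap d (cinv c x)) (at (cmap c (cinv d x))) u)"
      for u
      by (rule smooth_on_compose[OF T(1) o _ smooth_on_frechet[OF o smooth_trans[OF assms(1) d]] T(4)])
        (use assms d in auto)
    show "smooth_on ?S (\<lambda>x. local_rep A c Y (cmap c (cinv d x)))"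
      by (rule smooth_on_compose[OF T(1,2,3) assms(4) T(4)])
  qed
  then show "smooth_on ?S (\<lambda>x. tcoord A d (cinv d x) (Y (cinv d x)))"
  proof (rule smooth_on_cong[rotated])
    fix x assume "x \<in> ?S"
    then obtain p where p: "p \<in> cdom d" "p \<in> U" "x = cmap d p" by auto
    have "p \<in> cdom c" using p(2) assms(3) by blast
    then show "frechet_derivative (\<lambda>x. cmap d (cinv c x)) (at (cmap c (cinv d x)))
        (local_rep A c Y (cmap c (cinv d x))) = tcoord A d (cinv d x) (Y (cinv d x))"
      using dtrans_tcoord[OF assms(1) d _ p(1), of "Y p"] p assms(1) d
      by (simp add: local_rep_def dtrans_def)
  qed
qed

lemma smooth_funI:
  assumes "c \<in> A" "open U" "U \<subseteq> cdom c" "smooth_on (cmap c ` U) (\<lambda>x. f (cinv c x))"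
  shows "smooth_fun A U f"
  unfolding smooth_fun_def
proof
  fix d assume d: "d \<in> A"
  note T = smooth_trans_within[OF assms(1) d assms(2,3)]
  have "smooth_on (cmap d ` (cdom d \<inter> U)) (\<lambda>x. f (cinv c (cmap c (cinv d x))))"
    by (rule smooth_on_compose[OF T(1,2,3) assms(4) T(4)])
  then show "smooth_on (cmap d ` (cdom d \<inter> U)) (\<lambda>x. f (cinv d x))"
    by (rule smooth_on_cong[rotated]) (use assms(1,3) d in auto)
qed

lemma smooth_field_tvec:
  assumes "c \<in> A"
  shows "smooth_field A (cdom c) (\<lambda>q. tvec A c q u)"
proof (rule smooth_fieldI[OF assms open_cdom[OF assms]])
  show "smooth_on (cmap c ` cdom c) (local_rep A c (\<lambda>q. tvec A c q u))"
    by (rule smooth_on_cong[OF _ smooth_on_const[OF open_cimage[OF assms], of u]])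
      (use assms in \<open>auto simp: local_rep_def\<close>)
qed simp

lemma smooth_field_extend: "smooth_field A (cdom (chart_at A p)) (extend A p v)"
  unfolding extend_def by (rule smooth_field_tvec[OF chart_at(1)])

lemma smooth_field_add:
  assumes "open U" "smooth_field A U X" "smooth_field A U Y"
  shows "smooth_field A U (\<lambda>q. X q + Y q)"
  unfolding smooth_field_def
proof
  fix d assume d: "d \<in> A"
  have "smooth_on (cmap d ` (cdom d \<inter> U)) (\<lambda>x. local_rep A d X x + local_rep A d Y x)"
    by (intro smooth_on_add smooth_fieldD open_cimage_Int assms d)
  then show "smooth_on (cmap d ` (cdom d \<inter> U)) (\<lambda>x. tcoord A d (cinv d x) (X (cinv d x) + Y (cinv d x)))"
    by (rule smooth_on_cong[rotated])
      (use d linear_tcoord[OF d] in \<open>auto simp: local_rep_def linear_add\<close>)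
qed

lemma smooth_field_scale:
  assumes "open U" "smooth_fun A U f" "smooth_field A U Y"
  shows "smooth_field A U (\<lambda>q. f q *\<^sub>R Y q)"
  unfolding smooth_field_def
proof
  fix d assume d: "d \<in> A"
  have "smooth_on (cmap d ` (cdom d \<inter> U)) (\<lambda>x. f (cinv d x) *\<^sub>R local_rep A d Y x)"
    using assms(2) d
    by (intro smooth_on_scaleR smooth_fieldD open_cimage_Int assms d) (auto simp: smooth_fun_def)
  then show "smooth_on (cmap d ` (cdom d \<inter> U)) (\<lambda>x. tcoord A d (cinv d x) (f (cinv d x) *\<^sub>R Y (cinv d x)))"
    by (rule smooth_on_cong[rotated])
      (use d linear_tcoord[OF d] in \<open>auto simp: local_rep_def linear_scale\<close>)
qed

lemma smooth_fun_const: "open U \<Longrightarrow> smooth_fun A U (\<lambda>q. r)"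
  unfolding smooth_fun_def by (auto intro: smooth_on_const open_cimage_Int)

lemma smooth_field_zero: "open U \<Longrightarrow> smooth_field A U (\<lambda>q. 0)"
  unfolding smooth_field_def
proof
  fix d assume "open U" and d: "d \<in> A"
  show "smooth_on (cmap d ` (cdom d \<inter> U)) (\<lambda>x. tcoord A d (cinv d x) 0)"
    by (rule smooth_on_cong[OF _ smooth_on_const[OF open_cimage_Int[OF d \<open>open U\<close>], of 0]])
      (use d linear_tcoord[OF d] in \<open>auto simp: linear_0\<close>)
qed

lemma smooth_field_sum:
  assumes "open U" "\<And>i. i \<in> I \<Longrightarrow> smooth_field A U (Y i)"
  shows "smooth_field A U (\<lambda>q. \<Sum>i\<in>I. Y i q)"
  using assms(2)
  by (induction I rule: infinite_finite_induct) (auto intro!: smooth_field_zero smooth_field_add assms(1))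

lemma local_rep_has_derivative:
  assumes "c \<in> A" "open U" "p \<in> U" "p \<in> cdom c" "smooth_field A U Y"
  shows "(local_rep A c Y has_derivative frechet_derivative (local_rep A c Y) (at (cmap c p))) (at (cmap c p))"
  by (rule smooth_on_has_derivative[OF open_cimage_Int[OF assms(1,2)] smooth_fieldD[OF assms(5,1)]])
    (use assms in auto)

lemma local_rep_tvec_derivative:
  assumes c: "c \<in> A" and x: "x \<in> cmap c ` cdom c"
  shows "frechet_derivative (local_rep A c (\<lambda>q. tvec A c q u)) (at x) h = 0"
proof -
  have "(local_rep A c (\<lambda>q. tvec A c q u) has_derivative (\<lambda>h. 0)) (at x)"
    by (rule has_derivative_transform_within_open[OF has_derivative_const open_cimage[OF c] x])
      (use c in \<open>auto simp: local_rep_def\<close>)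
  then show ?thesis by (metis frechet_derivative_at)
qed

lemma dir_deriv_chart:
  assumes "c \<in> A" "p \<in> cdom c" "((\<lambda>x. f (cinv c x)) has_derivative f') (at (cmap c p))"
  shows "dir_deriv A f p v = f' (tcoord A c p v)"
proof -
  let ?b = "chart_at A p"
  note b = chart_at[of p]
  have "((\<lambda>x. f (cinv c (cmap c (cinv ?b x)))) has_derivative (\<lambda>v. f' (dtrans ?b c p v))) (at (cmap ?b p))"
    by (rule has_derivative_compose[OF dtrans_has_derivative[OF b(1) assms(1) b(2) assms(2)]])
      (use assms b in simp)
  then have "((\<lambda>x. f (cinv ?b x)) has_derivative (\<lambda>v. f' (dtrans ?b c p v))) (at (cmap ?b p))"
    by (rule has_derivative_transform_within_open[where s = "cmap ?b ` (cdom ?b \<inter> cdom c)"])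
      (use assms b open_cimage_Int open_cdom in auto)
  then show ?thesis
    unfolding dir_deriv_def tcoord_dtrans by (metis frechet_derivative_at)
qed

text \<open>In another chart the derivative of the components of a field acquires a Hessian term of the change
  of coordinates. That term is symmetric, by the equality of mixed second derivatives, in
  \<open>v\<close> and the value of the field; hence it drops out of the bracket, whose coordinate expression
  therefore has the same form in every chart.\<close>

lemma local_rep_derivative_trans:
  fixes p :: 'm
  defines "b \<equiv> chart_at A p"
  assumes c: "c \<in> A" "p \<in> cdom c" and U: "open U" "p \<in> U" and Y: "smooth_field A U Y"
  shows "frechet_derivative (local_rep A c Y) (at (cmap c p)) (tcoord A c p v) =
    frechet_derivative (\<lambda>y. frechet_derivative (\<lambda>x. cmap c (cinv b x)) (at y) (Y p)) (at (cmap b p)) v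
    + tcoord A c p (frechet_derivative (local_rep A b Y) (at (cmap b p)) v)"
proof -
  note b = chart_at[of p, folded b_def]
  let ?\<phi> = "\<lambda>x. cmap c (cinv b x)"
  let ?S = "cmap b ` (cdom b \<inter> cdom c)"
  have S: "open ?S" "cmap b p \<in> ?S" using open_cimage_Int open_cdom b c by auto
  note smooth = smooth_trans[OF b(1) c(1)]
  have lin: "linear (frechet_derivative ?\<phi> (at y))" if "y \<in> ?S" for y
    by (rule smooth_on_linear_frechet[OF S(1) smooth that])
  have "((\<lambda>y. frechet_derivative ?\<phi> (at y) (local_rep A b Y y)) has_derivative
      (\<lambda>v. frechet_derivative (\<lambda>y. frechet_derivative ?\<phi> (at y) (local_rep A b Y (cmap b p))) (at (cmap b p)) v
        + frechet_derivative ?\<phi> (at (cmap b p)) (frechet_derivative (local_rep A b Y) (at (cmap b p)) v)))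
      (at (cmap b p) within ?S)"
  proof (rule has_derivative_linear_family[OF lin S(2)])
    show "linear (\<lambda>u. frechet_derivative (\<lambda>y. frechet_derivative ?\<phi> (at y) u) (at (cmap b p)) h)" for h
      by (rule linear_frechet_family[OF S lin smooth_on_frechet[OF S(1) smooth]])
    show "((\<lambda>y. frechet_derivative ?\<phi> (at y) u) has_derivative
        (\<lambda>h. frechet_derivative (\<lambda>y. frechet_derivative ?\<phi> (at y) u) (at (cmap b p)) h))
        (at (cmap b p) within ?S)" for u
      by (rule has_derivative_at_withinI[OF smooth_on_has_derivative[OF S(1) smooth_on_frechet[OF S(1) smooth] S(2)]])
    show "(local_rep A b Y has_derivative frechet_derivative (local_rep A b Y) (at (cmap b p)))
        (at (cmap b p) within ?S)"
      by (rule has_derivative_at_withinI[OF local_rep_has_derivative[OF b(1) U b(2) Y]])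
  qed
  then have "((\<lambda>y. local_rep A c Y (?\<phi> y)) has_derivative
      (\<lambda>v. frechet_derivative (\<lambda>y. frechet_derivative ?\<phi> (at y) (local_rep A b Y (cmap b p))) (at (cmap b p)) v
        + frechet_derivative ?\<phi> (at (cmap b p)) (frechet_derivative (local_rep A b Y) (at (cmap b p)) v)))
      (at (cmap b p) within ?S)"
    by (rule has_derivative_transform[OF S(2), rotated]) (rule local_rep_trans[OF b(1) c(1)])
  then have 1: "((\<lambda>y. local_rep A c Y (?\<phi> y)) has_derivative
      (\<lambda>v. frechet_derivative (\<lambda>y. frechet_derivative ?\<phi> (at y) (local_rep A b Y (cmap b p))) (at (cmap b p)) v
        + frechet_derivative ?\<phi> (at (cmap b p)) (frechet_derivative (local_rep A b Y) (at (cmap b p)) v)))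
      (at (cmap b p))"
    using S by (simp add: at_within_open_NO_MATCH)
  have 2: "((\<lambda>y. local_rep A c Y (?\<phi> y)) has_derivative
      (\<lambda>v. frechet_derivative (local_rep A c Y) (at (cmap c p)) (dtrans b c p v))) (at (cmap b p))"
    by (rule has_derivative_compose[OF dtrans_has_derivative[OF b(1) c(1) b(2) c(2)]])
      (use local_rep_has_derivative[OF c(1) U c(2) Y] b in simp)
  from has_derivative_unique[OF 2 1]
  have "frechet_derivative (local_rep A c Y) (at (cmap c p)) (dtrans b c p v) =
      frechet_derivative (\<lambda>y. frechet_derivative ?\<phi> (at y) (local_rep A b Y (cmap b p))) (at (cmap b p)) v
        + frechet_derivative ?\<phi> (at (cmap b p)) (frechet_derivative (local_rep A b Y) (at (cmap b p)) v)"
    by (rule fun_cong)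
  moreover have "local_rep A b Y (cmap b p) = Y p"
    using b by (simp add: local_rep_cmap) (simp add: b_def)
  ultimately show ?thesis by (simp add: tcoord_dtrans dtrans_def flip: b_def)
qed

lemma lie_bracket_chart:
  assumes c: "c \<in> A" "p \<in> cdom c" and U: "open U" "p \<in> U"
    and X: "smooth_field A U X" and Y: "smooth_field A U Y"
  shows "tcoord A c p (lie_bracket A X Y p) =
    frechet_derivative (local_rep A c Y) (at (cmap c p)) (tcoord A c p (X p)) -
    frechet_derivative (local_rep A c X) (at (cmap c p)) (tcoord A c p (Y p))"
proof -
  let ?b = "chart_at A p"
  note b = chart_at[of p]
  have loc: "(\<lambda>y. tcoord A ?b (cinv ?b y) (Z (cinv ?b y))) = local_rep A ?b Z" for Z
    by (rule ext) (simp add: local_rep_def)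
  have br: "lie_bracket A X Y p = frechet_derivative (local_rep A ?b Y) (at (cmap ?b p)) (X p) -
      frechet_derivative (local_rep A ?b X) (at (cmap ?b p)) (Y p)"
    unfolding lie_bracket_def Let_def loc ..
  have "cmap ?b p \<in> cmap ?b ` (cdom ?b \<inter> cdom c)" using b c by auto
  note sym = second_derivative_symmetric[OF open_cimage_Int[OF b(1) open_cdom[OF c(1)]] this
      smooth_trans[OF b(1) c(1)], of "X p" "Y p"]
  show ?thesis
    unfolding br linear_diff[OF linear_tcoord[OF c]]
      local_rep_derivative_trans[OF c U X] local_rep_derivative_trans[OF c U Y]
    by (simp add: sym)
qed

text \<open>Here \<open>dw h u v\<close> is the derivative in the direction \<open>h\<close> of the components of \<open>w\<close>. The derivatives of
  the components of the three fields are cancelled by the brackets, so that the value depends on the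
  vectors only and the formula holds in every chart around \<open>p\<close>.\<close>

lemma ext_deriv_chart:
  fixes w :: "'m \<Rightarrow> 'e \<Rightarrow> 'e \<Rightarrow> real"
  assumes c: "c \<in> A" "p \<in> cdom c"
    and bil: "\<And>q. bilinear (w q)" and skew: "\<And>q u v. w q u v = - w q v u"
    and smooth: "\<And>u v. smooth_on (cmap c ` cdom c)
      (\<lambda>x. w (cinv c x) (tvec A c (cinv c x) u) (tvec A c (cinv c x) v))"
  defines "dw \<equiv> \<lambda>h u v. frechet_derivative
      (\<lambda>x. w (cinv c x) (tvec A c (cinv c x) u) (tvec A c (cinv c x) v)) (at (cmap c p)) h"
  shows "ext_deriv A w p x y z =
    dw (tcoord A c p x) (tcoord A c p y) (tcoord A c p z)
    - dw (tcoord A c p y) (tcoord A c p x) (tcoord A c p z)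
    + dw (tcoord A c p z) (tcoord A c p x) (tcoord A c p y)"
proof -
  let ?b = "chart_at A p" and ?O = "cmap c ` cdom c" and ?x = "cmap c p"
  let ?E = "extend A p" and ?t = "tcoord A c p"
  define \<Omega> where "\<Omega> = (\<lambda>x u v. w (cinv c x) (tvec A c (cinv c x) u) (tvec A c (cinv c x) v))"
  define d where "d = (\<lambda>u. frechet_derivative (local_rep A c (?E u)) (at ?x))"
  note b = chart_at[of p]
  note O = open_cimage[OF c(1)]
  have xO: "?x \<in> ?O" using c by simp
  have bil\<Omega>: "bilinear (\<Omega> x)" if "x \<in> ?O" for x
    unfolding bilinear_def \<Omega>_def
    using bil[of "cinv c x"] linear_tvec[OF c(1), of "cinv c x"] that c(1)
    by (auto simp: bilinear_def intro: linear_compose[unfolded o_def])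
  have smooth\<Omega>: "smooth_on ?O (\<lambda>x. \<Omega> x u v)" for u v unfolding \<Omega>_def by (rule smooth)
  have dw: "dw = (\<lambda>h u v. frechet_derivative (\<lambda>x. \<Omega> x u v) (at ?x) h)"
    unfolding dw_def \<Omega>_def ..
  have dloc: "(local_rep A c (?E u) has_derivative d u) (at ?x)" for u
    unfolding d_def
    by (rule local_rep_has_derivative[OF c(1) open_cdom[OF b(1)] b(2) c(2) smooth_field_extend])
  have loc: "local_rep A c (?E u) ?x = ?t u" for u using c by (simp add: local_rep_cmap)
  have dir: "dir_deriv A (\<lambda>q. w q (?E u q) (?E v q)) p h =
      dw (?t h) (?t u) (?t v) + \<Omega> ?x (d u (?t h)) (?t v) + \<Omega> ?x (?t u) (d v (?t h))" for u v h
  proof (rule dir_deriv_chart[OF c])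
    have "((\<lambda>x. \<Omega> x (local_rep A c (?E u) x) (local_rep A c (?E v) x)) has_derivative
        (\<lambda>h. dw h (local_rep A c (?E u) ?x) (local_rep A c (?E v) ?x) + \<Omega> ?x (d u h) (local_rep A c (?E v) ?x)
          + \<Omega> ?x (local_rep A c (?E u) ?x) (d v h))) (at ?x within ?O)"
    proof (rule has_derivative_bilinear_family[OF bil\<Omega> xO _ _ dloc[THEN has_derivative_at_withinI]
          dloc[THEN has_derivative_at_withinI]])
      show "bilinear (dw h)" for h unfolding dw by (rule bilinear_frechet_family[OF O xO bil\<Omega> smooth\<Omega>])
      show "((\<lambda>x. \<Omega> x u v) has_derivative (\<lambda>h. dw h u v)) (at ?x within ?O)" for u v
        unfolding dw by (rule has_derivative_at_withinI[OF smooth_on_has_derivative[OF O smooth\<Omega> xO]])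
    qed
    then have "((\<lambda>x. \<Omega> x (local_rep A c (?E u) x) (local_rep A c (?E v) x)) has_derivative
        (\<lambda>h. dw h (?t u) (?t v) + \<Omega> ?x (d u h) (?t v) + \<Omega> ?x (?t u) (d v h))) (at ?x)"
      using O xO by (simp add: at_within_open_NO_MATCH loc)
    then show "((\<lambda>x. w (cinv c x) (?E u (cinv c x)) (?E v (cinv c x))) has_derivative
        (\<lambda>h. dw h (?t u) (?t v) + \<Omega> ?x (d u h) (?t v) + \<Omega> ?x (?t u) (d v h))) (at ?x)"
      by (rule has_derivative_transform_within_open[OF _ O xO])
        (use c in \<open>auto simp: \<Omega>_def local_rep_def\<close>)
  qed
  have br: "w p (lie_bracket A (?E u) (?E v) p) h = \<Omega> ?x (d v (?t u)) (?t h) - \<Omega> ?x (d u (?t v)) (?t h)"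
    for u v h
  proof -
    let ?B = "lie_bracket A (?E u) (?E v) p"
    have "w p ?B h = \<Omega> ?x (?t ?B) (?t h)" using c by (simp add: \<Omega>_def)
    also have "?t ?B = d v (?t u) - d u (?t v)"
      unfolding d_def
      using lie_bracket_chart[OF c open_cdom[OF b(1)] b(2) smooth_field_extend smooth_field_extend, of u v]
      by simp
    finally show ?thesis using bilinear_lsub[OF bil\<Omega>[OF xO]] by simp
  qed
  have sk: "\<Omega> ?x u v = - \<Omega> ?x v u" for u v unfolding \<Omega>_def by (rule skew)
  show ?thesis
    unfolding ext_deriv_def ext_deriv_fields_def extend_at dir br
    using sk[of "?t y" "d z (?t x)"] sk[of "?t y" "d x (?t z)"] sk[of "?t x" "d z (?t y)"]
      sk[of "?t x" "d y (?t z)"] by simp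
qed

end

section \<open>Affine connections in coordinates\<close>

text \<open>The Christoffel symbols of \<open>D\<close> in the chart \<open>c\<close>, contracted with \<open>u\<close> and \<open>v\<close>: the components of
  the derivative in the direction \<open>u\<close> of the field with constant components \<open>v\<close>.\<close>

definition christoffel ::
    "('m, 'e::euclidean_space) chart set \<Rightarrow> ('m, 'e) connection \<Rightarrow> ('m, 'e) chart \<Rightarrow> 'e \<Rightarrow> 'e \<Rightarrow> 'e \<Rightarrow> 'e" where
  "christoffel A D c x u v =
     tcoord A c (cinv c x) (D (cinv c x) (tvec A c (cinv c x) u) (\<lambda>q. tvec A c q v))"

text \<open>The classical expression \<open>\<partial>\<Gamma> - \<partial>\<Gamma> + \<Gamma>\<Gamma> - \<Gamma>\<Gamma>\<close> for the components of the curvature.\<close>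

definition riemann ::
    "('m, 'e::euclidean_space) chart set \<Rightarrow> ('m, 'e) connection \<Rightarrow> ('m, 'e) chart \<Rightarrow>
     'e \<Rightarrow> 'e \<Rightarrow> 'e \<Rightarrow> 'e \<Rightarrow> 'e" where
  "riemann A D c x u v w =
     frechet_derivative (\<lambda>x. christoffel A D c x v w) (at x) u
     - frechet_derivative (\<lambda>x. christoffel A D c x u w) (at x) v
     + christoffel A D c x u (christoffel A D c x v w)
     - christoffel A D c x v (christoffel A D c x u w)"

locale manifold_connection = smooth_manifold A
  for A :: "('m::topological_space, 'e::euclidean_space) chart set" +
  fixes D :: "('m, 'e) connection"
  assumes connection: "affine_connection A D"
begin

abbreviation "\<Gamma> \<equiv> christoffel A D"

lemma conn_smooth:
  assumes "open U" "smooth_field A U X" "smooth_field A U Y"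
  shows "smooth_field A U (\<lambda>q. D q (X q) Y)"
  using connection assms smooth_fun_const[OF assms(1), of 0] unfolding affine_connection_def by blast

lemma conn_linear:
  assumes "open U" "p \<in> U" "smooth_field A U Y"
  shows "linear (\<lambda>v. D p v Y)"
  using connection assms smooth_fun_const[OF assms(1), of 0] unfolding affine_connection_def by blast

lemma conn_add:
  assumes "open U" "p \<in> U" "smooth_field A U Y" "smooth_field A U Z"
  shows "D p v (\<lambda>q. Y q + Z q) = D p v Y + D p v Z"
  using connection assms smooth_fun_const[OF assms(1), of 0] unfolding affine_connection_def by blast

lemma conn_leibniz:
  assumes "open U" "p \<in> U" "smooth_field A U Y" "smooth_fun A U f"
  shows "D p v (\<lambda>q. f q *\<^sub>R Y q) = dir_deriv A f p v *\<^sub>R Y p + f p *\<^sub>R D p v Y"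
  using connection assms unfolding affine_connection_def by blast

lemma conn_scale:
  assumes "open U" "p \<in> U" "smooth_field A U Y"
  shows "D p v (\<lambda>q. r *\<^sub>R Y q) = r *\<^sub>R D p v Y"
  using conn_leibniz[OF assms smooth_fun_const[OF assms(1)], of v r] by (simp add: dir_deriv_def)

lemma conn_zero: "D p v (\<lambda>q. 0) = 0"
  using conn_add[OF open_UNIV UNIV_I smooth_field_zero[OF open_UNIV] smooth_field_zero[OF open_UNIV], of p v]
  by simp

lemma conn_sum:
  assumes "open U" "p \<in> U" "\<And>i. i \<in> I \<Longrightarrow> smooth_field A U (Y i)"
  shows "D p v (\<lambda>q. \<Sum>i\<in>I. Y i q) = (\<Sum>i\<in>I. D p v (Y i))"
  using assms(3)
proof (induction I rule: infinite_finite_induct)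
  case (insert i I)
  then have "smooth_field A U (\<lambda>q. \<Sum>i\<in>I. Y i q)" using smooth_field_sum[OF assms(1), of I Y] by simp
  then show ?case using insert conn_add[OF assms(1,2), of "Y i" "\<lambda>q. \<Sum>i\<in>I. Y i q" v] by simp
qed (simp_all add: conn_zero)

text \<open>The Leibniz rule for the indicator function of \<open>U\<close>, which is smooth on \<open>U\<close> with derivative \<open>0\<close>:
  multiplication by it makes the two fields equal everywhere.\<close>

lemma conn_local:
  assumes U: "open U" "p \<in> U" and Y: "smooth_field A U Y" and eq: "\<And>q. q \<in> U \<Longrightarrow> Y q = Z q"
  shows "D p v Y = D p v Z"
proof -
  define f :: "'m \<Rightarrow> real" where "f = (\<lambda>q. if q \<in> U then 1 else 0)"
  note c = chart_at[of p]
  let ?c = "chart_at A p"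
  have "smooth_fun A U f"
    unfolding smooth_fun_def
  proof
    fix d assume d: "d \<in> A"
    show "smooth_on (cmap d ` (cdom d \<inter> U)) (\<lambda>x. f (cinv d x))"
      by (rule smooth_on_cong[OF _ smooth_on_const[OF open_cimage_Int[OF d U(1)], of 1]])
        (use d in \<open>auto simp: f_def\<close>)
  qed
  note L = conn_leibniz[OF U _ this]
  have "((\<lambda>x. f (cinv ?c x)) has_derivative (\<lambda>h. 0)) (at (cmap ?c p))"
    by (rule has_derivative_transform_within_open[OF has_derivative_const[of 1] open_cimage_Int[OF c(1) U(1)]])
      (use c U in \<open>auto simp: f_def\<close>)
  from dir_deriv_chart[OF c this] have 0: "dir_deriv A f p v = 0" by simp
  have "(\<lambda>q. f q *\<^sub>R Y q) = (\<lambda>q. f q *\<^sub>R Z q)" using eq by (auto simp: f_def)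
  then show ?thesis
    using L[OF Y, of v] L[OF smooth_field_cong[OF eq Y], of v] U(2) unfolding 0 by (simp add: f_def)
qed

lemma smooth_christoffel:
  assumes "c \<in> A"
  shows "smooth_on (cmap c ` cdom c) (\<lambda>x. \<Gamma> c x u v)"
  using smooth_fieldD[OF conn_smooth[OF open_cdom[OF assms] smooth_field_tvec[OF assms] smooth_field_tvec[OF assms]] assms, of u v]
  by (simp add: local_rep_def[abs_def] christoffel_def[abs_def])

lemma bilinear_christoffel:
  assumes c: "c \<in> A" and x: "x \<in> cmap c ` cdom c"
  shows "bilinear (\<Gamma> c x)"
proof -
  obtain p where p: "p \<in> cdom c" "x = cmap c p" using x by blast
  note o = open_cdom[OF c] and E = smooth_field_tvec[OF c] and lin = linear_tcoord[OF c p(1)]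
  have eq: "\<Gamma> c x = (\<lambda>u v. tcoord A c p (D p (tvec A c p u) (\<lambda>q. tvec A c q v)))"
    using p c by (intro ext) (simp add: christoffel_def)
  have add: "D p w (\<lambda>q. tvec A c q (u + v)) = D p w (\<lambda>q. tvec A c q u) + D p w (\<lambda>q. tvec A c q v)" for w u v
  proof -
    have "D p w (\<lambda>q. tvec A c q (u + v)) = D p w (\<lambda>q. tvec A c q u + tvec A c q v)"
      by (rule conn_local[OF o p(1) E]) (use linear_tvec[OF c] linear_add in blast)
    then show ?thesis by (simp add: conn_add[OF o p(1) E E])
  qed
  have scale: "D p w (\<lambda>q. tvec A c q (r *\<^sub>R u)) = r *\<^sub>R D p w (\<lambda>q. tvec A c q u)" for w u r
  proof -
    have "D p w (\<lambda>q. tvec A c q (r *\<^sub>R u)) = D p w (\<lambda>q. r *\<^sub>R tvec A c q u)"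
      by (rule conn_local[OF o p(1) E]) (use linear_tvec[OF c] linear_scale in blast)
    then show ?thesis by (simp add: conn_scale[OF o p(1) E])
  qed
  show ?thesis
    unfolding eq bilinear_def
  proof (intro conjI allI)
    show "linear (\<lambda>v. tcoord A c p (D p (tvec A c p u) (\<lambda>q. tvec A c q v)))" for u
      by (rule linearI) (simp_all add: add scale linear_add[OF lin] linear_scale[OF lin])
    show "linear (\<lambda>u. tcoord A c p (D p (tvec A c p u) (\<lambda>q. tvec A c q v)))" for v
      using linear_compose[OF linear_compose[OF linear_tvec[OF c p(1)] conn_linear[OF o p(1) E]] lin]
      by (simp add: o_def)
  qed
qed

text \<open>Expand \<open>Y\<close> in the coordinate frame of \<open>c\<close>, which is possible near \<open>p\<close> only, and apply the Leibniz rule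
  to each term.\<close>

lemma conn_chart:
  assumes c: "c \<in> A" "p \<in> cdom c" and U: "open U" "p \<in> U" and Y: "smooth_field A U Y"
  shows "tcoord A c p (D p v Y) =
    frechet_derivative (local_rep A c Y) (at (cmap c p)) (tcoord A c p v)
    + \<Gamma> c (cmap c p) (tcoord A c p v) (tcoord A c p (Y p))"
proof -
  define W where "W = U \<inter> cdom c"
  define y where "y = (\<lambda>i q. local_rep A c Y (cmap c q) \<bullet> i)"
  define E where "E = (\<lambda>i q. tvec A c q i)"
  let ?dY = "frechet_derivative (local_rep A c Y) (at (cmap c p))"
  have W: "open W" "p \<in> W" "W \<subseteq> cdom c" "W \<subseteq> U"
    using open_cdom[OF c(1)] c U by (auto simp: W_def)
  have YW: "smooth_field A W Y" by (rule smooth_field_subset[OF U(1) W(1,4) Y])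
  have E: "smooth_field A W (E i)" for i
    unfolding E_def by (rule smooth_field_subset[OF open_cdom[OF c(1)] W(1,3) smooth_field_tvec[OF c(1)]])
  have "cdom c \<inter> W = W" using W(3) by blast
  then have loc: "smooth_on (cmap c ` W) (local_rep A c Y)" and oW: "open (cmap c ` W)"
    using smooth_fieldD[OF YW c(1)] open_cimage_Int[OF c(1) W(1)] by auto
  have y: "smooth_fun A W (y i)" for i
  proof (rule smooth_funI[OF c(1) W(1,3)])
    show "smooth_on (cmap c ` W) (\<lambda>x. y i (cinv c x))"
      by (rule smooth_on_cong[OF _ smooth_on_inner[OF oW loc, of i]])
        (use c W(3) in \<open>auto simp: y_def\<close>)
  qed
  have "Y q = (\<Sum>i\<in>Basis. y i q *\<^sub>R E i q)" if "q \<in> W" for q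
  proof -
    have q: "q \<in> cdom c" using that W by auto
    have "Y q = tvec A c q (tcoord A c q (Y q))" using c q by simp
    also have "\<dots> = (\<Sum>i\<in>Basis. (tcoord A c q (Y q) \<bullet> i) *\<^sub>R tvec A c q i)"
      by (rule linear_basis_expansion[OF linear_tvec[OF c(1) q]])
    finally show ?thesis using c q by (simp add: y_def E_def local_rep_cmap)
  qed
  then have "D p v Y = D p v (\<lambda>q. \<Sum>i\<in>Basis. y i q *\<^sub>R E i q)"
    by (rule conn_local[OF W(1,2) YW])
  also have "\<dots> = (\<Sum>i\<in>Basis. D p v (\<lambda>q. y i q *\<^sub>R E i q))"
    by (rule conn_sum[OF W(1,2) smooth_field_scale[OF W(1) y E]])
  also have "\<dots> = (\<Sum>i\<in>Basis. dir_deriv A (y i) p v *\<^sub>R E i p + y i p *\<^sub>R D p v (E i))"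
    by (simp add: conn_leibniz[OF W(1,2) E y])
  also have "\<dots> = (\<Sum>i\<in>Basis. (?dY (tcoord A c p v) \<bullet> i) *\<^sub>R E i p + y i p *\<^sub>R D p v (E i))"
  proof -
    have "dir_deriv A (y i) p v = ?dY (tcoord A c p v) \<bullet> i" for i
    proof (rule dir_deriv_chart[OF c])
      have "((\<lambda>x. local_rep A c Y x \<bullet> i) has_derivative (\<lambda>h. ?dY h \<bullet> i)) (at (cmap c p))"
        by (rule has_derivative_inner_left[OF local_rep_has_derivative[OF c(1) U c(2) Y]])
      then show "((\<lambda>x. y i (cinv c x)) has_derivative (\<lambda>h. ?dY h \<bullet> i)) (at (cmap c p))"
        by (rule has_derivative_transform_within_open[OF _ open_cimage[OF c(1)]])
          (use c in \<open>auto simp: y_def\<close>)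
    qed
    then show ?thesis by simp
  qed
  finally have "tcoord A c p (D p v Y) =
      (\<Sum>i\<in>Basis. (?dY (tcoord A c p v) \<bullet> i) *\<^sub>R i + y i p *\<^sub>R tcoord A c p (D p v (E i)))"
    using linear_tcoord[OF c] c by (simp add: linear_sum linear_add linear_scale E_def)
  moreover have "tcoord A c p (D p v (E i)) = \<Gamma> c (cmap c p) (tcoord A c p v) i" for i
    using c by (simp add: christoffel_def E_def)
  moreover have "y i p = tcoord A c p (Y p) \<bullet> i" for i using c by (simp add: y_def local_rep_cmap)
  moreover have "linear (\<Gamma> c (cmap c p) (tcoord A c p v))"
    using bilinear_christoffel[OF c(1), of "cmap c p"] c by (simp add: bilinear_def)
  ultimately show ?thesis
    by (simp add: sum.distrib euclidean_representation
        linear_basis_expansion[of "\<Gamma> c (cmap c p) (tcoord A c p v)" "tcoord A c p (Y p)"])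
qed

text \<open>\<open>conn_chart\<close> applied twice, with the product rule for the components of \<open>\<nabla>\<^sub>Y Z\<close>.\<close>

lemma second_covariant_derivative_chart:
  fixes p :: 'm and c :: "('m, 'e) chart"
  defines "x \<equiv> cmap c p"
  defines "t \<equiv> tcoord A c p"
  defines "d \<equiv> \<lambda>Z. frechet_derivative (local_rep A c Z) (at x)"
  assumes c: "c \<in> A" "p \<in> cdom c" and U: "open U" "p \<in> U"
    and Y: "smooth_field A U Y" and Z: "smooth_field A U Z"
  shows "t (D p v (\<lambda>q. D q (Y q) Z)) =
    frechet_derivative (\<lambda>x. frechet_derivative (local_rep A c Z) (at x) (t (Y p))) (at x) (t v)
    + d Z (d Y (t v))
    + (frechet_derivative (\<lambda>x. \<Gamma> c x (t (Y p)) (t (Z p))) (at x) (t v)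
      + \<Gamma> c x (d Y (t v)) (t (Z p)) + \<Gamma> c x (t (Y p)) (d Z (t v)))
    + \<Gamma> c x (t v) (d Z (t (Y p)) + \<Gamma> c x (t (Y p)) (t (Z p)))"
proof -
  let ?O = "cmap c ` (cdom c \<inter> U)"
  have O: "open ?O" "x \<in> ?O" using open_cimage_Int[OF c(1) U(1)] c U by (auto simp: x_def)
  have OO: "?O \<subseteq> cmap c ` cdom c" by blast
  note sY = smooth_fieldD[OF Y c(1)] and sZ = smooth_fieldD[OF Z c(1)]
  note dY = smooth_on_has_derivative[OF O(1) sY O(2), THEN has_derivative_at_withinI, where s = ?O]
  note dZ = smooth_on_has_derivative[OF O(1) sZ O(2), THEN has_derivative_at_withinI, where s = ?O]
  have loc: "local_rep A c Y x = t (Y p)" "local_rep A c Z x = t (Z p)"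
    using c by (simp_all add: x_def t_def local_rep_cmap)
  have lin: "linear (frechet_derivative (local_rep A c Z) (at y))" if "y \<in> ?O" for y
    by (rule smooth_on_linear_frechet[OF O(1) sZ that])
  have bil: "bilinear (\<Gamma> c y)" if "y \<in> ?O" for y
    using bilinear_christoffel[OF c(1)] that by blast
  have s\<Gamma>: "smooth_on ?O (\<lambda>y. \<Gamma> c y u v)" for u v
    by (rule smooth_on_subset[OF open_cimage[OF c(1)] O(1) OO smooth_christoffel[OF c(1)]])
  have 1: "((\<lambda>y. frechet_derivative (local_rep A c Z) (at y) (local_rep A c Y y)) has_derivative
      (\<lambda>h. frechet_derivative (\<lambda>y. frechet_derivative (local_rep A c Z) (at y) (local_rep A c Y x)) (at x) h
        + frechet_derivative (local_rep A c Z) (at x) (frechet_derivative (local_rep A c Y) (at x) h)))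
      (at x within ?O)"
  proof (rule has_derivative_linear_family[OF lin O(2) _ _ dY])
    show "linear (\<lambda>u. frechet_derivative (\<lambda>y. frechet_derivative (local_rep A c Z) (at y) u) (at x) h)" for h
      by (rule linear_frechet_family[OF O lin smooth_on_frechet[OF O(1) sZ]])
    show "((\<lambda>y. frechet_derivative (local_rep A c Z) (at y) u) has_derivative
        (\<lambda>h. frechet_derivative (\<lambda>y. frechet_derivative (local_rep A c Z) (at y) u) (at x) h))
        (at x within ?O)" for u
      by (rule has_derivative_at_withinI[OF smooth_on_has_derivative[OF O(1) smooth_on_frechet[OF O(1) sZ] O(2)]])
  qed
  have 2: "((\<lambda>y. \<Gamma> c y (local_rep A c Y y) (local_rep A c Z y)) has_derivative
      (\<lambda>h. frechet_derivative (\<lambda>y. \<Gamma> c y (local_rep A c Y x) (local_rep A c Z x)) (at x) h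
        + \<Gamma> c x (frechet_derivative (local_rep A c Y) (at x) h) (local_rep A c Z x)
        + \<Gamma> c x (local_rep A c Y x) (frechet_derivative (local_rep A c Z) (at x) h)))
      (at x within ?O)"
  proof (rule has_derivative_bilinear_family[OF bil O(2) _ _ dY dZ])
    show "bilinear (\<lambda>u v. frechet_derivative (\<lambda>y. \<Gamma> c y u v) (at x) h)" for h
      by (rule bilinear_frechet_family[OF O bil s\<Gamma>])
    show "((\<lambda>y. \<Gamma> c y u v) has_derivative (\<lambda>h. frechet_derivative (\<lambda>y. \<Gamma> c y u v) (at x) h)) (at x within ?O)"
      for u v
      by (rule has_derivative_at_withinI[OF smooth_on_has_derivative[OF O(1) s\<Gamma> O(2)]])
  qed
  have "local_rep A c (\<lambda>q. D q (Y q) Z) y =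
      frechet_derivative (local_rep A c Z) (at y) (local_rep A c Y y) +
      \<Gamma> c y (local_rep A c Y y) (local_rep A c Z y)" if "y \<in> ?O" for y
  proof -
    obtain q where q: "q \<in> cdom c" "q \<in> U" "y = cmap c q" using \<open>y \<in> ?O\<close> by blast
    show ?thesis
      using conn_chart[OF c(1) q(1) U(1) q(2) Z, of "Y q"] c q by (simp add: local_rep_def)
  qed
  from has_derivative_transform[OF O(2) this has_derivative_add[OF 1 2]]
  have "(local_rep A c (\<lambda>q. D q (Y q) Z) has_derivative
      (\<lambda>h. frechet_derivative (\<lambda>y. frechet_derivative (local_rep A c Z) (at y) (t (Y p))) (at x) h
        + d Z (d Y h)
        + (frechet_derivative (\<lambda>y. \<Gamma> c y (t (Y p)) (t (Z p))) (at x) h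
        + \<Gamma> c x (d Y h) (t (Z p)) + \<Gamma> c x (t (Y p)) (d Z h)))) (at x)"
    using O by (simp add: at_within_open_NO_MATCH loc d_def)
  then have "frechet_derivative (local_rep A c (\<lambda>q. D q (Y q) Z)) (at x) (t v) =
      frechet_derivative (\<lambda>y. frechet_derivative (local_rep A c Z) (at y) (t (Y p))) (at x) (t v)
        + d Z (d Y (t v))
        + (frechet_derivative (\<lambda>y. \<Gamma> c y (t (Y p)) (t (Z p))) (at x) (t v)
        + \<Gamma> c x (d Y (t v)) (t (Z p)) + \<Gamma> c x (t (Y p)) (d Z (t v)))"
    by (metis (no_types, lifting) frechet_derivative_at)
  moreover have "t (D p (Y p) Z) = d Z (t (Y p)) + \<Gamma> c x (t (Y p)) (t (Z p))"
    unfolding t_def d_def x_def by (rule conn_chart[OF c U Z])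
  ultimately show ?thesis
    using conn_chart[OF c U conn_smooth[OF U(1) Y Z], of v] by (simp add: t_def x_def)
qed

text \<open>All derivatives of the components of \<open>X\<close>, \<open>Y\<close> and \<open>Z\<close> cancel, the second derivatives of \<open>Z\<close> by their
  symmetry. So the curvature is a tensor, and its components in every chart around \<open>p\<close> are given by
  the same formula.\<close>

lemma curvature_fields_chart:
  assumes c: "c \<in> A" "p \<in> cdom c" and U: "open U" "p \<in> U"
    and X: "smooth_field A U X" and Y: "smooth_field A U Y" and Z: "smooth_field A U Z"
  shows "tcoord A c p (curvature_fields A D X Y Z p) =
    riemann A D c (cmap c p) (tcoord A c p (X p)) (tcoord A c p (Y p)) (tcoord A c p (Z p))"
proof -
  let ?O = "cmap c ` (cdom c \<inter> U)" and ?x = "cmap c p" and ?t = "tcoord A c p"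
  have O: "open ?O" "?x \<in> ?O" using open_cimage_Int[OF c(1) U(1)] c U by auto
  have lin: "linear (frechet_derivative (local_rep A c W) (at ?x))" if "smooth_field A U W" for W
    by (rule smooth_on_linear_frechet[OF O(1) smooth_fieldD[OF that c(1)] O(2)])
  have bil: "bilinear (\<Gamma> c ?x)" using bilinear_christoffel[OF c(1)] c by blast
  show ?thesis
    unfolding curvature_fields_def linear_diff[OF linear_tcoord[OF c]]
      second_covariant_derivative_chart[OF c U Y Z] second_covariant_derivative_chart[OF c U X Z]
      conn_chart[OF c U Z] lie_bracket_chart[OF c U X Y] riemann_def
    using second_derivative_symmetric[OF O smooth_fieldD[OF Z c(1)], of "?t (X p)" "?t (Y p)"]
    by (simp add: linear_diff[OF lin[OF Z]] bilinear_lsub[OF bil] bilinear_radd[OF bil])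
qed

lemma curvature_chart:
  assumes c: "c \<in> A" "p \<in> cdom c"
  shows "curvature A g D p x y z w = g p (tvec A c p
    (riemann A D c (cmap c p) (tcoord A c p x) (tcoord A c p y) (tcoord A c p z))) w"
proof -
  note b = chart_at[of p]
  show ?thesis
    unfolding curvature_def
    using curvature_fields_chart[OF c open_cdom[OF b(1)] b(2) smooth_field_extend smooth_field_extend
        smooth_field_extend, of x y z]
    by (metis c extend_at tvec_tcoord)
qed

end

section \<open>The Strominger-Bismut connection\<close>

definition metric_rep ::
    "('m, 'e::euclidean_space) chart set \<Rightarrow> ('m \<Rightarrow> 'e \<Rightarrow> 'e \<Rightarrow> real) \<Rightarrow> ('m, 'e) chart \<Rightarrow> 'e \<Rightarrow> 'e \<Rightarrow> 'e \<Rightarrow> real" where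
  "metric_rep A g c x u v = g (cinv c x) (tvec A c (cinv c x) u) (tvec A c (cinv c x) v)"

locale almost_hermitian = smooth_manifold A
  for A :: "('m::topological_space, 'e::euclidean_space) chart set" +
  fixes g :: "'m \<Rightarrow> 'e \<Rightarrow> 'e \<Rightarrow> real" and J :: "'m \<Rightarrow> 'e \<Rightarrow> 'e"
  assumes metric: "riemannian_metric A g" and acs: "almost_complex_structure A J"
    and compatible: "g p (J p u) (J p v) = g p u v"
begin

abbreviation "G \<equiv> metric_rep A g"

abbreviation "\<omega> \<equiv> fundamental_form g J"

lemma bilinear_g: "bilinear (g p)" and g_sym: "g p u v = g p v u" and g_pos: "v \<noteq> 0 \<Longrightarrow> g p v v > 0"
  using metric by (auto simp: riemannian_metric_def)

lemma linear_J: "linear (J p)" and J_J: "J p (J p v) = - v"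
  using acs by (auto simp: almost_complex_structure_def)

lemma smooth_G: "c \<in> A \<Longrightarrow> smooth_on (cmap c ` cdom c) (\<lambda>x. G c x u v)"
  using metric by (auto simp: riemannian_metric_def metric_rep_def)

lemma bilinear_G:
  assumes "c \<in> A" "x \<in> cmap c ` cdom c"
  shows "bilinear (G c x)"
  unfolding bilinear_def metric_rep_def
  using bilinear_g[of "cinv c x"] linear_tvec[OF assms(1), of "cinv c x"] assms
  by (auto simp: bilinear_def intro: linear_compose[unfolded o_def])

lemma g_chart: "\<lbrakk>c \<in> A; p \<in> cdom c\<rbrakk> \<Longrightarrow> g p u v = G c (cmap c p) (tcoord A c p u) (tcoord A c p v)"
  by (simp add: metric_rep_def)

lemma bilinear_\<omega>: "bilinear (\<omega> p)"
  unfolding bilinear_def fundamental_form_def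
  using bilinear_g[of p] linear_J[of p]
  by (auto simp: bilinear_def intro: linear_compose[unfolded o_def])

lemma \<omega>_skew: "\<omega> p u v = - \<omega> p v u"
proof -
  have "g p (J p u) v = g p (J p (J p u)) (J p v)" by (simp add: compatible)
  also have "\<dots> = - g p (J p v) u" by (simp add: J_J bilinear_lneg[OF bilinear_g] g_sym)
  finally show ?thesis by (simp add: fundamental_form_def)
qed

definition J_rep :: "('m, 'e) chart \<Rightarrow> 'e \<Rightarrow> 'e \<Rightarrow> 'e" where
  "J_rep c x u = tcoord A c (cinv c x) (J (cinv c x) (tvec A c (cinv c x) u))"

lemma smooth_J_rep: "c \<in> A \<Longrightarrow> smooth_on (cmap c ` cdom c) (\<lambda>x. J_rep c x u)"
  using acs by (auto simp: almost_complex_structure_def J_rep_def)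

definition \<omega>_rep :: "('m, 'e) chart \<Rightarrow> 'e \<Rightarrow> 'e \<Rightarrow> 'e \<Rightarrow> real" where
  "\<omega>_rep c x u v = \<omega> (cinv c x) (tvec A c (cinv c x) u) (tvec A c (cinv c x) v)"

lemma smooth_\<omega>_rep:
  assumes c: "c \<in> A"
  shows "smooth_on (cmap c ` cdom c) (\<lambda>x. \<omega>_rep c x u v)"
proof (rule smooth_on_cong)
  show "smooth_on (cmap c ` cdom c) (\<lambda>x. G c x (J_rep c x u) v)"
    by (rule smooth_on_linear_family[where F = "\<lambda>x u. G c x u v", OF open_cimage[OF c] _ smooth_G[OF c] smooth_J_rep[OF c]])
      (use bilinear_G[OF c] in \<open>auto simp: bilinear_def\<close>)
  show "G c x (J_rep c x u) v = \<omega>_rep c x u v" if "x \<in> cmap c ` cdom c" for x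
    using that c by (auto simp: metric_rep_def J_rep_def \<omega>_rep_def fundamental_form_def)
qed

lemma bilinear_\<omega>_rep:
  assumes "c \<in> A" "x \<in> cmap c ` cdom c"
  shows "bilinear (\<omega>_rep c x)"
  unfolding bilinear_def \<omega>_rep_def
  using bilinear_\<omega>[of "cinv c x"] linear_tvec[OF assms(1), of "cinv c x"] assms
  by (auto simp: bilinear_def intro: linear_compose[unfolded o_def])

text \<open>Antisymmetrization over all three arguments turns this into the components of \<open>d\<omega>\<close>.\<close>

definition d\<omega>_rep :: "('m, 'e) chart \<Rightarrow> 'e \<Rightarrow> 'e \<Rightarrow> 'e \<Rightarrow> 'e \<Rightarrow> real" where
  "d\<omega>_rep c x h u v = frechet_derivative (\<lambda>x. \<omega>_rep c x u v) (at x) h"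

lemma ext_deriv_\<omega>_chart:
  assumes c: "c \<in> A" "p \<in> cdom c"
  shows "ext_deriv A \<omega> p x y z =
    d\<omega>_rep c (cmap c p) (tcoord A c p x) (tcoord A c p y) (tcoord A c p z)
    - d\<omega>_rep c (cmap c p) (tcoord A c p y) (tcoord A c p x) (tcoord A c p z)
    + d\<omega>_rep c (cmap c p) (tcoord A c p z) (tcoord A c p x) (tcoord A c p y)"
  unfolding d\<omega>_rep_def \<omega>_rep_def
  by (rule ext_deriv_chart[OF c bilinear_\<omega> \<omega>_skew smooth_\<omega>_rep[OF c(1), unfolded \<omega>_rep_def]])

lemma d\<omega>_rep_linear:
  assumes c: "c \<in> A" and x: "x \<in> cmap c ` cdom c"
  shows "linear (\<lambda>h. d\<omega>_rep c x h u v)" "bilinear (d\<omega>_rep c x h)"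
  unfolding d\<omega>_rep_def
  by (rule smooth_on_linear_frechet[OF open_cimage[OF c] smooth_\<omega>_rep[OF c] x, unfolded eta_contract_eq])
    (rule bilinear_frechet_family[OF open_cimage[OF c] x bilinear_\<omega>_rep[OF c] smooth_\<omega>_rep[OF c]])

lemma d\<omega>_rep_skew:
  assumes c: "c \<in> A" and x: "x \<in> cmap c ` cdom c"
  shows "d\<omega>_rep c x h u v = - d\<omega>_rep c x h v u"
proof -
  have "(\<lambda>x. \<omega>_rep c x u v) = (\<lambda>x. - \<omega>_rep c x v u)"
    unfolding \<omega>_rep_def by (rule ext) (rule \<omega>_skew)
  then have "((\<lambda>x. \<omega>_rep c x u v) has_derivative (\<lambda>h. - d\<omega>_rep c x h v u)) (at x)"
    using has_derivative_minus[OF smooth_on_has_derivative[OF open_cimage[OF c] smooth_\<omega>_rep[OF c, of v u] x]]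
    by (simp add: d\<omega>_rep_def)
  then show ?thesis unfolding d\<omega>_rep_def[of c x h u v] by (metis frechet_derivative_at)
qed

text \<open>The torsion of the Strominger-Bismut connection, as \<open>torsion_SB\<close> shows.\<close>

definition T :: "'m \<Rightarrow> 'e \<Rightarrow> 'e \<Rightarrow> 'e \<Rightarrow> real" where
  "T p u v w = ext_deriv A \<omega> p (J p u) (J p v) (J p w)"

lemma T_skew: "T p u v w = - T p v u w" "T p u v w = - T p u w v"
proof -
  note b = chart_at[of p]
  note s = d\<omega>_rep_skew[OF b(1) imageI[OF b(2)]]
  show "T p u v w = - T p v u w"
    unfolding T_def ext_deriv_\<omega>_chart[OF b] using s[of _ "tcoord A (chart_at A p) p (J p u)" "tcoord A (chart_at A p) p (J p v)"]
    by simp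
  show "T p u v w = - T p u w v"
    unfolding T_def ext_deriv_\<omega>_chart[OF b] using s[of _ "tcoord A (chart_at A p) p (J p v)" "tcoord A (chart_at A p) p (J p w)"]
    by simp
qed

text \<open>Linearity in the last argument is read off the coordinate formula; skew-symmetry moves it to the
  others.\<close>

lemma linear_T: "linear (\<lambda>u. T p u v w)" "linear (\<lambda>v. T p u v w)" "linear (\<lambda>w. T p u v w)"
proof -
  note b = chart_at[of p]
  have 3: "linear (\<lambda>w. T p u v w)" for u v
  proof -
    have 1: "linear (ext_deriv A \<omega> p x y)" for x y
      unfolding ext_deriv_\<omega>_chart[OF b, abs_def] tcoord_chart_at
      using d\<omega>_rep_linear[OF b(1) imageI[OF b(2)]]
      by (intro linear_compose_add linear_compose_sub) (auto simp: bilinear_def)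
    show ?thesis
      unfolding T_def using linear_compose[OF linear_J 1] by (simp add: o_def)
  qed
  show "linear (\<lambda>w. T p u v w)" by (rule 3)
  have 2: "linear (\<lambda>v. T p u v w)" for u w
  proof -
    have "(\<lambda>v. T p u v w) = (\<lambda>v. - T p u w v)" by (rule ext) (rule T_skew(2))
    with linear_compose_neg[OF 3[of u w]] show ?thesis by simp
  qed
  show "linear (\<lambda>v. T p u v w)" by (rule 2)
  have "(\<lambda>u. T p u v w) = (\<lambda>u. - T p v u w)" by (rule ext) (rule T_skew(1))
  with linear_compose_neg[OF 2[of v w]] show "linear (\<lambda>u. T p u v w)" by simp
qed

definition T_rep :: "('m, 'e) chart \<Rightarrow> 'e \<Rightarrow> 'e \<Rightarrow> 'e \<Rightarrow> 'e \<Rightarrow> real" where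
  "T_rep c x u v w = T (cinv c x) (tvec A c (cinv c x) u) (tvec A c (cinv c x) v) (tvec A c (cinv c x) w)"

lemma smooth_T_rep:
  assumes c: "c \<in> A"
  shows "smooth_on (cmap c ` cdom c) (\<lambda>x. T_rep c x u v w)"
proof -
  let ?O = "cmap c ` cdom c"
  note O = open_cimage[OF c]
  have d: "smooth_on ?O (\<lambda>x. d\<omega>_rep c x (J_rep c x u) (J_rep c x v) (J_rep c x w))" for u v w
  proof -
    have 0: "smooth_on ?O (\<lambda>x. d\<omega>_rep c x h y z)" for h y z
      unfolding d\<omega>_rep_def by (rule smooth_on_frechet[OF O smooth_\<omega>_rep[OF c]])
    have 1: "smooth_on ?O (\<lambda>x. d\<omega>_rep c x (J_rep c x u) y z)" for y z
      by (rule smooth_on_linear_family[where F = "\<lambda>x h. d\<omega>_rep c x h y z", OF O d\<omega>_rep_linear(1)[OF c] 0 smooth_J_rep[OF c]])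
    have 2: "smooth_on ?O (\<lambda>x. d\<omega>_rep c x (J_rep c x u) (J_rep c x v) z)" for z
      by (rule smooth_on_linear_family[where F = "\<lambda>x y. d\<omega>_rep c x (J_rep c x u) y z", OF O _ 1 smooth_J_rep[OF c]])
        (use d\<omega>_rep_linear(2)[OF c] in \<open>auto simp: bilinear_def\<close>)
    show ?thesis
      by (rule smooth_on_linear_family[where F = "\<lambda>x z. d\<omega>_rep c x (J_rep c x u) (J_rep c x v) z", OF O _ 2 smooth_J_rep[OF c]])
        (use d\<omega>_rep_linear(2)[OF c] in \<open>auto simp: bilinear_def\<close>)
  qed
  have "smooth_on ?O (\<lambda>x. d\<omega>_rep c x (J_rep c x u) (J_rep c x v) (J_rep c x w)
      - d\<omega>_rep c x (J_rep c x v) (J_rep c x u) (J_rep c x w)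
      + d\<omega>_rep c x (J_rep c x w) (J_rep c x u) (J_rep c x v))"
    by (intro smooth_on_add smooth_on_diff O d)
  then show ?thesis
    by (rule smooth_on_cong[rotated])
      (use c in \<open>auto simp: T_rep_def T_def J_rep_def ext_deriv_\<omega>_chart[OF c]\<close>)
qed

text \<open>The metric represents every linear form: the map sending \<open>z\<close> to the values of \<open>g p z\<close> on the
  basis is injective because \<open>g p\<close> is definite, hence surjective.\<close>

lemma ex1_riesz:
  assumes "linear f"
  shows "\<exists>!z. \<forall>w. g p z w = f w"
proof -
  let ?B = "\<lambda>z. \<Sum>i\<in>Basis. g p z i *\<^sub>R i"
  have comp: "?B z \<bullet> i = g p z i" if "i \<in> Basis" for z i using that by simp
  have lin: "linear ?B"
    using bilinear_g[of p]
    by (intro linear_compose_sum) (auto simp: bilinear_ladd bilinear_lmul algebra_simps intro!: linearI)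
  have eqI: "z = z'" if "\<And>w. g p z w = g p z' w" for z z'
    using that[of "z - z'"] g_pos[of "z - z'" p] bilinear_lsub[OF bilinear_g, of p z z' "z - z'"] by force
  have ext: "\<forall>w. g p z w = h w" if "\<And>i. i \<in> Basis \<Longrightarrow> g p z i = h i" "linear h" for z h
  proof
    fix w
    have "linear (g p z)" using bilinear_g by (simp add: bilinear_def)
    from linear_basis_expansion[OF this, of w] linear_basis_expansion[OF that(2), of w] that(1)
    show "g p z w = h w" by simp
  qed
  have "inj ?B"
  proof (rule injI)
    fix z z' assume "?B z = ?B z'"
    then have "g p z i = g p z' i" if "i \<in> Basis" for i using comp[OF that] by metis
    then have "\<forall>w. g p z w = g p z' w" by (rule ext) (use bilinear_g in \<open>simp_all add: bilinear_def\<close>)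
    then show "z = z'" using eqI by blast
  qed
  then have "surj ?B" using lin linear_injective_imp_surjective by blast
  then obtain z where z: "(\<Sum>i\<in>Basis. f i *\<^sub>R i) = ?B z" using surjD[of ?B] by blast
  have "g p z i = f i" if "i \<in> Basis" for i
  proof -
    have "g p z i = (\<Sum>i\<in>Basis. f i *\<^sub>R i) \<bullet> i" unfolding z by (rule comp[OF that, symmetric])
    also have "\<dots> = f i" using that by simp
    finally show ?thesis .
  qed
  then have "\<forall>w. g p z w = f w" by (rule ext[OF _ assms])
  then show ?thesis using eqI by (metis (no_types, lifting))
qed

text \<open>The form \<open>T\<close> as a vector-valued form; it is twice the difference of the two connections.\<close>

definition \<tau> :: "'m \<Rightarrow> 'e \<Rightarrow> 'e \<Rightarrow> 'e" where
  "\<tau> p u v = (THE z. \<forall>w. g p z w = T p u v w)"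

lemma g_\<tau>: "g p (\<tau> p u v) w = T p u v w"
  unfolding \<tau>_def using theI'[OF ex1_riesz[OF linear_T(3)]] by blast

lemma \<tau>_eqI: "(\<And>w. g p z w = T p u v w) \<Longrightarrow> \<tau> p u v = z"
  unfolding \<tau>_def using the1_equality[OF ex1_riesz[OF linear_T(3)]] by blast

lemma bilinear_\<tau>: "bilinear (\<tau> p)"
  unfolding bilinear_def
proof (intro conjI allI)
  note G = bilinear_ladd[OF bilinear_g] bilinear_lmul[OF bilinear_g] g_\<tau>
  show "linear (\<tau> p u)" for u
    by (rule linearI; rule \<tau>_eqI) (simp_all add: G linear_add[OF linear_T(2)] linear_scale[OF linear_T(2)])
  show "linear (\<lambda>u. \<tau> p u v)" for v
    by (rule linearI; rule \<tau>_eqI) (simp_all add: G linear_add[OF linear_T(1)] linear_scale[OF linear_T(1)])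
qed

lemma \<tau>_skew: "\<tau> p u v = - \<tau> p v u"
  by (rule \<tau>_eqI) (simp add: bilinear_lneg[OF bilinear_g] g_\<tau> T_skew(1)[of p u])

definition \<tau>_rep :: "('m, 'e) chart \<Rightarrow> 'e \<Rightarrow> 'e \<Rightarrow> 'e \<Rightarrow> 'e" where
  "\<tau>_rep c x u v = tcoord A c (cinv c x) (\<tau> (cinv c x) (tvec A c (cinv c x) u) (tvec A c (cinv c x) v))"

lemma G_\<tau>_rep:
  "\<lbrakk>c \<in> A; x \<in> cmap c ` cdom c\<rbrakk> \<Longrightarrow> G c x (\<tau>_rep c x u v) w = T_rep c x u v w"
  by (auto simp: metric_rep_def \<tau>_rep_def T_rep_def g_\<tau>)

lemma bilinear_\<tau>_rep:
  assumes "c \<in> A" "x \<in> cmap c ` cdom c"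
  shows "bilinear (\<tau>_rep c x)"
proof -
  have p: "cinv c x \<in> cdom c" using assms by auto
  note lin = linear_tvec[OF assms(1) p] linear_tcoord[OF assms(1) p]
  have "linear (\<tau> (cinv c x) u)" "linear (\<lambda>u. \<tau> (cinv c x) u v)" for u v
    using bilinear_\<tau> by (simp_all add: bilinear_def)
  from linear_compose[OF linear_compose[OF lin(1) this(1)] lin(2)]
    linear_compose[OF linear_compose[OF lin(1) this(2)] lin(2)]
  show ?thesis by (simp add: bilinear_def \<tau>_rep_def o_def)
qed

lemma \<tau>_rep_skew:
  assumes "c \<in> A" "x \<in> cmap c ` cdom c"
  shows "\<tau>_rep c x u v = - \<tau>_rep c x v u"
proof -
  have "cinv c x \<in> cdom c" using assms by auto
  from linear_neg[OF linear_tcoord[OF assms(1) this]] show ?thesis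
    unfolding \<tau>_rep_def by (subst \<tau>_skew) simp
qed

text \<open>The components of \<open>\<tau>\<close> solve the linear system with the Gram matrix of the metric and the components
  of \<open>T\<close> as right-hand side.\<close>

lemma smooth_\<tau>_rep:
  assumes c: "c \<in> A"
  shows "smooth_on (cmap c ` cdom c) (\<lambda>x. \<tau>_rep c x u v)"
proof -
  let ?O = "cmap c ` cdom c"
  note O = open_cimage[OF c]
  let ?B = "\<lambda>x z. \<Sum>i\<in>Basis. G c x z i *\<^sub>R i"
  show ?thesis
  proof (rule smooth_on_linear_solve[OF O, where B = ?B])
    fix x assume x: "x \<in> ?O"
    then obtain p where p: "p \<in> cdom c" "x = cmap c p" by blast
    note bil = bilinear_G[OF c x]
    show lin: "linear (?B x)"
      using bil by (intro linear_compose_sum) (auto simp: bilinear_ladd bilinear_lmul algebra_simps intro!: linearI)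
    show "inj (?B x)"
      unfolding linear_injective_0[OF lin]
    proof (intro allI impI)
      fix z assume z: "?B x z = 0"
      have "linear (G c x z)" using bil by (simp add: bilinear_def)
      from linear_basis_expansion[OF this, of z]
      have "G c x z z = ?B x z \<bullet> z" by (simp add: inner_sum_left inner_commute[of z] mult.commute)
      then have "g p (tvec A c p z) (tvec A c p z) = 0" using z c p by (simp add: metric_rep_def)
      then have "tvec A c p z = 0" using g_pos[of "tvec A c p z" p] by (metis less_irrefl)
      then show "z = 0" using tcoord_tvec[OF c p(1), of z] linear_0[OF linear_tcoord[OF c p(1)]] by simp
    qed
    show "?B x (\<tau>_rep c x u v) = (\<Sum>i\<in>Basis. T_rep c x u v i *\<^sub>R i)"
      by (simp add: G_\<tau>_rep[OF c x])
  next
    show "smooth_on ?O (\<lambda>x. ?B x z)" for z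
      by (intro smooth_on_sum smooth_on_scaleR smooth_on_const O smooth_G[OF c])
    show "smooth_on ?O (\<lambda>x. \<Sum>i\<in>Basis. T_rep c x u v i *\<^sub>R i)"
      by (intro smooth_on_sum smooth_on_scaleR smooth_on_const O smooth_T_rep[OF c])
  qed
qed

lemma smooth_field_\<tau>:
  assumes U: "open U" and X: "smooth_field A U X" and Y: "smooth_field A U Y"
  shows "smooth_field A U (\<lambda>q. \<tau> q (X q) (Y q))"
  unfolding smooth_field_def
proof
  fix d assume d: "d \<in> A"
  let ?O = "cmap d ` (cdom d \<inter> U)"
  note O = open_cimage_Int[OF d U]
  have bil: "bilinear (\<tau>_rep d x)" if "x \<in> ?O" for x
    using bilinear_\<tau>_rep[OF d] that by blast
  have s: "smooth_on ?O (\<lambda>x. \<tau>_rep d x u v)" for u v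
    by (rule smooth_on_subset[OF open_cimage[OF d] O _ smooth_\<tau>_rep[OF d]]) blast
  have 1: "smooth_on ?O (\<lambda>x. \<tau>_rep d x (local_rep A d X x) v)" for v
    by (rule smooth_on_linear_family[where F = "\<lambda>x u. \<tau>_rep d x u v", OF O _ s smooth_fieldD[OF X d]])
      (use bil in \<open>auto simp: bilinear_def\<close>)
  have "smooth_on ?O (\<lambda>x. \<tau>_rep d x (local_rep A d X x) (local_rep A d Y x))"
    by (rule smooth_on_linear_family[where F = "\<lambda>x v. \<tau>_rep d x (local_rep A d X x) v", OF O _ 1 smooth_fieldD[OF Y d]])
      (use bil in \<open>auto simp: bilinear_def\<close>)
  then show "smooth_on ?O (\<lambda>x. tcoord A d (cinv d x) (\<tau> (cinv d x) (X (cinv d x)) (Y (cinv d x))))"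
    by (rule smooth_on_cong[rotated]) (use d in \<open>auto simp: \<tau>_rep_def local_rep_def\<close>)
qed

end

locale bismut = almost_hermitian A g J
  for A :: "('m::topological_space, 'e::euclidean_space) chart set" and g J +
  fixes LC :: "('m, 'e) connection"
  assumes LC: "levi_civita A g LC"
begin

sublocale LC: manifold_connection A LC
  by unfold_locales (use LC in \<open>simp add: levi_civita_def\<close>)

abbreviation SB :: "('m, 'e) connection" where "SB \<equiv> strominger_bismut A g J LC"

lemma SB_eq: "SB p v Y = LC p v Y + (1/2) *\<^sub>R \<tau> p v (Y p)"
proof -
  have "g p (LC p v Y + (1/2) *\<^sub>R \<tau> p v (Y p)) z = g p (LC p v Y) z
      + 1/2 * ext_deriv A \<omega> p (J p v) (J p (Y p)) (J p z)" for z
    by (simp add: bilinear_ladd[OF bilinear_g] bilinear_lmul[OF bilinear_g] g_\<tau> T_def)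
  moreover from this have "u = LC p v Y + (1/2) *\<^sub>R \<tau> p v (Y p)" if "\<forall>z. g p u z = g p (LC p v Y) z
      + 1/2 * ext_deriv A \<omega> p (J p v) (J p (Y p)) (J p z)" for u
  proof -
    have "linear (g p u)" using bilinear_g by (simp add: bilinear_def)
    from ex1_riesz[OF this, of p] that calculation show ?thesis by metis
  qed
  ultimately show ?thesis
    unfolding strominger_bismut_def by (intro the_equality) blast+
qed

text \<open>Being an affine connection plus a smooth tensor, \<open>SB\<close> is an affine connection, so the coordinate
  formulas hold for it too. Smoothness of \<open>\<tau>\<close> is essential: the curvature of \<open>SB\<close> contains the
  Levi-Civita derivative of \<open>SB q (Y q) Z\<close>, about which something is known for smooth fields only.\<close>

lemma affine_connection_SB: "affine_connection A SB"
  unfolding affine_connection_def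
proof (intro allI impI conjI ballI)
  fix U X Y Z f
  assume H: "open U \<and> smooth_field A U X \<and> smooth_field A U Y \<and> smooth_field A U Z \<and> smooth_fun A U f"
  then have U: "open U" by blast
  have "smooth_field A U (\<lambda>q. LC q (X q) Y + (1/2) *\<^sub>R \<tau> q (X q) (Y q))"
    using H by (intro smooth_field_add LC.conn_smooth smooth_field_scale smooth_field_\<tau> smooth_fun_const) auto
  then show "smooth_field A U (\<lambda>q. SB q (X q) Y)" by (simp add: SB_eq)
  fix p assume p: "p \<in> U"
  show "linear (\<lambda>v. SB p v Y)"
    unfolding SB_eq using LC.conn_linear[OF U p] H bilinear_\<tau>
    by (intro linear_compose_add linear_compose_scale_right) (auto simp: bilinear_def)
  fix v
  show "SB p v (\<lambda>q. Y q + Z q) = SB p v Y + SB p v Z"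
    using H LC.conn_add[OF U p, of Y Z v] by (simp add: SB_eq bilinear_radd[OF bilinear_\<tau>] scaleR_add_right)
  show "SB p v (\<lambda>q. f q *\<^sub>R Y q) = dir_deriv A f p v *\<^sub>R Y p + f p *\<^sub>R SB p v Y"
    using H LC.conn_leibniz[OF U p, of Y f v] by (simp add: SB_eq bilinear_rmul[OF bilinear_\<tau>] scaleR_add_right)
qed

sublocale SB: manifold_connection A SB
  by unfold_locales (rule affine_connection_SB)

lemma christoffel_SB:
  assumes c: "c \<in> A" and x: "x \<in> cmap c ` cdom c"
  shows "SB.\<Gamma> c x u v = LC.\<Gamma> c x u v + (1/2) *\<^sub>R \<tau>_rep c x u v"
  using linear_tcoord[OF c] c x
  by (auto simp: christoffel_def SB_eq \<tau>_rep_def linear_add linear_scale)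

lemma torsion_SB: "torsion A g SB p x y z = T p x y z"
proof -
  note b = chart_at[of p]
  have "torsion_fields A LC (extend A p x) (extend A p y) p = 0"
    using LC open_cdom[OF b(1)] b(2) smooth_field_extend unfolding levi_civita_def by blast
  then have "torsion_fields A SB (extend A p x) (extend A p y) p = (1/2) *\<^sub>R \<tau> p x y - (1/2) *\<^sub>R \<tau> p y x"
    by (simp add: torsion_fields_def SB_eq algebra_simps)
  also have "\<dots> = \<tau> p x y"
    unfolding \<tau>_skew[of p y x] by (simp flip: scaleR_add_left)
  finally show ?thesis by (simp add: torsion_def g_\<tau>)
qed

text \<open>Fields with constant components in \<open>c\<close> commute, so this is the vanishing of the torsion on them.\<close>

lemma christoffel_LC_sym:
  assumes c: "c \<in> A" and x: "x \<in> cmap c ` cdom c"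
  shows "LC.\<Gamma> c x u v = LC.\<Gamma> c x v u"
proof -
  obtain p where p: "p \<in> cdom c" "x = cmap c p" using x by blast
  let ?E = "\<lambda>u q. tvec A c q u"
  note E = smooth_field_tvec[OF c] and o = open_cdom[OF c]
  have "torsion_fields A LC (?E u) (?E v) p = 0"
    using LC o E p(1) unfolding levi_civita_def by blast
  moreover have "tcoord A c p (lie_bracket A (?E u) (?E v) p) = 0"
    unfolding lie_bracket_chart[OF c p(1) o p(1) E E] using local_rep_tvec_derivative[OF c x] p by simp
  ultimately have "tcoord A c p (LC p (?E u p) (?E v)) - tcoord A c p (LC p (?E v p) (?E u)) = 0"
    using linear_diff[OF linear_tcoord[OF c p(1)]] linear_0[OF linear_tcoord[OF c p(1)]]
    unfolding torsion_fields_def by (metis diff_0_right)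
  then show ?thesis using c p by (simp add: christoffel_def)
qed

lemma metric_rep_derivative:
  assumes c: "c \<in> A" and x: "x \<in> cmap c ` cdom c"
  shows "frechet_derivative (\<lambda>x. G c x u v) (at x) h = G c x (LC.\<Gamma> c x h u) v + G c x u (LC.\<Gamma> c x h v)"
proof -
  obtain p where p: "p \<in> cdom c" "x = cmap c p" using x by blast
  let ?E = "\<lambda>u q. tvec A c q u"
  note E = smooth_field_tvec[OF c] and o = open_cdom[OF c]
  have "((\<lambda>x. g (cinv c x) (?E u (cinv c x)) (?E v (cinv c x))) has_derivative
      frechet_derivative (\<lambda>x. G c x u v) (at x)) (at (cmap c p))"
    using smooth_on_has_derivative[OF open_cimage[OF c] smooth_G[OF c] x, of u v] p
    by (simp add: metric_rep_def[abs_def])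
  from dir_deriv_chart[OF c p(1) this, of "tvec A c p h"]
  have "frechet_derivative (\<lambda>x. G c x u v) (at x) h =
      dir_deriv A (\<lambda>q. g q (?E u q) (?E v q)) p (tvec A c p h)" using c p by simp
  also have "\<dots> = g p (LC p (tvec A c p h) (?E u)) (?E v p) + g p (?E u p) (LC p (tvec A c p h) (?E v))"
    using LC o E p(1) unfolding levi_civita_def by blast
  finally show ?thesis using c p by (simp add: metric_rep_def christoffel_def)
qed

text \<open>Substitute \<open>\<Gamma> + \<tau>/2\<close> for the Christoffel symbols. The second and third arguments of the curvature
  are equal, and \<open>\<tau> n n\<close> and its derivatives vanish.\<close>

lemma riemann_SB:
  fixes x :: 'e and c :: "('m, 'e) chart" and v n :: 'e
  defines "\<Gamma> \<equiv> LC.\<Gamma> c x" and "t \<equiv> \<tau>_rep c x"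
  assumes c: "c \<in> A" and x: "x \<in> cmap c ` cdom c"
  shows "riemann A SB c x v n n = riemann A LC c x v n n
    - (1/2) *\<^sub>R frechet_derivative (\<lambda>x. \<tau>_rep c x v n) (at x) n
    + (1/2) *\<^sub>R t v (\<Gamma> n n) - (1/2) *\<^sub>R \<Gamma> n (t v n) - (1/2) *\<^sub>R t n (\<Gamma> v n) - (1/4) *\<^sub>R t n (t v n)"
proof -
  note O = open_cimage[OF c]
  have t0: "\<tau>_rep c y n n = 0" if "y \<in> cmap c ` cdom c" for y
  proof -
    have "2 *\<^sub>R \<tau>_rep c y n n = \<tau>_rep c y n n + \<tau>_rep c y n n" by (rule scaleR_2)
    also have "\<dots> = 0" using \<tau>_rep_skew[OF c that, of n n] by (metis add.right_inverse)
    finally show ?thesis by simp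
  qed
  have d: "frechet_derivative (\<lambda>x. SB.\<Gamma> c x u w) (at x) h = frechet_derivative (\<lambda>x. LC.\<Gamma> c x u w) (at x) h
      + (1/2) *\<^sub>R frechet_derivative (\<lambda>x. \<tau>_rep c x u w) (at x) h" for u w h
  proof -
    have "((\<lambda>x. SB.\<Gamma> c x u w) has_derivative (\<lambda>h. frechet_derivative (\<lambda>x. LC.\<Gamma> c x u w) (at x) h
        + (1/2) *\<^sub>R frechet_derivative (\<lambda>x. \<tau>_rep c x u w) (at x) h)) (at x)"
      by (rule has_derivative_transform_within_open[OF has_derivative_add[OF
            smooth_on_has_derivative[OF O LC.smooth_christoffel[OF c] x]
            has_derivative_scaleR_right[OF smooth_on_has_derivative[OF O smooth_\<tau>_rep[OF c] x]]] O x])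
        (simp add: christoffel_SB[OF c])
    then show ?thesis by (metis (no_types, lifting) frechet_derivative_at)
  qed
  have d0: "frechet_derivative (\<lambda>x. \<tau>_rep c x n n) (at x) h = 0" for h
  proof -
    have "((\<lambda>x. \<tau>_rep c x n n) has_derivative (\<lambda>h. 0)) (at x)"
      by (rule has_derivative_transform_within_open[OF has_derivative_const O x]) (simp add: t0)
    then show ?thesis by (metis frechet_derivative_at)
  qed
  note bil = LC.bilinear_christoffel[OF c x] bilinear_\<tau>_rep[OF c x]
  show ?thesis
    unfolding riemann_def d d0 christoffel_SB[OF c x] t0[OF x] \<Gamma>_def t_def
    by (simp add: bilinear_radd[OF bil(1)] bilinear_radd[OF bil(2)] bilinear_rmul[OF bil(1)] bilinear_rmul[OF bil(2)]
        algebra_simps)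
qed

end

section \<open>Fields along curves in coordinates\<close>

text \<open>At a time \<open>t\<close> a field along the curve is given by its components in a chart depending on \<open>t\<close>. To
  differentiate or to integrate, one fixes a chart \<open>c\<close> and works on the times at which the curve runs
  in its domain. These form a relatively open subset of \<open>{a..b}\<close>, so that derivatives
  within it and within \<open>{a..b}\<close> agree.\<close>

locale manifold_curve = smooth_manifold A
  for A :: "('m::topological_space, 'e::euclidean_space) chart set" +
  fixes a b :: real and \<gamma> :: "real \<Rightarrow> 'm"
  assumes ab: "a < b" and curve: "smooth_curve A a b \<gamma>"
begin

abbreviation chart_times :: "('m, 'e) chart \<Rightarrow> real set" where
  "chart_times c \<equiv> {t \<in> {a..b}. \<gamma> t \<in> cdom c}"

abbreviation deriv_along :: "(real \<Rightarrow> 'v::real_normed_vector) \<Rightarrow> real \<Rightarrow> 'v" where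
  "deriv_along f t \<equiv> vector_derivative f (at t within {a..b})"

abbreviation vel :: "real \<Rightarrow> 'e" where "vel \<equiv> velocity A a b \<gamma>"

abbreviation path_rep :: "('m, 'e) chart \<Rightarrow> real \<Rightarrow> 'e" where "path_rep c t \<equiv> cmap c (\<gamma> t)"

definition field_rep :: "('m, 'e) chart \<Rightarrow> (real \<Rightarrow> 'e) \<Rightarrow> real \<Rightarrow> 'e" where
  "field_rep c V t = tcoord A c (\<gamma> t) (V t)"

lemma openin_times: "c \<in> A \<Longrightarrow> openin (top_of_set {a..b}) (chart_times c)"
  using continuous_openin_preimage_gen[of "{a..b}" \<gamma> "cdom c"] curve open_cdom[of c]
  by (simp add: smooth_curve_def vimage_def Int_def)

lemma at_within_relopen:
  assumes "openin (top_of_set {a..b}) S" "t \<in> S"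
  shows "at t within S = at t within {a..b}"
proof -
  obtain T where "open T" "S = {a..b} \<inter> T" using assms(1) openin_open by blast
  then show ?thesis using assms(2) by (intro at_within_nhd[of t T]) auto
qed

lemma at_within_times: "\<lbrakk>c \<in> A; t \<in> chart_times c\<rbrakk> \<Longrightarrow> at t within chart_times c = at t within {a..b}"
  using at_within_relopen openin_times by blast

lemma frechet_deriv_along:
  assumes c: "c \<in> A" "t \<in> chart_times c" and f: "f differentiable (at t within chart_times c)"
  shows "(f has_vector_derivative deriv_along f t) (at t within {a..b})"
    and "frechet_derivative f (at t within chart_times c) 1 = deriv_along f t"
proof -
  let ?f' = "frechet_derivative f (at t within chart_times c)"
  have d: "(f has_derivative ?f') (at t within {a..b})"
    using f unfolding frechet_derivative_works at_within_times[OF c] .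
  have "?f' = (\<lambda>h. h *\<^sub>R ?f' 1)"
  proof
    fix h show "?f' h = h *\<^sub>R ?f' 1" using linear_scale[OF has_derivative_linear[OF d], of h 1] by simp
  qed
  with d have v: "(f has_vector_derivative ?f' 1) (at t within {a..b})"
    by (simp add: has_vector_derivative_def)
  moreover have "at t within {a..b} \<noteq> bot" using c(2) ab islimpt_Icc[OF ab] by (simp add: trivial_limit_within)
  ultimately show "?f' 1 = deriv_along f t" using vector_derivative_within by metis
  with v show "(f has_vector_derivative deriv_along f t) (at t within {a..b})" by simp
qed

lemma has_deriv_along:
  assumes "c \<in> A" "smooth_on (chart_times c) f" "t \<in> chart_times c"
  shows "(f has_vector_derivative deriv_along f t) (at t within {a..b})"
proof -
  have "Ck_on (Suc 0) (chart_times c) f" using assms(2) by (simp only: smooth_on_def)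
  then have "f differentiable (at t within chart_times c)"
    using assms(3) unfolding Ck_on.simps differentiable_on_def by blast
  then show ?thesis by (rule frechet_deriv_along(1)[OF assms(1,3)])
qed

lemma smooth_deriv_along:
  assumes c: "c \<in> A" and f: "smooth_on (chart_times c) f"
  shows "smooth_on (chart_times c) (deriv_along f)"
  unfolding smooth_on_def
proof
  fix k
  have C: "Ck_on (Suc k) (chart_times c) f" using f by (simp only: smooth_on_def)
  then have "Ck_on k (chart_times c) (\<lambda>t. frechet_derivative f (at t within chart_times c) 1)"
    unfolding Ck_on.simps by blast
  then show "Ck_on k (chart_times c) (deriv_along f)"
    by (rule Ck_on_cong[rotated])
      (use C in \<open>auto simp only: Ck_on.simps differentiable_on_def intro!: frechet_deriv_along(2)[OF c]\<close>)
qed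

lemma smooth_path_rep: "c \<in> A \<Longrightarrow> smooth_on (chart_times c) (path_rep c)"
  using curve by (simp add: smooth_curve_def)

lemma smooth_field_rep:
  "\<lbrakk>smooth_field_along A a b \<gamma> V; c \<in> A\<rbrakk> \<Longrightarrow> smooth_on (chart_times c) (field_rep c V)"
  by (simp add: smooth_field_along_def field_rep_def[abs_def])

lemma deriv_alongI:
  "\<lbrakk>t \<in> {a..b}; (f has_vector_derivative f') (at t within {a..b})\<rbrakk> \<Longrightarrow> deriv_along f t = f'"
  using islimpt_Icc[OF ab] by (intro vector_derivative_within) (simp_all add: trivial_limit_within)

lemma velocity_chart:
  assumes c: "c \<in> A" "t \<in> chart_times c"
  shows "field_rep c vel t = deriv_along (path_rep c) t"
proof -
  let ?b = "chart_at A (\<gamma> t)"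
  let ?S = "chart_times ?b \<inter> chart_times c"
  note b = chart_at[of "\<gamma> t"]
  have S: "openin (top_of_set {a..b}) ?S" "t \<in> ?S"
    using openin_times[OF b(1)] openin_times[OF c(1)] b(2) c(2) by auto
  have "(path_rep ?b has_vector_derivative vel t) (at t within {a..b})"
    unfolding velocity_def by (rule has_deriv_along[OF b(1) smooth_path_rep[OF b(1)]]) (use S in blast)
  from vector_derivative_diff_chain_within[OF this, OF dtrans_has_derivative[OF b(1) c(1) b(2), THEN has_derivative_at_withinI]]
  have "((\<lambda>x. cmap c (cinv ?b x)) \<circ> path_rep ?b has_vector_derivative field_rep c vel t) (at t within {a..b})"
    using c(2) by (simp add: field_rep_def tcoord_dtrans)
  then have "((\<lambda>x. cmap c (cinv ?b x)) \<circ> path_rep ?b has_vector_derivative field_rep c vel t) (at t within ?S)"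
    by (simp only: at_within_relopen[OF S])
  then have "(path_rep c has_vector_derivative field_rep c vel t) (at t within ?S)"
    by (rule has_vector_derivative_transform[OF S(2), rotated]) (use b in auto)
  then have "(path_rep c has_vector_derivative field_rep c vel t) (at t within {a..b})"
    by (simp only: at_within_relopen[OF S])
  from deriv_alongI[OF _ this] show ?thesis using c(2) by simp
qed

lemma smooth_velocity: "smooth_field_along A a b \<gamma> vel"
  unfolding smooth_field_along_def
proof
  fix c assume c: "c \<in> A"
  show "smooth_on (chart_times c) (\<lambda>t. tcoord A c (\<gamma> t) (vel t))"
    by (rule smooth_on_cong[OF _ smooth_deriv_along[OF c smooth_path_rep[OF c]]])
      (use velocity_chart[OF c] in \<open>simp add: field_rep_def\<close>)
qed

text \<open>The covariant derivative at \<open>t\<close> is defined by the frame of the chart chosen at \<open>\<gamma> t\<close>. That frame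
  is a family of smooth fields, whose components in \<open>c\<close> are differentiated along the curve by
  the chain rule; the derivatives that appear are those in \<open>conn_chart\<close>.\<close>

lemma cov_along_chart:
  assumes D: "affine_connection A D" and c: "c \<in> A" "t \<in> chart_times c" and V: "smooth_field_along A a b \<gamma> V"
  shows "field_rep c (cov_along A D a b \<gamma> V) t =
    deriv_along (field_rep c V) t + christoffel A D c (path_rep c t) (field_rep c vel t) (field_rep c V t)"
proof -
  interpret D: manifold_connection A D by unfold_locales (rule D)
  let ?b = "chart_at A (\<gamma> t)" and ?x = "path_rep c t" and ?t = "tcoord A c (\<gamma> t)"
  let ?S = "chart_times ?b \<inter> chart_times c"
  define E where "E = extend A (\<gamma> t)"
  define k where "k = (\<lambda>i s. field_rep ?b V s \<bullet> i)"
  define dE where "dE = (\<lambda>i. frechet_derivative (local_rep A c (E i)) (at ?x) (field_rep c vel t))"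
  note b = chart_at[of "\<gamma> t"]
  have p: "\<gamma> t \<in> cdom c" using c(2) by blast
  have S: "openin (top_of_set {a..b}) ?S" "t \<in> ?S"
    using openin_times[OF b(1)] openin_times[OF c(1)] b(2) c(2) by auto
  note E = smooth_field_extend[of "\<gamma> t", folded E_def]
  note ob = open_cdom[OF b(1)]
  have dk: "(k i has_vector_derivative deriv_along (k i) t) (at t within {a..b})" for i
  proof -
    have d: "(field_rep ?b V has_vector_derivative deriv_along (field_rep ?b V) t) (at t within {a..b})"
      by (rule has_deriv_along[OF b(1) smooth_field_rep[OF V b(1)]]) (use S in blast)
    have 1: "(k i has_vector_derivative deriv_along (field_rep ?b V) t \<bullet> i) (at t within {a..b})"
      unfolding k_def
      by (rule bounded_linear.has_vector_derivative[OF bounded_linear_inner_left d])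
    from deriv_alongI[OF _ 1] 1 show ?thesis using S(2) by simp
  qed
  have dloc: "((\<lambda>s. local_rep A c (E i) (path_rep c s)) has_vector_derivative dE i) (at t within {a..b})" for i
  proof -
    have "(path_rep c has_vector_derivative field_rep c vel t) (at t within {a..b})"
      unfolding velocity_chart[OF c] by (rule has_deriv_along[OF c(1) smooth_path_rep[OF c(1)] c(2)])
    from vector_derivative_diff_chain_within[OF this, OF
        local_rep_has_derivative[OF c(1) ob b(2) p E, THEN has_derivative_at_withinI]]
    show ?thesis by (simp add: dE_def o_def)
  qed
  have "((\<lambda>s. \<Sum>i\<in>Basis. k i s *\<^sub>R local_rep A c (E i) (path_rep c s)) has_vector_derivative
      (\<Sum>i\<in>Basis. k i t *\<^sub>R dE i + deriv_along (k i) t *\<^sub>R local_rep A c (E i) ?x)) (at t within {a..b})"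
    by (intro has_vector_derivative_sum has_vector_derivative_scaleR
        dk[folded has_real_derivative_iff_has_vector_derivative] dloc)
  then have "((\<lambda>s. \<Sum>i\<in>Basis. k i s *\<^sub>R local_rep A c (E i) (path_rep c s)) has_vector_derivative
      (\<Sum>i\<in>Basis. k i t *\<^sub>R dE i + deriv_along (k i) t *\<^sub>R local_rep A c (E i) ?x)) (at t within ?S)"
    by (simp only: at_within_relopen[OF S])
  then have "(field_rep c V has_vector_derivative
      (\<Sum>i\<in>Basis. k i t *\<^sub>R dE i + deriv_along (k i) t *\<^sub>R local_rep A c (E i) ?x)) (at t within ?S)"
  proof (rule has_vector_derivative_transform[OF S(2), rotated])
    fix s assume "s \<in> ?S"
    then have q: "\<gamma> s \<in> cdom ?b" "\<gamma> s \<in> cdom c" by blast+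
    have "field_rep c V s = tcoord A c (\<gamma> s) (tvec A ?b (\<gamma> s) (field_rep ?b V s))"
      using b(1) q(1) by (simp add: field_rep_def)
    also have "\<dots> = (\<Sum>i\<in>Basis. (field_rep ?b V s \<bullet> i) *\<^sub>R tcoord A c (\<gamma> s) (tvec A ?b (\<gamma> s) i))"
      using linear_basis_expansion[OF linear_compose[OF linear_tvec[OF b(1) q(1)] linear_tcoord[OF c(1) q(2)]]]
      unfolding o_def .
    finally show "field_rep c V s = (\<Sum>i\<in>Basis. k i s *\<^sub>R local_rep A c (E i) (path_rep c s))"
      using c(1) q(2) by (simp add: local_rep_cmap k_def E_def extend_def)
  qed
  then have "(field_rep c V has_vector_derivative
      (\<Sum>i\<in>Basis. k i t *\<^sub>R dE i + deriv_along (k i) t *\<^sub>R local_rep A c (E i) ?x)) (at t within {a..b})"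
    by (simp only: at_within_relopen[OF S])
  from deriv_alongI[OF _ this] have dV: "deriv_along (field_rep c V) t =
      (\<Sum>i\<in>Basis. k i t *\<^sub>R dE i + deriv_along (k i) t *\<^sub>R ?t i)"
    using c p by (simp add: local_rep_cmap E_def)
  have V: "V t = (\<Sum>i\<in>Basis. k i t *\<^sub>R i)"
    by (simp add: k_def field_rep_def euclidean_representation)
  have lin: "linear (\<lambda>u. D.\<Gamma> c ?x (field_rep c vel t) (?t u))"
  proof -
    have "linear (D.\<Gamma> c ?x (field_rep c vel t))"
      using D.bilinear_christoffel[OF c(1) imageI[OF p]] by (simp add: bilinear_def)
    from linear_compose[OF linear_tcoord[OF c(1) p] this] show ?thesis by (simp add: o_def)
  qed
  have "cov_along A D a b \<gamma> V t =
      (\<Sum>i\<in>Basis. deriv_along (k i) t *\<^sub>R i + k i t *\<^sub>R D (\<gamma> t) (vel t) (E i))"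
    by (simp add: cov_along_def Let_def k_def[abs_def] field_rep_def[abs_def] E_def)
  then have "field_rep c (cov_along A D a b \<gamma> V) t =
      (\<Sum>i\<in>Basis. deriv_along (k i) t *\<^sub>R ?t i + k i t *\<^sub>R ?t (D (\<gamma> t) (vel t) (E i)))"
    using linear_tcoord[OF c(1) p] by (simp add: field_rep_def linear_sum linear_add linear_scale)
  also have "\<dots> = (\<Sum>i\<in>Basis. deriv_along (k i) t *\<^sub>R ?t i + k i t *\<^sub>R dE i
      + k i t *\<^sub>R D.\<Gamma> c ?x (field_rep c vel t) (?t i))"
    by (simp add: D.conn_chart[OF c(1) p ob b(2) E] scaleR_add_right dE_def field_rep_def add.assoc)
       (simp add: E_def)
  also have "\<dots> = deriv_along (field_rep c V) t + (\<Sum>i\<in>Basis. k i t *\<^sub>R D.\<Gamma> c ?x (field_rep c vel t) (?t i))"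
    unfolding dV by (simp add: sum.distrib)
  also have "(\<Sum>i\<in>Basis. k i t *\<^sub>R D.\<Gamma> c ?x (field_rep c vel t) (?t i)) =
      D.\<Gamma> c ?x (field_rep c vel t) (?t (V t))"
    unfolding V by (simp add: linear_sum[OF lin] linear_scale[OF lin])
  finally show ?thesis by (simp only: field_rep_def[of c V t])
qed

end

section \<open>The index form\<close>

text \<open>The pointwise heart of the theorem, in components at one point: \<open>v'\<close>, \<open>w'\<close> and \<open>n'\<close> are the derivatives
  of the components of \<open>V\<close>, \<open>W\<close> and the velocity \<open>n\<close>, and \<open>d\<tau>\<close> is the derivative of \<open>\<tau>\<close> along
  \<open>n\<close> evaluated at \<open>(v, n)\<close>. The hypothesis on \<open>R'\<close> is \<open>riemann_SB\<close>, that on \<open>n'\<close> the geodesic equation.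
  The last summand is the derivative along the curve of \<open>- G (\<tau> v n) w / 2\<close>; its first two
  terms come from the derivative of the metric, which the Levi-Civita connection preserves.
  By \<open>skew\<close> the terms quadratic in \<open>\<tau>\<close> cancel: they are \<open>1/4 - 1/2 + 1/4\<close> times the same number.\<close>

lemma index_integrand_identity:
  fixes G :: "'e::real_vector \<Rightarrow> 'e \<Rightarrow> real" and \<Gamma> \<tau> :: "'e \<Rightarrow> 'e \<Rightarrow> 'e"
  assumes G: "bilinear G" and G_sym: "\<And>x y. G x y = G y x"
    and \<Gamma>: "bilinear \<Gamma>" and \<Gamma>_sym: "\<And>x y. \<Gamma> x y = \<Gamma> y x"
    and \<tau>: "bilinear \<tau>" and skew: "\<And>x y z. G (\<tau> x y) z = - G (\<tau> y x) z" "\<And>x y z. G (\<tau> x y) z = - G (\<tau> x z) y"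
    and R': "R' = R - (1/2) *\<^sub>R d\<tau> + (1/2) *\<^sub>R \<tau> v (\<Gamma> n n) - (1/2) *\<^sub>R \<Gamma> n (\<tau> v n)
      - (1/2) *\<^sub>R \<tau> n (\<Gamma> v n) - (1/4) *\<^sub>R \<tau> n (\<tau> v n)"
    and n': "n' = - \<Gamma> n n"
  shows "G (v' + \<Gamma> n v) (w' + \<Gamma> n w) - G R w =
    G (v' + \<Gamma> n v + (1/2) *\<^sub>R \<tau> n v) (w' + \<Gamma> n w + (1/2) *\<^sub>R \<tau> n w)
    + G (\<tau> v n) (w' + \<Gamma> n w + (1/2) *\<^sub>R \<tau> n w) - G R' w
    - 1/2 * (G (\<Gamma> n (\<tau> v n)) w + G (\<tau> v n) (\<Gamma> n w)
      + G (d\<tau> + \<tau> v' n + \<tau> v n') w + G (\<tau> v n) w')"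
proof -
  note Gs = bilinear_ladd[OF G] bilinear_radd[OF G] bilinear_lmul[OF G] bilinear_rmul[OF G]
    bilinear_lsub[OF G] bilinear_rsub[OF G] bilinear_lneg[OF G] bilinear_rneg[OF G]
  have 1: "G x (\<tau> n w) = G (\<tau> x n) w" for x
    using G_sym[of x "\<tau> n w"] skew(2)[of n w x] skew(1)[of n x w] by simp
  have 2: "G (\<tau> n v) x = - G (\<tau> v n) x" for x by (rule skew(1))
  have 3: "G (\<tau> n (\<tau> v n)) w = - G (\<tau> (\<tau> v n) n) w" by (rule skew(1))
  have 4: "G (\<tau> n (\<Gamma> v n)) w = - G (\<tau> (\<Gamma> n v) n) w" unfolding \<Gamma>_sym[of v n] by (rule skew(1))
  have 6: "\<tau> v (- \<Gamma> n n) = - \<tau> v (\<Gamma> n n)" by (rule bilinear_rneg[OF \<tau>])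
  have 7: "G (\<tau> (\<tau> n v) n) w = - G (\<tau> (\<tau> v n) n) w"
    using 1[of "\<tau> n v"] 1[of "\<tau> v n"] skew(1)[of n v "\<tau> n w"] by simp
  show ?thesis
    unfolding R' n' 6 Gs 1 2 3 4
    by (simp add: 7 bilinear_ladd[OF \<tau>] bilinear_lmul[OF \<tau>] Gs algebra_simps)
qed

locale bismut_geodesic = bismut A g J LC + manifold_curve A a b \<gamma>
  for A :: "('m::topological_space, 'e::euclidean_space) chart set" and g J LC a b \<gamma> +
  assumes geodesic: "\<And>t. t \<in> {a..b} \<Longrightarrow> cov_along A LC a b \<gamma> (velocity A a b \<gamma>) t = 0"
begin

definition LC_integrand :: "(real \<Rightarrow> 'e) \<Rightarrow> (real \<Rightarrow> 'e) \<Rightarrow> real \<Rightarrow> real" where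
  "LC_integrand V W t = g (\<gamma> t) (cov_along A LC a b \<gamma> V t) (cov_along A LC a b \<gamma> W t)
     - curvature A g LC (\<gamma> t) (V t) (vel t) (vel t) (W t)"

definition SB_integrand :: "(real \<Rightarrow> 'e) \<Rightarrow> (real \<Rightarrow> 'e) \<Rightarrow> real \<Rightarrow> real" where
  "SB_integrand V W t = g (\<gamma> t) (cov_along A SB a b \<gamma> V t) (cov_along A SB a b \<gamma> W t)
     + torsion A g SB (\<gamma> t) (V t) (vel t) (cov_along A SB a b \<gamma> W t)
     - curvature A g SB (\<gamma> t) (V t) (vel t) (vel t) (W t)"

text \<open>One formula for all times at which the curve runs in \<open>c\<close>; the definition of the integrand uses a
  chart that may jump with \<open>t\<close>.\<close>

lemma LC_integrand_chart:
  assumes c: "c \<in> A" "t \<in> chart_times c"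
    and V: "smooth_field_along A a b \<gamma> V" and W: "smooth_field_along A a b \<gamma> W"
  defines "x \<equiv> path_rep c t" and "n \<equiv> field_rep c vel t" and "v \<equiv> field_rep c V t" and "w \<equiv> field_rep c W t"
  shows "LC_integrand V W t =
    G c x (deriv_along (field_rep c V) t + LC.\<Gamma> c x n v) (deriv_along (field_rep c W) t + LC.\<Gamma> c x n w)
    - G c x (riemann A LC c x v n n) w"
proof -
  have p: "\<gamma> t \<in> cdom c" using c by blast
  have g: "g (\<gamma> t) y z = G c x (tcoord A c (\<gamma> t) y) (tcoord A c (\<gamma> t) z)" for y z
    unfolding x_def by (rule g_chart[OF c(1) p])
  show ?thesis
    unfolding LC_integrand_def LC.curvature_chart[OF c(1) p] g
    using cov_along_chart[OF LC.connection c V] cov_along_chart[OF LC.connection c W] c(1) p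
    by (simp add: field_rep_def x_def n_def v_def w_def)
qed

lemma smooth_imp_continuous_along:
  assumes c: "c \<in> A" and f: "smooth_on (cmap c ` cdom c) f"
  shows "continuous_on (chart_times c) (\<lambda>t. f (path_rep c t))"
  by (rule continuous_on_compose2[OF smooth_on_continuous[OF f] smooth_on_continuous[OF smooth_path_rep[OF c]]]) auto

text \<open>Continuity makes the index form an honest integral. The integrand for \<open>SB\<close> then differs from an
  integrable function by a derivative, so it is integrable as well.\<close>

lemma continuous_LC_integrand:
  assumes V: "smooth_field_along A a b \<gamma> V" and W: "smooth_field_along A a b \<gamma> W"
  shows "continuous_on {a..b} (LC_integrand V W)"
proof -
  have loc: "continuous_on (chart_times c) (LC_integrand V W)" if c: "c \<in> A" for c
  proof -
    let ?X = "path_rep c" and ?S = "chart_times c" and ?Q = "cmap c ` cdom c"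
    note Q = open_cimage[OF c]
    have XQ: "?X t \<in> ?Q" if "t \<in> ?S" for t using that by blast
    have fld: "continuous_on ?S (field_rep c Y)" "continuous_on ?S (deriv_along (field_rep c Y))"
      if "smooth_field_along A a b \<gamma> Y" for Y
      using smooth_field_rep[OF that c] smooth_deriv_along[OF c smooth_field_rep[OF that c]]
      by (auto intro: smooth_on_continuous)
    have \<Gamma>: "continuous_on ?S (\<lambda>t. LC.\<Gamma> c (?X t) (y t) (z t))"
      if "continuous_on ?S y" "continuous_on ?S z" for y z
      by (rule continuous_on_bilinear_family[OF LC.bilinear_christoffel[OF c XQ]
            smooth_imp_continuous_along[OF c LC.smooth_christoffel[OF c]] that])
    have G: "continuous_on ?S (\<lambda>t. G c (?X t) (y t) (z t))"
      if "continuous_on ?S y" "continuous_on ?S z" for y z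
      by (rule continuous_on_bilinear_family[OF bilinear_G[OF c XQ]
            smooth_imp_continuous_along[OF c smooth_G[OF c]] that])
    have d\<Gamma>: "continuous_on ?S (\<lambda>t. frechet_derivative (\<lambda>x. LC.\<Gamma> c x (y t) (z t)) (at (?X t)) (h t))"
      if "continuous_on ?S y" "continuous_on ?S z" "continuous_on ?S h" for y z h
    proof (rule continuous_on_linear_family[OF _ _ that(3)])
      show "linear (frechet_derivative (\<lambda>x. LC.\<Gamma> c x (y t) (z t)) (at (?X t)))" if "t \<in> ?S" for t
        by (rule smooth_on_linear_frechet[OF Q LC.smooth_christoffel[OF c] XQ[OF that]])
      show "continuous_on ?S (\<lambda>t. frechet_derivative (\<lambda>x. LC.\<Gamma> c x (y t) (z t)) (at (?X t)) h)" for h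
      proof (rule continuous_on_bilinear_family[OF _ _ that(1,2)])
        show "bilinear (\<lambda>u v. frechet_derivative (\<lambda>x. LC.\<Gamma> c x u v) (at (?X t)) h)" if "t \<in> ?S" for t
          by (rule bilinear_frechet_family[OF Q XQ[OF that] LC.bilinear_christoffel[OF c] LC.smooth_christoffel[OF c]])
        show "continuous_on ?S (\<lambda>t. frechet_derivative (\<lambda>x. LC.\<Gamma> c x u v) (at (?X t)) h)" for u v
          by (rule smooth_imp_continuous_along[OF c smooth_on_frechet[OF Q LC.smooth_christoffel[OF c]]])
      qed
    qed
    note cont = fld[OF V] fld[OF W] fld(1)[OF smooth_velocity]
    show ?thesis
      by (rule continuous_on_cong[THEN iffD2, OF refl LC_integrand_chart[OF c _ V W]])
        (auto simp only: riemann_def intro!: continuous_on_diff continuous_on_add G \<Gamma> d\<Gamma> cont)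
  qed
  show ?thesis
    unfolding continuous_on_eq_continuous_within
  proof
    fix t assume t: "t \<in> {a..b}"
    let ?c = "chart_at A (\<gamma> t)"
    note c = chart_at[of "\<gamma> t"]
    have "t \<in> chart_times ?c" using t c by blast
    with loc[OF c(1)] have "continuous (at t within chart_times ?c) (LC_integrand V W)"
      unfolding continuous_on_eq_continuous_within by blast
    then show "continuous (at t within {a..b}) (LC_integrand V W)"
      unfolding at_within_times[OF c(1) \<open>t \<in> chart_times ?c\<close>] .
  qed
qed

text \<open>The boundary term is differentiated in the chart chosen at \<open>\<gamma> t\<close>, in which the components at the
  time \<open>t\<close> are the vectors themselves.\<close>

lemma boundary_term_derivative:
  assumes V: "smooth_field_along A a b \<gamma> V" and W: "smooth_field_along A a b \<gamma> W" and t: "t \<in> {a..b}"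
  shows "((\<lambda>t. 1/2 * T (\<gamma> t) (V t) (W t) (vel t)) has_vector_derivative
    LC_integrand V W t - SB_integrand V W t) (at t within {a..b})"
proof -
  define c where "c = chart_at A (\<gamma> t)"
  define x where "x = path_rep c t"
  note c = chart_at[of "\<gamma> t", folded c_def]
  let ?X = "path_rep c" and ?S = "chart_times c" and ?Q = "cmap c ` cdom c"
  let ?r = "\<lambda>Y. field_rep c Y t" and ?d = "\<lambda>Y. deriv_along (field_rep c Y) t"
  let ?d\<tau> = "frechet_derivative (\<lambda>x. \<tau>_rep c x (V t) (vel t)) (at x) (vel t)"
  have tS: "t \<in> ?S" using t c by blast
  have r [simp]: "field_rep c Y t = Y t" for Y by (simp add: field_rep_def c_def)
  have xQ: "x \<in> ?Q" using c by (simp add: x_def)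
  note Q = open_cimage[OF c(1)]
  have XQ: "?X s \<in> ?Q" if "s \<in> ?S" for s using that by blast
  have fld: "(field_rep c Y has_vector_derivative ?d Y) (at t within ?S)" if "smooth_field_along A a b \<gamma> Y" for Y
    using has_deriv_along[OF c(1) smooth_field_rep[OF that c(1)] tS] by (simp only: at_within_times[OF c(1) tS])
  have X: "(?X has_vector_derivative vel t) (at t within ?S)"
    using has_deriv_along[OF c(1) smooth_path_rep[OF c(1)] tS] velocity_chart[OF c(1) tS]
    by (simp only: at_within_times[OF c(1) tS] r)
  note \<tau>' = has_vector_derivative_bilinear_family[OF Q smooth_\<tau>_rep[OF c(1)] bilinear_\<tau>_rep[OF c(1)] XQ X tS
      fld[OF V] fld[OF smooth_velocity], folded x_def, unfolded r]
  note G' = has_vector_derivative_bilinear_family[OF Q smooth_G[OF c(1)] bilinear_G[OF c(1)] XQ X tS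
      \<tau>' fld[OF W], folded x_def, unfolded r metric_rep_derivative[OF c(1) xQ]]
  have T_chart: "1/2 * T (\<gamma> s) (V s) (W s) (vel s) =
      - 1/2 * G c (?X s) (\<tau>_rep c (?X s) (field_rep c V s) (field_rep c vel s)) (field_rep c W s)"
    if "s \<in> ?S" for s
  proof -
    have "\<gamma> s \<in> cdom c" using that by blast
    then show ?thesis
      using T_skew(2)[of "\<gamma> s" "V s" "W s" "vel s"] G_\<tau>_rep[OF c(1) XQ[OF that]] c(1)
      by (simp add: T_rep_def field_rep_def)
  qed
  have deriv: "((\<lambda>t. 1/2 * T (\<gamma> t) (V t) (W t) (vel t)) has_vector_derivative - 1/2 *
     (G c x (LC.\<Gamma> c x (vel t) (\<tau>_rep c x (V t) (vel t))) (W t) + G c x (\<tau>_rep c x (V t) (vel t)) (LC.\<Gamma> c x (vel t) (W t))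
      + G c x (?d\<tau> + \<tau>_rep c x (?d V) (vel t) + \<tau>_rep c x (V t) (?d vel)) (W t)
      + G c x (\<tau>_rep c x (V t) (vel t)) (?d W))) (at t within ?S)"
    by (rule has_vector_derivative_transform[OF tS T_chart has_vector_derivative_mult_right[OF G']])
  have p: "\<gamma> t \<in> cdom c" by (rule c(2))
  have id: "tcoord A c (\<gamma> t) y = y" "tvec A c (\<gamma> t) y = y" for y by (simp_all add: c_def)
  have gG: "g (\<gamma> t) y z = G c x y z" for y z
    using g_chart[OF c, of y z] by (simp add: id x_def)
  have T\<tau>: "T (\<gamma> t) y z u = G c x (\<tau>_rep c x y z) u" for y z u
    using G_\<tau>_rep[OF c(1) xQ, of y z u] c by (simp add: T_rep_def x_def id)
  have skew: "G c x (\<tau>_rep c x y z) u = - G c x (\<tau>_rep c x z y) u"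
      "G c x (\<tau>_rep c x y z) u = - G c x (\<tau>_rep c x y u) z" for y z u
    unfolding T\<tau>[symmetric] by (rule T_skew)+
  have G_sym: "G c x y z = G c x z y" for y z unfolding gG[symmetric] by (rule g_sym)
  have geo: "?d vel = - LC.\<Gamma> c x (vel t) (vel t)"
    using cov_along_chart[OF LC.connection c(1) tS smooth_velocity] geodesic[OF t]
    by (simp add: x_def eq_neg_iff_add_eq_0)
  have covSB: "cov_along A SB a b \<gamma> Y t = ?d Y + LC.\<Gamma> c x (vel t) (Y t) + (1/2) *\<^sub>R \<tau>_rep c x (vel t) (Y t)"
    if "smooth_field_along A a b \<gamma> Y" for Y
    using cov_along_chart[OF SB.connection c(1) tS that] christoffel_SB[OF c(1) xQ] by (simp add: x_def add.assoc)
  have SB: "SB_integrand V W t =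
      G c x (?d V + LC.\<Gamma> c x (vel t) (V t) + (1/2) *\<^sub>R \<tau>_rep c x (vel t) (V t))
        (?d W + LC.\<Gamma> c x (vel t) (W t) + (1/2) *\<^sub>R \<tau>_rep c x (vel t) (W t))
      + G c x (\<tau>_rep c x (V t) (vel t)) (?d W + LC.\<Gamma> c x (vel t) (W t) + (1/2) *\<^sub>R \<tau>_rep c x (vel t) (W t))
      - G c x (riemann A SB c x (V t) (vel t) (vel t)) (W t)"
    unfolding SB_integrand_def torsion_SB T\<tau> covSB[OF V] covSB[OF W] gG SB.curvature_chart[OF c] id x_def[symmetric] ..
  have LC: "LC_integrand V W t =
      G c x (?d V + LC.\<Gamma> c x (vel t) (V t)) (?d W + LC.\<Gamma> c x (vel t) (W t))
      - G c x (riemann A LC c x (V t) (vel t) (vel t)) (W t)"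
    using LC_integrand_chart[OF c(1) tS V W] by (simp add: x_def)
  note identity = index_integrand_identity[OF bilinear_G[OF c(1) xQ] G_sym LC.bilinear_christoffel[OF c(1) xQ]
      christoffel_LC_sym[OF c(1) xQ] bilinear_\<tau>_rep[OF c(1) xQ] skew riemann_SB[OF c(1) xQ] geo]
  have "LC_integrand V W t - SB_integrand V W t = - 1/2 *
     (G c x (LC.\<Gamma> c x (vel t) (\<tau>_rep c x (V t) (vel t))) (W t) + G c x (\<tau>_rep c x (V t) (vel t)) (LC.\<Gamma> c x (vel t) (W t))
      + G c x (?d\<tau> + \<tau>_rep c x (?d V) (vel t) + \<tau>_rep c x (V t) (?d vel)) (W t)
      + G c x (\<tau>_rep c x (V t) (vel t)) (?d W))"
    unfolding LC SB identity by simp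
  with deriv show ?thesis by (simp only: at_within_times[OF c(1) tS])
qed

lemma index_form_SB:
  assumes V: "smooth_field_along A a b \<gamma> V" and W: "smooth_field_along A a b \<gamma> W"
  shows "integral {a..b} (LC_integrand V W) = integral {a..b} (SB_integrand V W)
    + (1/2 * T (\<gamma> b) (V b) (W b) (vel b) - 1/2 * T (\<gamma> a) (V a) (W a) (vel a))"
proof -
  let ?B = "\<lambda>t. 1/2 * T (\<gamma> t) (V t) (W t) (vel t)"
  have 1: "((\<lambda>t. LC_integrand V W t - SB_integrand V W t) has_integral ?B b - ?B a) {a..b}"
    by (rule fundamental_theorem_of_calculus[OF less_imp_le[OF ab] boundary_term_derivative[OF V W]])
  have "(LC_integrand V W has_integral integral {a..b} (LC_integrand V W)) {a..b}"
    by (intro integrable_integral integrable_continuous_real continuous_LC_integrand V W)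
  from has_integral_diff[OF this 1]
  have "integral {a..b} (SB_integrand V W) = integral {a..b} (LC_integrand V W) - (?B b - ?B a)"
    by (intro integral_unique) simp
  then show ?thesis by simp
qed

end

theorem theorem1p2:
  fixes A :: "('m::{t2_space, second_countable_topology}, 'e::euclidean_space) chart set"
    and g :: "'m \<Rightarrow> 'e \<Rightarrow> 'e \<Rightarrow> real"
    and J :: "'m \<Rightarrow> 'e \<Rightarrow> 'e"
    and LC SB :: "('m, 'e) connection"
    and \<gamma> :: "real \<Rightarrow> 'm" and a b :: real
    and V W :: "real \<Rightarrow> 'e"
  assumes "hermitian_manifold A g J"
    and "levi_civita A g LC"
    and "SB = strominger_bismut A g J LC"
    and "a < b"
    and "geodesic A LC a b \<gamma>"
    and "unit_speed A g a b \<gamma>"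
    and "smooth_field_along A a b \<gamma> V"
    and "smooth_field_along A a b \<gamma> W"
  shows "index_form A g LC a b \<gamma> V W =
           integral {a..b} (\<lambda>t.
             g (\<gamma> t) (cov_along A SB a b \<gamma> V t) (cov_along A SB a b \<gamma> W t)
             + torsion A g SB (\<gamma> t) (V t) (velocity A a b \<gamma> t) (cov_along A SB a b \<gamma> W t)
             - curvature A g SB (\<gamma> t) (V t) (velocity A a b \<gamma> t) (velocity A a b \<gamma> t) (W t))
           + (1/2 * torsion A g SB (\<gamma> b) (V b) (W b) (velocity A a b \<gamma> b)
              - 1/2 * torsion A g SB (\<gamma> a) (V a) (W a) (velocity A a b \<gamma> a))
         \<and> index_form A g LC a b \<gamma> V V =
           integral {a..b} (\<lambda>t.
             g (\<gamma> t) (cov_along A SB a b \<gamma> V t) (cov_along A SB a b \<gamma> V t)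
             + torsion A g SB (\<gamma> t) (V t) (velocity A a b \<gamma> t) (cov_along A SB a b \<gamma> V t)
             - curvature A g SB (\<gamma> t) (V t) (velocity A a b \<gamma> t) (velocity A a b \<gamma> t) (V t))"
proof -
  interpret bismut_geodesic A g J LC a b \<gamma>
    by unfold_locales
      (use assms in \<open>auto simp: hermitian_manifold_def integrable_complex_structure_def geodesic_def\<close>)
  have "T p u u w = 0" for p u w using T_skew(1)[of p u u w] by simp
  then show ?thesis
    using index_form_SB[OF assms(7,8)] index_form_SB[OF assms(7,7)]
    unfolding assms(3) index_form_def LC_integrand_def[abs_def] SB_integrand_def[abs_def] torsion_SB by simp
qed

end
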